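(* Let $(M^n,g)$ be a Lie-Hermitian manifold with universal cover $(G,J,g)$. Let $\mathfrak g$ be the Lie algebra of $G$ and $\mathfrak g'=[\mathfrak g,\mathfrak g]$ its commutator. Assume that $\mathfrak g$ is solvable and that $J\mathfrak g'=\mathfrak g'$. If the Chern connection of $g$ has constant holomorphic sectional curvature, i.e. there is a constant $c\in\mathbb R$ such that $H(x)=c$ for every nonzero tangent vector $x$, then $g$ is Chern flat, i.e. the curvature tensor $R$ of the Chern connection vanishes identically.
   Context: A Lie-Hermitian manifold is a compact Hermitian manifold $(M^n,g)$ (of complex dimension $n$) which is a compact quotient $M=G/\Gamma$ of a Lie group $G$ (here simply connected, being the universal cover) by a discrete subgroup $\Gamma\subseteq G$ (acting by left translations), such that the lifts to $G$ of the complex structure $J$ and of the Hermitian metric $g$ are left-invariant. The left-invariant structures $J$ and $g$ on $G$ are identified with the corresponding structures on $\mathfrak g$: a linear map $J:\mathfrak g\to\mathfrak g$ with $J^2=-I$ and $[x,y]-[Jx,Jy]+J[Jx,y]+J[x,Jy]=0$ for all $x,y\in\mathfrak g$, and an inner product $g=\langle\,,\rangle$ on $\mathfrak g$ with $\langle Jx,Jy\rangle=\langle x,y\rangle$. The Chern connection $\nabla$ of a Hermitian manifold is the unique connection with $\nabla g=0$, $\nabla J=0$ whose torsion $T(x,y)=\nabla_xy-\nabla_yx-[x,y]$ (extended complex bilinearly) satisfies $T(X,\overline Y)=0$ for all type $(1,0)$ vectors $X,Y$. Its curvature is $R(x,y,z,w)=\langle \nabla_x\nabla_yz-\nabla_y\nabla_xz-\nabla_{[x,y]}z,\,w\rangle$.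 The holomorphic sectional curvature of the Chern connection is $H(x)=R(x,Jx,Jx,x)/|x|^4$ for real tangent vectors $x\neq0$. *)

theory Defs
  imports
    "HOL-Analysis.Analysis"
    "HOL-Algebra.Coset"
    "HOL-Library.Function_Algebras"
begin

section \<open>Smooth manifolds\<close>

text \<open>
  Both notions below are meant for open \<open>S\<close>, so that derivatives may be taken at the points of
  \<open>S\<close> regardless of the values of \<open>f\<close> outside. In finite dimension, \<open>f\<close> is of class \<open>C\<^sup>k\<^sup>+\<^sup>1\<close> iff
  it is differentiable and all its directional derivatives are of class \<open>C\<^sup>k\<close>.
\<close>

primrec Ck_on :: "nat \<Rightarrow> 'v::euclidean_space set \<Rightarrow> ('v \<Rightarrow> 'w::real_normed_vector) \<Rightarrow> bool" where
  "Ck_on 0 S f \<longleftrightarrow> continuous_on S f"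
| "Ck_on (Suc k) S f \<longleftrightarrow> (\<forall>x\<in>S. f differentiable (at x)) \<and>
     (\<forall>v. Ck_on k S (\<lambda>x. frechet_derivative f (at x) v))"

definition smooth_on :: "'v::euclidean_space set \<Rightarrow> ('v \<Rightarrow> 'w::real_normed_vector) \<Rightarrow> bool" where
  "smooth_on S f \<longleftrightarrow> (\<forall>k. Ck_on k S f)"

text \<open>
  A chart is a pair of a domain and a coordinate map. The manifolds live on the carrier
  \<open>topspace T\<close> of an abstract topology, which allows quotients to be manifolds too. Atlases are
  not required to be maximal.
\<close>

type_synonym ('p, 'v) chart = "'p set \<times> ('p \<Rightarrow> 'v)"

definition is_chart :: "'p topology \<Rightarrow> ('p, 'v::euclidean_space) chart \<Rightarrow> bool" where
  "is_chart T = (\<lambda>(U, \<phi>). openin T U \<and> open (\<phi> ` U) \<and>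
     homeomorphic_map (subtopology T U) (top_of_set (\<phi> ` U)) \<phi>)"

definition smooth_manifold :: "'p topology \<Rightarrow> ('p, 'v::euclidean_space) chart set \<Rightarrow> bool" where
  "smooth_manifold T A \<longleftrightarrow>
     Hausdorff_space T \<and> second_countable T \<and>
     (\<forall>ch\<in>A. is_chart T ch) \<and> \<Union>(fst ` A) = topspace T \<and>
     (\<forall>(U, \<phi>)\<in>A. \<forall>(V, \<psi>)\<in>A. smooth_on (\<phi> ` (U \<inter> V)) (\<psi> \<circ> inv_into U \<phi>))"

definition mcarrier :: "('p, 'v) chart set \<Rightarrow> 'p set" where
  "mcarrier A = \<Union>(fst ` A)"

definition prod_atlas ::
  "('p, 'v) chart set \<Rightarrow> ('q, 'w) chart set \<Rightarrow> ('p \<times> 'q, 'v \<times> 'w) chart set" where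
  "prod_atlas A B = {(U \<times> V, map_prod \<phi> \<psi>) |U \<phi> V \<psi>. (U, \<phi>) \<in> A \<and> (V, \<psi>) \<in> B}"

definition smooth_map ::
  "'p topology \<Rightarrow> ('p, 'v::euclidean_space) chart set \<Rightarrow>
   'q topology \<Rightarrow> ('q, 'w::euclidean_space) chart set \<Rightarrow> ('p \<Rightarrow> 'q) \<Rightarrow> bool" where
  "smooth_map T A T' B F \<longleftrightarrow> continuous_map T T' F \<and>
     (\<forall>(U, \<phi>)\<in>A. \<forall>(V, \<psi>)\<in>B. smooth_on (\<phi> ` (U \<inter> F -` V)) (\<psi> \<circ> F \<circ> inv_into U \<phi>))"

definition smooth_fun :: "('p, 'v::euclidean_space) chart set \<Rightarrow> ('p \<Rightarrow> real) \<Rightarrow> bool" where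
  "smooth_fun A f \<longleftrightarrow> (\<forall>(U, \<phi>)\<in>A. smooth_on (\<phi> ` U) (f \<circ> inv_into U \<phi>))"


section \<open>Tangent vectors and vector fields\<close>

text \<open>
  A tangent vector at \<open>p\<close> is identified with the directional derivative that it defines on smooth
  functions. To make equality of tangent vectors (and of vector fields) the equality of HOL, the
  functional is set to \<open>0\<close> on functions that are not smooth, and vector fields are set to \<open>0\<close>
  outside the manifold. Sums and differences are the pointwise ones.
\<close>

type_synonym 'p tvec = "('p \<Rightarrow> real) \<Rightarrow> real"
type_synonym 'p vfield = "'p \<Rightarrow> 'p tvec"

definition coord_tvec ::
  "('p, 'v::euclidean_space) chart set \<Rightarrow> ('p, 'v) chart \<Rightarrow> 'p \<Rightarrow> 'v \<Rightarrow> 'p tvec" where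
  "coord_tvec A = (\<lambda>(U, \<phi>) p \<xi> f.
     if smooth_fun A f then frechet_derivative (f \<circ> inv_into U \<phi>) (at (\<phi> p)) \<xi> else 0)"

definition tangent_space :: "('p, 'v::euclidean_space) chart set \<Rightarrow> 'p \<Rightarrow> 'p tvec set" where
  "tangent_space A p = {coord_tvec A ch p \<xi> |ch \<xi>. ch \<in> A \<and> p \<in> fst ch}"

definition vector_fields :: "('p, 'v::euclidean_space) chart set \<Rightarrow> 'p vfield set" where
  "vector_fields A = {X. (\<forall>p. p \<notin> mcarrier A \<longrightarrow> X p = 0) \<and>
     (\<forall>(U, \<phi>)\<in>A. \<exists>\<xi>. smooth_on (\<phi> ` U) \<xi> \<and>
        (\<forall>p\<in>U. X p = coord_tvec A (U, \<phi>) p (\<xi> (\<phi> p))))}"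

definition fscale :: "('p \<Rightarrow> real) \<Rightarrow> 'p vfield \<Rightarrow> 'p vfield" where
  "fscale h X = (\<lambda>p f. h p * X p f)"

definition vderiv :: "'p vfield \<Rightarrow> ('p \<Rightarrow> real) \<Rightarrow> 'p \<Rightarrow> real" where
  "vderiv X f = (\<lambda>p. X p f)"

definition lie_bracket :: "'p vfield \<Rightarrow> 'p vfield \<Rightarrow> 'p vfield" where
  "lie_bracket X Y = (\<lambda>p f. X p (vderiv Y f) - Y p (vderiv X f))"

text \<open>The differential of \<open>F\<close> (into the manifold with atlas \<open>B\<close>) on tangent vectors.\<close>

definition differential ::
  "('q, 'w::euclidean_space) chart set \<Rightarrow> ('p \<Rightarrow> 'q) \<Rightarrow> 'p tvec \<Rightarrow> 'q tvec" where
  "differential B F x = (\<lambda>f. if smooth_fun B f then x (f \<circ> F) else 0)"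


section \<open>Hermitian manifolds\<close>

type_synonym 'p endo_field = "'p \<Rightarrow> 'p tvec \<Rightarrow> 'p tvec"
type_synonym 'p metric_field = "'p \<Rightarrow> 'p tvec \<Rightarrow> 'p tvec \<Rightarrow> real"

definition endo_app :: "'p endo_field \<Rightarrow> 'p vfield \<Rightarrow> 'p vfield" where
  "endo_app J X = (\<lambda>p. J p (X p))"

definition metric_app :: "'p metric_field \<Rightarrow> 'p vfield \<Rightarrow> 'p vfield \<Rightarrow> 'p \<Rightarrow> real" where
  "metric_app g X Y = (\<lambda>p. g p (X p) (Y p))"

definition complex_structure :: "('p, 'v::euclidean_space) chart set \<Rightarrow> 'p endo_field \<Rightarrow> bool" where
  "complex_structure A J \<longleftrightarrow>
     (\<forall>p\<in>mcarrier A. \<forall>x\<in>tangent_space A p.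
        J p x \<in> tangent_space A p \<and> J p (J p x) = - x \<and>
        (\<forall>y\<in>tangent_space A p. J p (x + y) = J p x + J p y) \<and>
        (\<forall>c. J p (\<lambda>f. c * x f) = (\<lambda>f. c * J p x f))) \<and>
     (\<forall>X\<in>vector_fields A. endo_app J X \<in> vector_fields A) \<and>
     (\<forall>X\<in>vector_fields A. \<forall>Y\<in>vector_fields A.
        lie_bracket X Y - lie_bracket (endo_app J X) (endo_app J Y)
        + endo_app J (lie_bracket (endo_app J X) Y)
        + endo_app J (lie_bracket X (endo_app J Y)) = 0)"

definition riemannian_metric :: "('p, 'v::euclidean_space) chart set \<Rightarrow> 'p metric_field \<Rightarrow> bool" where
  "riemannian_metric A g \<longleftrightarrow>
     (\<forall>p\<in>mcarrier A. \<forall>x\<in>tangent_space A p.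
        (x \<noteq> 0 \<longrightarrow> g p x x > 0) \<and>
        (\<forall>y\<in>tangent_space A p. g p x y = g p y x \<and>
           (\<forall>z\<in>tangent_space A p. g p (x + y) z = g p x z + g p y z) \<and>
           (\<forall>c. g p (\<lambda>f. c * x f) y = c * g p x y))) \<and>
     (\<forall>X\<in>vector_fields A. \<forall>Y\<in>vector_fields A. smooth_fun A (metric_app g X Y))"

definition hermitian_manifold ::
  "'p topology \<Rightarrow> ('p, 'v::euclidean_space) chart set \<Rightarrow> 'p endo_field \<Rightarrow> 'p metric_field \<Rightarrow> bool" where
  "hermitian_manifold T A J g \<longleftrightarrow>
     smooth_manifold T A \<and> complex_structure A J \<and> riemannian_metric A g \<and>
     (\<forall>p\<in>mcarrier A. \<forall>x\<in>tangent_space A p. \<forall>y\<in>tangent_space A p.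
        g p (J p x) (J p y) = g p x y)"


section \<open>The Chern connection and its curvature\<close>

type_synonym 'p connection = "'p vfield \<Rightarrow> 'p vfield \<Rightarrow> 'p vfield"

definition affine_connection :: "('p, 'v::euclidean_space) chart set \<Rightarrow> 'p connection \<Rightarrow> bool" where
  "affine_connection A D \<longleftrightarrow>
     (\<forall>X\<in>vector_fields A. \<forall>Y\<in>vector_fields A. D X Y \<in> vector_fields A \<and>
        (\<forall>Z\<in>vector_fields A. D (X + Y) Z = D X Z + D Y Z \<and> D X (Y + Z) = D X Y + D X Z) \<and>
        (\<forall>f. smooth_fun A f \<longrightarrow>
           D (fscale f X) Y = fscale f (D X Y) \<and>
           D X (fscale f Y) = fscale (vderiv X f) Y + fscale f (D X Y)))"

definition torsion :: "'p connection \<Rightarrow> 'p vfield \<Rightarrow> 'p vfield \<Rightarrow> 'p vfield" where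
  "torsion D X Y = D X Y - D Y X - lie_bracket X Y"

text \<open>
  A complex vector field \<open>X + iY\<close>, i.e. a section of the complexified tangent bundle, is
  represented by the pair \<open>(X, Y)\<close>. It is of type \<open>(1,0)\<close> if \<open>J (X + iY) = i (X + iY)\<close>.
\<close>

definition complex_bilinear_ext ::
  "('p vfield \<Rightarrow> 'p vfield \<Rightarrow> 'p vfield) \<Rightarrow>
   'p vfield \<times> 'p vfield \<Rightarrow> 'p vfield \<times> 'p vfield \<Rightarrow> 'p vfield \<times> 'p vfield" where
  "complex_bilinear_ext S = (\<lambda>(X1, X2) (Y1, Y2). (S X1 Y1 - S X2 Y2, S X1 Y2 + S X2 Y1))"

definition type10_fields ::
  "('p, 'v::euclidean_space) chart set \<Rightarrow> 'p endo_field \<Rightarrow> ('p vfield \<times> 'p vfield) set" where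
  "type10_fields A J = {(X, Y). X \<in> vector_fields A \<and> Y \<in> vector_fields A \<and>
     (endo_app J X, endo_app J Y) = (- Y, X)}"

definition conj_field :: "'p vfield \<times> 'p vfield \<Rightarrow> 'p vfield \<times> 'p vfield" where
  "conj_field = (\<lambda>(X, Y). (X, - Y))"

definition chern_connection ::
  "('p, 'v::euclidean_space) chart set \<Rightarrow> 'p endo_field \<Rightarrow> 'p metric_field \<Rightarrow> 'p connection \<Rightarrow> bool" where
  "chern_connection A J g D \<longleftrightarrow> affine_connection A D \<and>
     (\<forall>X\<in>vector_fields A. \<forall>Y\<in>vector_fields A. \<forall>Z\<in>vector_fields A. \<forall>p\<in>mcarrier A.
        vderiv X (metric_app g Y Z) p = metric_app g (D X Y) Z p + metric_app g Y (D X Z) p) \<and>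
     (\<forall>X\<in>vector_fields A. \<forall>Y\<in>vector_fields A. D X (endo_app J Y) = endo_app J (D X Y)) \<and>
     (\<forall>Z\<in>type10_fields A J. \<forall>W\<in>type10_fields A J.
        complex_bilinear_ext (torsion D) Z (conj_field W) = (0, 0))"

definition curvature ::
  "'p metric_field \<Rightarrow> 'p connection \<Rightarrow> 'p vfield \<Rightarrow> 'p vfield \<Rightarrow> 'p vfield \<Rightarrow> 'p vfield \<Rightarrow> 'p \<Rightarrow> real" where
  "curvature g D X Y Z W =
     metric_app g (D X (D Y Z) - D Y (D X Z) - D (lie_bracket X Y) Z) W"

text \<open>
  The curvature is a tensor, so the value at \<open>p\<close> depends only on the tangent vector \<open>X p\<close>. Every
  tangent vector at \<open>p\<close> is the value at \<open>p\<close> of some vector field.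
\<close>

definition hol_sect_curv ::
  "'p endo_field \<Rightarrow> 'p metric_field \<Rightarrow> 'p connection \<Rightarrow> 'p vfield \<Rightarrow> 'p \<Rightarrow> real" where
  "hol_sect_curv J g D X p =
     curvature g D X (endo_app J X) (endo_app J X) X p / (g p (X p) (X p))\<^sup>2"

definition const_hol_sect_curv ::
  "('p, 'v::euclidean_space) chart set \<Rightarrow> 'p endo_field \<Rightarrow> 'p metric_field \<Rightarrow> 'p connection \<Rightarrow> real \<Rightarrow> bool" where
  "const_hol_sect_curv A J g D c \<longleftrightarrow>
     (\<forall>p\<in>mcarrier A. \<forall>x\<in>tangent_space A p. x \<noteq> 0 \<longrightarrow>
        (\<forall>X\<in>vector_fields A. X p = x \<longrightarrow> hol_sect_curv J g D X p = c))"

definition flat_connection ::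
  "('p, 'v::euclidean_space) chart set \<Rightarrow> 'p metric_field \<Rightarrow> 'p connection \<Rightarrow> bool" where
  "flat_connection A g D \<longleftrightarrow>
     (\<forall>X\<in>vector_fields A. \<forall>Y\<in>vector_fields A. \<forall>Z\<in>vector_fields A. \<forall>W\<in>vector_fields A.
        \<forall>p\<in>mcarrier A. curvature g D X Y Z W p = 0)"


section \<open>Lie groups and their Lie algebras\<close>

definition lie_group ::
  "('g, 'b) monoid_scheme \<Rightarrow> 'g topology \<Rightarrow> ('g, 'v::euclidean_space) chart set \<Rightarrow> bool" where
  "lie_group G T A \<longleftrightarrow>
     group G \<and> smooth_manifold T A \<and> topspace T = carrier G \<and>
     smooth_map (prod_topology T T) (prod_atlas A A) T A (\<lambda>(a, b). a \<otimes>\<^bsub>G\<^esub> b) \<and>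
     smooth_map T A T A (\<lambda>a. inv\<^bsub>G\<^esub> a)"

definition left_invariant_fields ::
  "('g, 'b) monoid_scheme \<Rightarrow> ('g, 'v::euclidean_space) chart set \<Rightarrow> 'g vfield set" where
  "left_invariant_fields G A = {X\<in>vector_fields A. \<forall>a\<in>carrier G. \<forall>p\<in>carrier G.
     X (a \<otimes>\<^bsub>G\<^esub> p) = differential A (\<lambda>q. a \<otimes>\<^bsub>G\<^esub> q) (X p)}"

definition left_invariant_endo ::
  "('g, 'b) monoid_scheme \<Rightarrow> ('g, 'v::euclidean_space) chart set \<Rightarrow> 'g endo_field \<Rightarrow> bool" where
  "left_invariant_endo G A J \<longleftrightarrow>
     (\<forall>a\<in>carrier G. \<forall>p\<in>carrier G. \<forall>x\<in>tangent_space A p.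
        J (a \<otimes>\<^bsub>G\<^esub> p) (differential A (\<lambda>q. a \<otimes>\<^bsub>G\<^esub> q) x) =
        differential A (\<lambda>q. a \<otimes>\<^bsub>G\<^esub> q) (J p x))"

definition left_invariant_metric ::
  "('g, 'b) monoid_scheme \<Rightarrow> ('g, 'v::euclidean_space) chart set \<Rightarrow> 'g metric_field \<Rightarrow> bool" where
  "left_invariant_metric G A g \<longleftrightarrow>
     (\<forall>a\<in>carrier G. \<forall>p\<in>carrier G. \<forall>x\<in>tangent_space A p. \<forall>y\<in>tangent_space A p.
        g (a \<otimes>\<^bsub>G\<^esub> p) (differential A (\<lambda>q. a \<otimes>\<^bsub>G\<^esub> q) x) (differential A (\<lambda>q. a \<otimes>\<^bsub>G\<^esub> q) y) =
        g p x y)"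

definition commutator_space :: "'p vfield set \<Rightarrow> 'p vfield set \<Rightarrow> 'p vfield set" where
  "commutator_space S S' =
     module.span (\<lambda>c. fscale (\<lambda>_. c)) {lie_bracket X Y |X Y. X \<in> S \<and> Y \<in> S'}"

primrec derived_series :: "'p vfield set \<Rightarrow> nat \<Rightarrow> 'p vfield set" where
  "derived_series L 0 = L"
| "derived_series L (Suc k) = commutator_space (derived_series L k) (derived_series L k)"

definition solvable_lie_algebra :: "'p vfield set \<Rightarrow> bool" where
  "solvable_lie_algebra L \<longleftrightarrow> (\<exists>k. derived_series L k = {0})"


section \<open>Lie-Hermitian manifolds\<close>

text \<open>
  The library's \<^const>\<open>simply_connected\<close> is about subsets of types with a topology; this is its
  definition for an abstract topology. It includes path-connectedness (take constant loops).
\<close>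

definition simply_connected_space :: "'p topology \<Rightarrow> bool" where
  "simply_connected_space T \<longleftrightarrow>
     (\<forall>p q. pathin T p \<and> p 1 = p 0 \<and> pathin T q \<and> q 1 = q 0 \<longrightarrow>
        homotopic_with (\<lambda>r. r 1 = r 0) (top_of_set {0..1}) T p q)"

definition quotient_topology :: "'p topology \<Rightarrow> ('p \<Rightarrow> 'q) \<Rightarrow> 'q topology" where
  "quotient_topology T \<pi> =
     topology (\<lambda>W. W \<subseteq> \<pi> ` topspace T \<and> openin T {x \<in> topspace T. \<pi> x \<in> W})"

lemma quotient_map_quotient_topology: "quotient_map T (quotient_topology T \<pi>) \<pi>"
proof -
  let ?P = "\<lambda>W. W \<subseteq> \<pi> ` topspace T \<and> openin T {x \<in> topspace T. \<pi> x \<in> W}"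
  have "istopology ?P"
    unfolding istopology_def
  proof (intro conjI allI impI)
    fix S S' assume "?P S" "?P S'"
    moreover have "{x \<in> topspace T. \<pi> x \<in> S \<inter> S'} =
        {x \<in> topspace T. \<pi> x \<in> S} \<inter> {x \<in> topspace T. \<pi> x \<in> S'}" by auto
    ultimately show "S \<inter> S' \<subseteq> \<pi> ` topspace T"
      and "openin T {x \<in> topspace T. \<pi> x \<in> S \<inter> S'}" by auto
  next
    fix \<K> assume K: "\<forall>K\<in>\<K>. ?P K"
    have "{x \<in> topspace T. \<pi> x \<in> \<Union>\<K>} = \<Union>((\<lambda>K. {x \<in> topspace T. \<pi> x \<in> K}) ` \<K>)" by auto
    then show "openin T {x \<in> topspace T. \<pi> x \<in> \<Union>\<K>}" using K by auto
    show "\<Union>\<K> \<subseteq> \<pi> ` topspace T" using K by auto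
  qed
  then have o: "openin (quotient_topology T \<pi>) W \<longleftrightarrow> ?P W" for W
    by (simp add: quotient_topology_def)
  have "{x \<in> topspace T. \<pi> x \<in> \<pi> ` topspace T} = topspace T" by auto
  then have "openin (quotient_topology T \<pi>) (\<pi> ` topspace T)" by (simp add: o)
  then have "topspace (quotient_topology T \<pi>) = \<pi> ` topspace T"
    using o openin_subset openin_topspace by (metis subset_antisym)
  then show ?thesis by (auto simp: quotient_map_def o)
qed

text \<open>The charts of the quotient are the local inverses of \<open>\<pi>\<close> followed by charts.\<close>

definition quotient_atlas ::
  "'p topology \<Rightarrow> ('p, 'v::euclidean_space) chart set \<Rightarrow> ('p \<Rightarrow> 'q) \<Rightarrow> ('q, 'v) chart set" where
  "quotient_atlas T A \<pi> =
     {(\<pi> ` V, \<phi> \<circ> inv_into V \<pi>) |U V \<phi>. (U, \<phi>) \<in> A \<and> V \<subseteq> U \<and> openin T V \<and> inj_on \<pi> V}"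

text \<open>
  The quotient is by the action of \<open>\<Gamma>\<close> by left translations, whose orbits are the right cosets
  \<open>\<Gamma> #> a\<close>.
\<close>

abbreviation coset_proj :: "('g, 'b) monoid_scheme \<Rightarrow> 'g set \<Rightarrow> 'g \<Rightarrow> 'g set" where
  "coset_proj G \<Gamma> \<equiv> (\<lambda>a. \<Gamma> #>\<^bsub>G\<^esub> a)"

abbreviation left_quotient_topology ::
  "('g, 'b) monoid_scheme \<Rightarrow> 'g topology \<Rightarrow> 'g set \<Rightarrow> 'g set topology" where
  "left_quotient_topology G T \<Gamma> \<equiv> quotient_topology T (coset_proj G \<Gamma>)"

abbreviation left_quotient_atlas ::
  "('g, 'b) monoid_scheme \<Rightarrow> 'g topology \<Rightarrow> ('g, 'v::euclidean_space) chart set \<Rightarrow> 'g set \<Rightarrow>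
   ('g set, 'v) chart set" where
  "left_quotient_atlas G T A \<Gamma> \<equiv> quotient_atlas T A (coset_proj G \<Gamma>)"

text \<open>
  The parameters are the simply connected Lie group \<open>G\<close> (with topology \<open>T\<close> and atlas \<open>A\<close>), the
  discrete subgroup \<open>\<Gamma>\<close>, the Hermitian structure \<open>(J, g)\<close> of the compact quotient, and its lift
  \<open>(J', g')\<close> to \<open>G\<close>.
\<close>

definition lie_hermitian_manifold ::
  "('g, 'b) monoid_scheme \<Rightarrow> 'g topology \<Rightarrow> ('g, 'v::euclidean_space) chart set \<Rightarrow> 'g set \<Rightarrow>
   'g set endo_field \<Rightarrow> 'g set metric_field \<Rightarrow> 'g endo_field \<Rightarrow> 'g metric_field \<Rightarrow> bool" where
  "lie_hermitian_manifold G T A \<Gamma> J g J' g' \<longleftrightarrow>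
     lie_group G T A \<and> simply_connected_space T \<and>
     subgroup \<Gamma> G \<and> subtopology T \<Gamma> = discrete_topology \<Gamma> \<and>
     compact_space (left_quotient_topology G T \<Gamma>) \<and>
     hermitian_manifold (left_quotient_topology G T \<Gamma>) (left_quotient_atlas G T A \<Gamma>) J g \<and>
     hermitian_manifold T A J' g' \<and>
     (let d\<pi> = differential (left_quotient_atlas G T A \<Gamma>) (coset_proj G \<Gamma>) in
      \<forall>p\<in>carrier G. \<forall>x\<in>tangent_space A p.
        d\<pi> (J' p x) = J (coset_proj G \<Gamma> p) (d\<pi> x) \<and>
        (\<forall>y\<in>tangent_space A p. g' p x y = g (coset_proj G \<Gamma> p) (d\<pi> x) (d\<pi> y))) \<and>
     left_invariant_endo G A J' \<and> left_invariant_metric G A g'"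

end

theory Submission
  imports Defs
begin

text \<open>
  On the Lie algebra, the (0,1) part of the Chern connection is \<open>B x y = ([x, y] + J [J x, y]) / 2\<close>,
  so the connection itself is \<open>B x\<close> minus its adjoint \<open>D x\<close>, and the holomorphic sectional curvature
  is \<open>c\<close> iff \<open>\<bar>D x x\<bar>\<^sup>2 - \<bar>B x x\<bar>\<^sup>2 - 2 \<langle>B (B x x) x, x\<rangle> = c / 2 \<bar>x\<bar>\<^sup>4\<close>. As \<open>J \<gg>' = \<gg>'\<close>, the values
  of \<open>B\<close> lie in \<open>\<gg>'\<close> and \<open>D x\<close> vanishes on its orthogonal complement \<open>W\<close>. A vector of \<open>W\<close> shows
  \<open>c \<le> 0\<close>, and a central vector of the nilpotent algebra \<open>\<gg>'\<close> shows \<open>c \<ge> 0\<close>. For \<open>c = 0\<close>, polarisation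
  yields \<open>[w, J w] = 0\<close> for \<open>w \<in> W\<close>, and a trace argument then gives \<open>B x w = 0\<close> and \<open>\<bar>D w u\<bar> = \<bar>B w u\<bar>\<close>
  for \<open>u \<in> \<gg>'\<close>. The same applies to \<open>\<gg>'\<close> in place of \<open>\<gg>\<close> and the \<open>J\<close>-hull of its commutator algebra,
  and so on. There the operators \<open>B w\<close> are nilpotent and normal, hence zero. So \<open>B\<close> vanishes on \<open>\<gg>'\<close>,
  the remaining \<open>B w\<close> commute with each other and with their adjoints, and the curvature is zero.

  Left-invariant fields descend to a global frame of the quotient, which may be taken orthonormal
  and in which the Chern connection has constant coefficients. As the curvature is tensorial, it is
  determined by the Lie algebra.
\<close>

section \<open>Solvable Lie algebras\<close>

text \<open>Traces stand in for eigenvalues. A real solvable algebra need not have a common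
  eigenvector, so nilpotency of \<gg>' comes from a vector annihilated by \<gg>' in a suitable
  representation, and its source is that the identity of a nonzero space is not a commutator. In the
  flat case the coefficient of t^2 in the curvature along w + t u, averaged over u and J u, is |D w
  u|^2 - |B w u|^2 - |B u w|^2 - 2 <B (B u w) w, u>. Summed over an orthonormal basis of \<gg>', the
  first two terms cancel, since adjoint maps have equal Hilbert-Schmidt norms; the last term is the
  trace of the square of the antilinear map u -> B u w, and [w, J w] = 0 makes it zero. Only the
  squares |B u w|^2 remain, so they vanish. The descent inside \<gg>' needs J-stable ideals, and the
  commutator algebra of \<gg>' need not be one, whence the J-hull. Once B annihilates W in its
  second argument, D preserves the ideal, so restricting the algebra does not change the curvature
  expression.\<close>

lemma orthonormal_basis_obtain:
  fixes U :: "'a::euclidean_space set"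
  assumes "subspace U"
  obtains E where "finite E" "E \<subseteq> U" "card E = dim U"
    "\<And>x. x \<in> U \<Longrightarrow> (\<Sum>e\<in>E. (x \<bullet> e) *\<^sub>R e) = x"
    "\<And>e. e \<in> E \<Longrightarrow> e \<bullet> e = 1"
proof -
  obtain E where E: "E \<subseteq> U" "pairwise orthogonal E" "\<And>x. x \<in> E \<Longrightarrow> norm x = 1"
     "independent E" "card E = dim U" "span E = U"
    using orthonormal_basis_subspace[OF assms] by metis
  have fin: "finite E" using E(4) independent_imp_finite by blast
  show thesis
  proof (rule that[OF fin E(1,5)])
    show "(\<Sum>e\<in>E. (x \<bullet> e) *\<^sub>R e) = x" if "x \<in> U" for x
      using orthonormal_basis_expand[OF E(2,3) _ fin] that E(6) by auto
    show "e \<bullet> e = 1" if "e \<in> E" for e using E(3)[OF that] by (simp add: norm_eq_1)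
  qed
qed

text \<open>Both sides expand to the double sum of
  \<open>(h e \<bullet> d) * (f d \<bullet> e)\<close>, in which \<open>f\<close> and
  \<open>h\<close> may be exchanged. The maps live on the whole space and are only required to
  preserve \<open>U\<close>, so that traces on an ideal need no restricted maps.\<close>

lemma trace_commute:
  fixes f h :: "'a::euclidean_space \<Rightarrow> 'a"
  assumes "linear f" "linear h"
    and exp: "\<And>x. x \<in> U \<Longrightarrow> (\<Sum>e\<in>E. (x \<bullet> e) *\<^sub>R e) = x" and "E \<subseteq> U"
    and f: "\<And>x. x \<in> U \<Longrightarrow> f x \<in> U" and h: "\<And>x. x \<in> U \<Longrightarrow> h x \<in> U"
  shows "(\<Sum>e\<in>E. f (h e) \<bullet> e) = (\<Sum>e\<in>E. h (f e) \<bullet> e)"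
proof -
  have *: "(\<Sum>e\<in>E. f (h e) \<bullet> e) = (\<Sum>e\<in>E. \<Sum>d\<in>E. (h e \<bullet> d) * (f d \<bullet> e))"
    if "linear f" "\<And>x. x \<in> U \<Longrightarrow> h x \<in> U" for f h
  proof (rule sum.cong[OF refl])
    fix e assume "e \<in> E"
    then have "h e = (\<Sum>d\<in>E. (h e \<bullet> d) *\<^sub>R d)" using exp that \<open>E \<subseteq> U\<close> by (metis subsetD)
    then have "f (h e) = (\<Sum>d\<in>E. (h e \<bullet> d) *\<^sub>R f d)"
      using linear_sum[OF \<open>linear f\<close>] linear_cmul[OF \<open>linear f\<close>] by (metis (no_types, lifting) sum.cong)
    then show "f (h e) \<bullet> e = (\<Sum>d\<in>E. (h e \<bullet> d) * (f d \<bullet> e))"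
      by (simp add: inner_sum_left)
  qed
  have "(\<Sum>e\<in>E. f (h e) \<bullet> e) = (\<Sum>e\<in>E. \<Sum>d\<in>E. (h e \<bullet> d) * (f d \<bullet> e))"
    using *[of f h] assms(1) h by blast
  also have "\<dots> = (\<Sum>e\<in>E. \<Sum>d\<in>E. (f e \<bullet> d) * (h d \<bullet> e))"
    by (subst sum.swap) (simp add: mult.commute)
  also have "\<dots> = (\<Sum>e\<in>E. h (f e) \<bullet> e)"
    using *[of h f] assms(2) f by simp
  finally show ?thesis .
qed

text \<open>Both sums collect the squares of the matrix entries \<open>f e \<bullet> d\<close>, one
  by rows and the other by columns.\<close>

lemma sum_adjoint_norm:
  fixes f h :: "'a::euclidean_space \<Rightarrow> 'a"
  assumes exp: "\<And>x. x \<in> U \<Longrightarrow> (\<Sum>e\<in>E. (x \<bullet> e) *\<^sub>R e) = x" and "E \<subseteq> U"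
    and f: "\<And>x. x \<in> U \<Longrightarrow> f x \<in> U" and h: "\<And>x. x \<in> U \<Longrightarrow> h x \<in> U"
    and adj: "\<And>x y. x \<in> U \<Longrightarrow> y \<in> U \<Longrightarrow> f x \<bullet> y = x \<bullet> h y"
  shows "(\<Sum>e\<in>E. f e \<bullet> f e) = (\<Sum>e\<in>E. h e \<bullet> h e)"
proof -
  have *: "x \<bullet> x = (\<Sum>d\<in>E. (x \<bullet> d)\<^sup>2)" if "x \<in> U" for x
  proof -
    have "x \<bullet> x = x \<bullet> (\<Sum>d\<in>E. (x \<bullet> d) *\<^sub>R d)" using exp[OF that] by simp
    then show ?thesis by (simp add: inner_sum_right power2_eq_square)
  qed
  have "(\<Sum>e\<in>E. f e \<bullet> f e) = (\<Sum>e\<in>E. \<Sum>d\<in>E. (f e \<bullet> d)\<^sup>2)"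
    using * f \<open>E \<subseteq> U\<close> by (intro sum.cong) auto
  also have "\<dots> = (\<Sum>e\<in>E. \<Sum>d\<in>E. (h d \<bullet> e)\<^sup>2)"
    using adj \<open>E \<subseteq> U\<close> by (intro sum.cong refl) (metis inner_commute subsetD)
  also have "\<dots> = (\<Sum>d\<in>E. h d \<bullet> h d)"
    using * h \<open>E \<subseteq> U\<close> by (subst sum.swap) (intro sum.cong, auto)
  finally show ?thesis .
qed

text \<open>The property is left open because it serves for subspaces invariant under the whole
  algebra and also for those invariant under one term of the derived series.\<close>

lemma minimal_subspace:
  fixes m :: "'a::euclidean_space set"
  assumes "subspace m" "m \<noteq> {0}" "P m"
  shows "\<exists>m0. (subspace m0 \<and> m0 \<noteq> {0} \<and> m0 \<subseteq> m \<and> P m0) \<and>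
    (\<forall>n. subspace n \<longrightarrow> n \<noteq> {0} \<longrightarrow> n \<subseteq> m0 \<longrightarrow> P n \<longrightarrow> n = m0)"
proof -
  let ?Q = "\<lambda>n. subspace n \<and> n \<noteq> {0} \<and> n \<subseteq> m \<and> P n"
  have "?Q m" using assms by simp
  then obtain m0 where m0: "?Q m0" "\<And>n. ?Q n \<Longrightarrow> dim m0 \<le> dim n"
    using ex_has_least_nat[of ?Q m dim] by auto
  have "n = m0" if n: "subspace n" "n \<noteq> {0}" "n \<subseteq> m0" "P n" for n
  proof -
    have "dim m0 \<le> dim n" using m0 n by auto
    then show "n = m0" using n m0(1) subspace_dim_equal by blast
  qed
  then show ?thesis using m0(1) by blast
qed

text \<open>
  If \<open>b = [y, a]\<close> were invertible with \<open>b a = a b\<close>, the identity would be the commutator of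
  \<open>b\<inverse> y\<close> and \<open>a\<close>, which has trace zero.
\<close>

lemma commutator_singular:
  fixes a b y :: "'a::euclidean_space \<Rightarrow> 'a"
  assumes lin: "linear a" "linear b" "linear y" and m: "subspace m" "m \<noteq> {0}"
    and inv: "\<And>v. v \<in> m \<Longrightarrow> a v \<in> m" "\<And>v. v \<in> m \<Longrightarrow> b v \<in> m" "\<And>v. v \<in> m \<Longrightarrow> y v \<in> m"
    and b: "\<And>v. v \<in> m \<Longrightarrow> b v = y (a v) - a (y v)"
    and comm: "\<And>v. v \<in> m \<Longrightarrow> a (b v) = b (a v)"
  shows "\<exists>v\<in>m. v \<noteq> 0 \<and> b v = 0"
proof (rule ccontr)
  assume "\<not> ?thesis"
  then have "inj_on b (span m)"
    using m lin by (simp add: linear_inj_on_iff_eq_0 span_eq_iff[THEN iffD2], blast)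
  then obtain h where h: "range h \<subseteq> span m" "linear h" "\<And>x. x \<in> span m \<Longrightarrow> h (b x) = x"
    using linear_inj_on_left_inverse[OF lin(2)] by metis
  have sm: "span m = m" using m(1) by (simp add: span_eq_iff)
  have dm: "dim (b ` m) = dim m"
    using dim_image_eq[OF lin(2)] \<open>inj_on b (span m)\<close> by blast
  have bm: "b ` m = m"
    by (rule subspace_dim_equal[OF linear_subspace_image[OF lin(2) m(1)] m(1)]) (use inv(2) dm in auto)
  have ha: "h (a v) = a (h v)" if "v \<in> m" for v
  proof -
    have "v \<in> b ` m" using that by (simp only: bm)
    then obtain u where u: "u \<in> m" "v = b u" by blast
    then have "h (a v) = h (b (a u))" using comm by simp
    also have "\<dots> = a u" using h(3) u inv sm by auto
    also have "u = h v" using u h sm by auto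
    finally show ?thesis .
  qed
  obtain E where E: "finite E" "E \<subseteq> m" "card E = dim m"
    "\<And>x. x \<in> m \<Longrightarrow> (\<Sum>e\<in>E. (x \<bullet> e) *\<^sub>R e) = x" "\<And>e. e \<in> E \<Longrightarrow> e \<bullet> e = 1"
    by (rule orthonormal_basis_obtain[OF m(1)]) (rule that)
  have "(\<Sum>e\<in>E. (h \<circ> y) (a e) \<bullet> e) = (\<Sum>e\<in>E. a ((h \<circ> y) e) \<bullet> e)"
    by (rule trace_commute[OF linear_compose[OF lin(3) h(2)] lin(1) E(4,2)]) (use h(1) inv sm in auto)
  moreover have "(h \<circ> y) (a e) \<bullet> e = a ((h \<circ> y) e) \<bullet> e + 1" if "e \<in> E" for e
  proof -
    have e: "e \<in> m" using that E by auto
    have "e = h (b e)" using h sm e by simp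
    also have "\<dots> = h (y (a e)) - h (a (y e))"
      using b[OF e] linear_diff[OF h(2)] by simp
    also have "h (a (y e)) = a (h (y e))" using ha inv e by simp
    finally have "h (y (a e)) = a (h (y e)) + e" by (simp add: algebra_simps)
    then show ?thesis using E(5)[OF that] by (simp add: inner_add_left)
  qed
  then have "(\<Sum>e\<in>E. (h \<circ> y) (a e) \<bullet> e) = (\<Sum>e\<in>E. a ((h \<circ> y) e) \<bullet> e + 1)"
    by (rule sum.cong[OF refl])
  then have "(\<Sum>e\<in>E. (h \<circ> y) (a e) \<bullet> e) = (\<Sum>e\<in>E. a ((h \<circ> y) e) \<bullet> e) + real (card E)"
    unfolding sum.distrib by simp
  ultimately have "dim m = 0" unfolding E(3) by simp
  then have "m \<subseteq> {0}" by (simp only: dim_eq_0)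
  then show False using m(2) subspace_0[OF m(1)] by blast
qed

section \<open>Derived and lower central series; the derived algebra of a solvable algebra is
  nilpotent\<close>

primrec der_ser :: "('a::real_vector \<Rightarrow> 'a \<Rightarrow> 'a) \<Rightarrow> 'a set \<Rightarrow> nat \<Rightarrow> 'a set" where
  "der_ser br S 0 = S"
| "der_ser br S (Suc k) = span {br x y |x y. x \<in> der_ser br S k \<and> y \<in> der_ser br S k}"

primrec lcs :: "('a::real_vector \<Rightarrow> 'a \<Rightarrow> 'a) \<Rightarrow> 'a set \<Rightarrow> nat \<Rightarrow> 'a set" where
  "lcs br U 0 = U"
| "lcs br U (Suc k) = span {br x y |x y. x \<in> U \<and> y \<in> lcs br U k}"

text \<open>The algebra is a subspace of a Euclidean space, so its metric is the ambient inner
  product and passing to an ideal only replaces \<open>S\<close>. Bracket identities are total; only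
  closure refers to \<open>S\<close>.\<close>

locale lie_subalgebra =
  fixes S :: "'a::euclidean_space set" and br :: "'a \<Rightarrow> 'a \<Rightarrow> 'a"
  assumes subspace_S: "subspace S"
    and bilinear_br: "bilinear br"
    and br_closed: "x \<in> S \<Longrightarrow> y \<in> S \<Longrightarrow> br x y \<in> S"
    and br_self: "br x x = 0"
    and jacobi: "br x (br y z) = br (br x y) z + br y (br x z)"
begin

lemma linear_br: "linear (br x)" "linear (\<lambda>x. br x y)"
  using bilinear_br by (auto simp: bilinear_def)

lemmas br_simps = bilinear_ladd[OF bilinear_br] bilinear_radd[OF bilinear_br]
  bilinear_lmul[OF bilinear_br] bilinear_rmul[OF bilinear_br]
  bilinear_lneg[OF bilinear_br] bilinear_rneg[OF bilinear_br]
  bilinear_lsub[OF bilinear_br] bilinear_rsub[OF bilinear_br]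
  bilinear_lzero[OF bilinear_br] bilinear_rzero[OF bilinear_br]

lemma br_anti: "br x y = - br y x"
proof -
  have "br (x + y) (x + y) = br x y + br y x"
    unfolding br_simps by (simp add: br_self)
  then show ?thesis by (simp only: br_self eq_neg_iff_add_eq_0)
qed

lemma span_in:
  assumes "subspace T" "\<And>x y. x \<in> X \<Longrightarrow> y \<in> Y \<Longrightarrow> f x y \<in> T"
  shows "span {f x y |x y. x \<in> X \<and> y \<in> Y} \<subseteq> T"
  using assms by (intro span_minimal) auto

lemma br_span_right:
  assumes "subspace T" "\<And>y. y \<in> Y \<Longrightarrow> br x y \<in> T" "y \<in> span Y"
  shows "br x y \<in> T"
proof -
  have "span Y \<subseteq> {y. br x y \<in> T}"
    using assms by (intro span_minimal linear_subspace_vimage[OF linear_br(1), unfolded vimage_def]) auto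
  then show ?thesis using assms by auto
qed

lemma subspace_der_ser: "subspace (der_ser br S k)"
  by (cases k) (auto simp: subspace_S)

lemma der_ser_ideal: "x \<in> S \<Longrightarrow> z \<in> der_ser br S k \<Longrightarrow> br x z \<in> der_ser br S k"
proof (induction k arbitrary: x z)
  case 0
  then show ?case using br_closed by simp
next
  case (Suc k)
  let ?T = "span {br x y |x y. x \<in> der_ser br S k \<and> y \<in> der_ser br S k}"
  have "br x z \<in> ?T"
  proof (rule br_span_right[of ?T "{br x y |x y. x \<in> der_ser br S k \<and> y \<in> der_ser br S k}"])
    fix v assume "v \<in> {br x y |x y. x \<in> der_ser br S k \<and> y \<in> der_ser br S k}"
    then obtain a b where ab: "v = br a b" "a \<in> der_ser br S k" "b \<in> der_ser br S k" by auto
    then have "br x a \<in> der_ser br S k" "br x b \<in> der_ser br S k" using Suc by auto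
    then show "br x v \<in> ?T"
      unfolding ab(1) jacobi[of x] using ab by (intro span_add span_base) auto
  qed (use Suc in auto)
  then show ?case by simp
qed

lemma der_ser_subset: "der_ser br S k \<subseteq> S"
proof (induction k)
  case (Suc k)
  then show ?case using br_closed unfolding der_ser.simps by (intro span_in[OF subspace_S]) auto
qed simp

lemma der_ser_1_ideal: "x \<in> S \<Longrightarrow> y \<in> S \<Longrightarrow> br x y \<in> der_ser br S 1"
  by (auto intro: span_base)

text \<open>
  A weak form of Lie's theorem over the reals. On a minimal invariant subspace the derived series
  acts by zero, by descending induction.
\<close>

lemma killed_by_derived_algebra:
  fixes \<rho> :: "'a \<Rightarrow> 'c::euclidean_space \<Rightarrow> 'c"
  assumes bil: "bilinear \<rho>" and m: "subspace m" "m \<noteq> {0}"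
    and inv: "\<And>x v. x \<in> S \<Longrightarrow> v \<in> m \<Longrightarrow> \<rho> x v \<in> m"
    and rep: "\<And>x y v. x \<in> S \<Longrightarrow> y \<in> S \<Longrightarrow> v \<in> m \<Longrightarrow> \<rho> (br x y) v = \<rho> x (\<rho> y v) - \<rho> y (\<rho> x v)"
    and solv: "der_ser br S k = {0}"
  shows "\<exists>v\<in>m. v \<noteq> 0 \<and> (\<forall>z\<in>der_ser br S 1. \<rho> z v = 0)"
proof -
  have lin: "linear (\<rho> x)" for x using bil by (auto simp: bilinear_def)
  have lin2: "linear (\<lambda>x. \<rho> x v)" for v using bil by (auto simp: bilinear_def)
  define P where "P n \<longleftrightarrow> (\<forall>x\<in>S. \<forall>v\<in>n. \<rho> x v \<in> n)" for n
  have "P m" using inv P_def by simp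
  from minimal_subspace[of m P, OF m this] obtain m0
    where "subspace m0 \<and> m0 \<noteq> {0} \<and> m0 \<subseteq> m \<and> P m0"
    and m0_min: "\<forall>n. subspace n \<longrightarrow> n \<noteq> {0} \<longrightarrow> n \<subseteq> m0 \<longrightarrow> P n \<longrightarrow> n = m0"
    by (elim exE) (erule conjE, rule that)
  then have m0: "subspace m0" "m0 \<noteq> {0}" "m0 \<subseteq> m" "\<forall>x\<in>S. \<forall>v\<in>m0. \<rho> x v \<in> m0"
    unfolding P_def by simp_all
  \<comment> \<open>The next term of the derived series acts by zero, so the elements of
    \<open>K\<close> act by commuting maps.\<close>
  have step: "\<forall>z\<in>der_ser br S (Suc j). \<forall>v\<in>m0. \<rho> z v = 0"
    if IH: "\<forall>z\<in>der_ser br S (Suc (Suc j)). \<forall>v\<in>m0. \<rho> z v = 0" for j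
  proof -
    define K where "K = der_ser br S (Suc j)"
    have KS: "b \<in> S" if "b \<in> K" for b using that der_ser_subset K_def by blast
    have Kid: "br x b \<in> K" "br b x \<in> K" if "b \<in> K" "x \<in> S" for b x
      using der_ser_ideal[of x b "Suc j"] that br_anti[of b x] subspace_neg[OF subspace_der_ser]
      unfolding K_def by metis+
    have swap: "\<rho> x (\<rho> y v) = \<rho> y (\<rho> x v) + \<rho> (br x y) v" if "x \<in> S" "y \<in> S" "v \<in> m0" for x y v
      using rep[of x y v] that m0 by auto
    have Kcomm: "\<rho> a (\<rho> b v) = \<rho> b (\<rho> a v)" if "a \<in> K" "b \<in> K" "v \<in> m0" for a b v
    proof -
      have "br a b \<in> der_ser br S (Suc (Suc j))" using that unfolding K_def by (auto intro: span_base)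
      then show ?thesis using swap[of a b v] IH that KS by auto
    qed
    define sing where "sing b \<longleftrightarrow> (\<exists>v\<in>m0. v \<noteq> 0 \<and> \<rho> b v = 0)" for b
    have sing_br: "sing (br y a)" if "a \<in> S" "y \<in> S" "\<And>v. v \<in> m0 \<Longrightarrow> \<rho> a (\<rho> (br y a) v) = \<rho> (br y a) (\<rho> a v)" for a y
      unfolding sing_def
      by (rule commutator_singular[of "\<rho> a" "\<rho> (br y a)" "\<rho> y"])
        (use that m0 lin br_closed rep in auto)
    have pow_in: "(\<rho> b ^^ n) v \<in> m0" if "b \<in> K" "v \<in> m0" for b n v
      using that m0 KS by (induction n) auto
    have pow_lin: "linear (\<rho> b ^^ n)" for b n
      by (induction n) (auto simp only: funpow.simps intro: linear_compose lin linear_id)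
    \<comment> \<open>The generalised kernel of a singular \<open>b\<close> is invariant under all
      of \<open>S\<close>, because \<open>br b y\<close> stays in \<open>K\<close> and hence
      commutes with \<open>b\<close>. Minimality of \<open>m0\<close> makes it everything.\<close>
    have nilp: "\<exists>n. (\<rho> b ^^ n) v = 0" if b: "b \<in> K" "sing b" and v: "v \<in> m0" for b v
    proof -
      let ?N = "{v \<in> m0. \<exists>n. (\<rho> b ^^ n) v = 0}"
      have more: "(\<rho> b ^^ (n + i)) v = 0" if "(\<rho> b ^^ n) v = 0" for n i v
        using that linear_0[OF pow_lin] by (subst add.commute) (simp add: funpow_add)
      have "subspace ?N"
        unfolding subspace_def
      proof (intro conjI ballI allI)
        show "0 \<in> ?N" using m0(1) subspace_0 by (auto intro: exI[of _ 0])
        show "x + y \<in> ?N" if xy: "x \<in> ?N" "y \<in> ?N" for x y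
        proof -
          obtain n i where "(\<rho> b ^^ n) x = 0" "(\<rho> b ^^ i) y = 0" using xy by auto
          then have "(\<rho> b ^^ (n + i)) x = 0" "(\<rho> b ^^ (n + i)) y = 0"
            using more[of n x i] more[of i y n] by (simp_all add: add.commute)
          then have "(\<rho> b ^^ (n + i)) (x + y) = 0" by (simp add: linear_add[OF pow_lin])
          then show ?thesis using that m0(1) subspace_add by blast
        qed
        show "c *\<^sub>R x \<in> ?N" if "x \<in> ?N" for c x
          using that m0(1) subspace_scale linear_cmul[OF pow_lin] by fastforce
      qed
      moreover have "?N \<noteq> {0}"
      proof -
        obtain v where "v \<in> m0" "v \<noteq> 0" "\<rho> b v = 0" using b(2) sing_def by auto
        then have "v \<in> ?N" by (auto intro!: exI[of _ 1])
        then show ?thesis using \<open>v \<noteq> 0\<close> by auto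
      qed
      moreover have "\<rho> y v \<in> ?N" if yv: "y \<in> S" "v \<in> ?N" for y v
      proof -
        have v: "v \<in> m0" using that by auto
        \<comment> \<open>The Leibniz expansion stops after one correction term, since
          \<open>b\<close> commutes with \<open>br b y\<close>; one additional power of
          \<open>b\<close> therefore suffices.\<close>
        have *: "(\<rho> b ^^ Suc n) (\<rho> y v) = \<rho> y ((\<rho> b ^^ Suc n) v) + real (Suc n) *\<^sub>R \<rho> (br b y) ((\<rho> b ^^ n) v)" for n
        proof (induction n)
          case 0
          then show ?case using swap[of b y v] KS b that by auto
        next
          case (Suc n)
          have "(\<rho> b ^^ Suc (Suc n)) (\<rho> y v) = \<rho> b (\<rho> y ((\<rho> b ^^ Suc n) v)) + real (Suc n) *\<^sub>R \<rho> b (\<rho> (br b y) ((\<rho> b ^^ n) v))"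
            using Suc linear_add[OF lin] linear_cmul[OF lin] by simp
          also have "\<rho> b (\<rho> (br b y) ((\<rho> b ^^ n) v)) = \<rho> (br b y) ((\<rho> b ^^ Suc n) v)"
            using Kcomm[OF b(1) Kid(2)[OF b(1) yv(1)] pow_in[OF b(1) v]] by simp
          also have "\<rho> b (\<rho> y ((\<rho> b ^^ Suc n) v)) = \<rho> y ((\<rho> b ^^ Suc (Suc n)) v) + \<rho> (br b y) ((\<rho> b ^^ Suc n) v)"
            using swap[of b y "(\<rho> b ^^ Suc n) v"] KS b that pow_in[OF b(1) v, of "Suc n"] by auto
          finally show ?case by (simp add: algebra_simps scaleR_2)
        qed
        obtain n where "(\<rho> b ^^ n) v = 0" using yv by auto
        then have "(\<rho> b ^^ Suc n) (\<rho> y v) = 0" unfolding * using linear_0[OF lin] by simp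
        then show ?thesis using m0(4) that by blast
      qed
      ultimately have "?N = m0" by (intro m0_min[rule_format]) (auto simp: P_def)
      then show ?thesis using v by auto
    qed
    \<comment> \<open>The common kernel of the singular elements of \<open>K\<close>. It is
      \<open>S\<close>-invariant because \<open>br y b\<close> is again a singular element of
      \<open>K\<close>, so once it is nonzero, it is \<open>m0\<close> and singular elements act by
      zero.\<close>
    define N where "N = {v \<in> m0. \<forall>b\<in>K. sing b \<longrightarrow> \<rho> b v = 0}"
    have subN: "subspace N"
      unfolding subspace_def N_def
      using m0(1) linear_0[OF lin] linear_add[OF lin] linear_cmul[OF lin]
      by (auto simp: subspace_0 subspace_add subspace_scale)
    have "N \<noteq> {0}"
    proof -
      \<comment> \<open>Minimality is now taken with respect to \<open>K\<close> alone. In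
        \<open>E\<close>, the kernel of a singular \<open>b\<close> is nonzero by nilpotency and
        \<open>K\<close>-invariant by commutativity, hence all of \<open>E\<close>.\<close>
      define Q where "Q n \<longleftrightarrow> (\<forall>b\<in>K. \<forall>v\<in>n. \<rho> b v \<in> n)" for n
      have "Q m0" using m0(4) KS Q_def by simp
      from minimal_subspace[of m0 Q, OF m0(1,2) this] obtain E
        where "subspace E \<and> E \<noteq> {0} \<and> E \<subseteq> m0 \<and> Q E"
        and E_min: "\<forall>n. subspace n \<longrightarrow> n \<noteq> {0} \<longrightarrow> n \<subseteq> E \<longrightarrow> Q n \<longrightarrow> n = E"
        by (elim exE) (erule conjE, rule that)
      then have E: "subspace E" "E \<noteq> {0}" "E \<subseteq> m0" "\<forall>b\<in>K. \<forall>v\<in>E. \<rho> b v \<in> E"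
        unfolding Q_def by simp_all
      have "E \<subseteq> N"
      proof -
        have "\<rho> b v = 0" if b: "b \<in> K" "sing b" and v: "v \<in> E" for b v
        proof -
          let ?n = "{v \<in> E. \<rho> b v = 0}"
          have "subspace ?n"
            unfolding subspace_def
            using E(1) linear_0[OF lin] linear_add[OF lin] linear_cmul[OF lin]
            by (auto simp: subspace_0 subspace_add subspace_scale)
          moreover have "?n \<noteq> {0}"
          proof
            assume n0: "?n = {0}"
            obtain u where u: "u \<in> E" "u \<noteq> 0" using E(1,2) subspace_0 by blast
            have "(\<rho> b ^^ n) u \<in> E \<and> (\<rho> b ^^ n) u \<noteq> 0" for n
            proof (induction n)
              case (Suc n)
              then have "(\<rho> b ^^ n) u \<notin> ?n" using n0 by blast
              then show ?case using Suc E(4) b(1) by auto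
            qed (use u in auto)
            then show False using nilp[OF b, of u] u E(3) by blast
          qed
          moreover have "\<rho> a v \<in> ?n" if "a \<in> K" "v \<in> ?n" for a v
            using Kcomm[OF b(1) \<open>a \<in> K\<close>, of v] E(3,4) that linear_0[OF lin] by auto
          ultimately have "?n = E" by (intro E_min[rule_format]) (auto simp: Q_def)
          then show ?thesis using v by auto
        qed
        then show ?thesis using E(3) N_def by auto
      qed
      then show ?thesis using E(1,2) subspace_0 by blast
    qed
    moreover have "\<rho> y v \<in> N" if "y \<in> S" "v \<in> N" for y v
    proof -
      have v: "v \<in> m0" using that N_def by auto
      have "\<rho> b (\<rho> y v) = 0" if b: "b \<in> K" "sing b" for b
      proof -
        have "br y b \<in> K" by (rule Kid(1)[OF b(1) \<open>y \<in> S\<close>])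
        moreover have "sing (br y b)"
          by (rule sing_br[OF KS[OF b(1)] \<open>y \<in> S\<close> Kcomm[OF b(1) Kid(1)[OF b(1) \<open>y \<in> S\<close>]]])
        ultimately have "\<rho> (br y b) v = 0" using \<open>v \<in> N\<close> N_def by auto
        moreover have "\<rho> b v = 0" using \<open>v \<in> N\<close> N_def b by auto
        ultimately show ?thesis using swap[of y b v] KS[OF b(1)] \<open>y \<in> S\<close> v linear_0[OF lin] by simp
      qed
      then show ?thesis using m0(4) that(1) v N_def by auto
    qed
    ultimately have "N = m0" using subN N_def by (intro m0_min[rule_format]) (auto simp: P_def)
    then have zero: "\<rho> b v = 0" if "b \<in> K" "sing b" "v \<in> m0" for b v
      using that N_def by blast
    \<comment> \<open>Here \<open>y\<close> need not lie in \<open>K\<close>, so its commuting with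
      \<open>br x y\<close> is not given. But \<open>br y (br x y)\<close> is singular and acts by
      zero, which says that they commute, and then \<open>br x y\<close> is singular too.\<close>
    have gen: "\<rho> (br x y) v = 0" if x: "x \<in> der_ser br S j" and y: "y \<in> der_ser br S j" and v: "v \<in> m0" for x y v
    proof -
      have xy: "x \<in> S" "y \<in> S" using x y der_ser_subset by auto
      have z: "br x y \<in> K" using x y unfolding K_def by (auto intro: span_base)
      have "sing (br x y)"
      proof (rule sing_br[OF xy(2,1)])
        fix v assume v: "v \<in> m0"
        have "sing (br y (br x y))"
          by (rule sing_br[OF KS[OF z] xy(2) Kcomm[OF z Kid(1)[OF z xy(2)]]])
        then have "\<rho> (br y (br x y)) v = 0" using zero[OF Kid(1)[OF z xy(2)] _ v] by blast
        then show "\<rho> y (\<rho> (br x y) v) = \<rho> (br x y) (\<rho> y v)"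
          using swap[of y "br x y" v] xy KS[OF z] v by simp
      qed
      then show ?thesis using zero z v by auto
    qed
    have "\<rho> z v = 0" if "z \<in> K" "v \<in> m0" for z v
    proof -
      have "K \<subseteq> {z. \<rho> z v = 0}"
        unfolding K_def der_ser.simps
        using gen that(2) by (intro span_in linear_subspace_kernel[OF lin2]) auto
      then show ?thesis using that by auto
    qed
    then show ?thesis unfolding K_def by blast
  qed
  have z0: "\<forall>z\<in>der_ser br S (Suc k). \<forall>v\<in>m0. \<rho> z v = 0"
  proof -
    have "der_ser br S (Suc k) \<subseteq> {0}"
      unfolding der_ser.simps solv by (intro span_in[OF subspace_single_0]) (auto simp: br_simps)
    then show ?thesis using linear_0[OF lin2] by blast
  qed
  have "\<forall>z\<in>der_ser br S (Suc 0). \<forall>v\<in>m0. \<rho> z v = 0"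
    by (rule inc_induct[of 0 k "\<lambda>j. \<forall>z\<in>der_ser br S (Suc j). \<forall>v\<in>m0. \<rho> z v = 0", OF le0 z0 step])
  moreover obtain v where "v \<in> m0" "v \<noteq> 0" using m0(1,2) subspace_0 by blast
  ultimately show ?thesis using m0(3) by auto
qed

text \<open>By duality: a vector of \<open>m\<close> annihilated by the derived algebra in the
  contragredient representation is orthogonal to all brackets of the derived algebra with
  \<open>m\<close>.\<close>

lemma br_derived_ideal_proper:
  assumes m: "subspace m" "m \<noteq> {0}" "\<And>x y. x \<in> S \<Longrightarrow> y \<in> m \<Longrightarrow> br x y \<in> m"
    and solv: "der_ser br S k = {0}"
  shows "span {br x y |x y. x \<in> der_ser br S 1 \<and> y \<in> m} \<noteq> m"
proof -
  obtain E where E: "finite E" "E \<subseteq> m" "card E = dim m"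
    "\<And>x. x \<in> m \<Longrightarrow> (\<Sum>e\<in>E. (x \<bullet> e) *\<^sub>R e) = x" "\<And>e. e \<in> E \<Longrightarrow> e \<bullet> e = 1"
    by (rule orthonormal_basis_obtain[OF m(1)]) (rule that)
  \<comment> \<open>Minus the adjoint of \<open>br x\<close> on \<open>m\<close>, written in an
    orthonormal basis so that it is bilinear on the whole space with values in
    \<open>m\<close>.\<close>
  define \<rho> where "\<rho> x v = (\<Sum>e\<in>E. - (v \<bullet> br x e) *\<^sub>R e)" for x v
  have bil: "bilinear \<rho>"
    unfolding bilinear_def
  proof (intro conjI allI linearI)
    show "\<rho> x (v + w) = \<rho> x v + \<rho> x w" "\<rho> (x + y) v = \<rho> x v + \<rho> y v" for x y v w
      unfolding \<rho>_def br_simps inner_add_left inner_add_right minus_add_distrib scaleR_add_left sum.distrib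
      by (rule refl)+
    show "\<rho> x (c *\<^sub>R v) = c *\<^sub>R \<rho> x v" "\<rho> (c *\<^sub>R x) v = c *\<^sub>R \<rho> x v" for c x v
      by (simp_all add: \<rho>_def br_simps scaleR_sum_right)
  qed
  have rm: "\<rho> x v \<in> m" for x v
    unfolding \<rho>_def using E(2) m(1) by (intro subspace_sum subspace_scale) auto
  have adj: "\<rho> x v \<bullet> y = - (v \<bullet> br x y)" if "y \<in> m" for x v y
  proof -
    have "v \<bullet> br x y = v \<bullet> br x (\<Sum>e\<in>E. (y \<bullet> e) *\<^sub>R e)" using E(4)[OF that] by simp
    also have "\<dots> = (\<Sum>e\<in>E. (y \<bullet> e) * (v \<bullet> br x e))"
      using linear_br by (simp add: linear_sum linear_cmul inner_sum_right)
    also have "\<dots> = - (\<rho> x v \<bullet> y)"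
      unfolding \<rho>_def by (simp add: inner_sum_left sum_negf inner_commute[of y] mult.commute)
    finally show ?thesis by simp
  qed
  have rep: "\<rho> (br x y) v = \<rho> x (\<rho> y v) - \<rho> y (\<rho> x v)" if "x \<in> S" "y \<in> S" "v \<in> m" for x y v
  proof -
    let ?d = "\<rho> (br x y) v - (\<rho> x (\<rho> y v) - \<rho> y (\<rho> x v))"
    have "?d \<bullet> z = 0" if "z \<in> m" for z
      using that \<open>x \<in> S\<close> \<open>y \<in> S\<close> m(3) jacobi[of x y z]
      by (simp add: inner_diff_left adj inner_simps)
    moreover have "?d \<in> m" using rm m(1) subspace_diff by blast
    ultimately have "?d = 0" by (metis inner_eq_zero_iff)
    then show ?thesis by simp
  qed
  obtain v where v: "v \<in> m" "v \<noteq> 0" "\<forall>z\<in>der_ser br S 1. \<rho> z v = 0"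
    using killed_by_derived_algebra[of \<rho> m k] bil m(1,2) rm rep solv by blast
  have "v \<notin> span {br x y |x y. x \<in> der_ser br S 1 \<and> y \<in> m}"
  proof
    assume "v \<in> span {br x y |x y. x \<in> der_ser br S 1 \<and> y \<in> m}"
    moreover have "\<dots> \<subseteq> {y. v \<bullet> y = 0}"
    proof (rule span_in)
      fix z y assume "z \<in> der_ser br S 1" "y \<in> m"
      then show "br z y \<in> {y. v \<bullet> y = 0}" using v(3) adj[of y z v] by simp
    qed (rule subspace_hyperplane)
    ultimately show False using v(2) by auto
  qed
  then show ?thesis using v(1) by auto
qed

text \<open>Each term has to be an ideal of the whole algebra \<open>S\<close>, and not of
  \<open>U\<close> only, for \<open>br_derived_ideal_proper\<close> to apply to it.\<close>

lemma lcs_ideal: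
  assumes "\<And>x u. x \<in> S \<Longrightarrow> u \<in> U \<Longrightarrow> br x u \<in> U" "subspace U" "U \<subseteq> S"
  shows "x \<in> S \<Longrightarrow> z \<in> lcs br U k \<Longrightarrow> br x z \<in> lcs br U k"
proof (induction k arbitrary: x z)
  case 0
  then show ?case by (simp add: assms(1))
next
  case (Suc k)
  let ?Y = "{br x y |x y. x \<in> U \<and> y \<in> lcs br U k}"
  have "br x z \<in> span ?Y"
  proof (rule br_span_right[of _ ?Y])
    fix v assume "v \<in> ?Y"
    then obtain a b where ab: "v = br a b" "a \<in> U" "b \<in> lcs br U k" by auto
    then have "br x a \<in> U" "br x b \<in> lcs br U k" using Suc.IH Suc.prems(1) assms(1) by blast+
    then show "br x v \<in> span ?Y"
      unfolding ab(1) jacobi[of x] using ab by (intro span_add span_base) auto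
  qed (use Suc in auto)
  then show ?case by simp
qed

lemma lcs_subset:
  assumes "\<And>x u. x \<in> U \<Longrightarrow> u \<in> U \<Longrightarrow> br x u \<in> U" "subspace U"
  shows "lcs br U k \<subseteq> U"
proof (induction k)
  case (Suc k)
  then show ?case using assms(1) unfolding lcs.simps by (intro span_in[OF assms(2)]) auto
qed simp

lemma subspace_lcs: "subspace U \<Longrightarrow> subspace (lcs br U k)"
  by (cases k) auto

text \<open>As long as a term of the lower central series is nonzero, the next one has smaller
  dimension, which cannot happen more often than the dimension of the derived algebra.\<close>

lemma derived_algebra_nilpotent:
  assumes solv: "der_ser br S k = {0}"
  shows "\<exists>n. lcs br (der_ser br S 1) n = {0}"
proof (rule ccontr)
  assume no: "\<not> ?thesis"
  let ?U = "der_ser br S 1"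
  have U: "\<And>x u. x \<in> S \<Longrightarrow> u \<in> ?U \<Longrightarrow> br x u \<in> ?U" "subspace ?U" "?U \<subseteq> S"
    using der_ser_ideal subspace_der_ser der_ser_subset by blast+
  have "dim (lcs br ?U n) + n \<le> dim ?U" for n
  proof (induction n)
    case (Suc n)
    have "lcs br ?U (Suc n) \<noteq> lcs br ?U n"
      unfolding lcs.simps
      by (rule br_derived_ideal_proper[OF subspace_lcs[OF U(2)] _ _ solv])
        (use no lcs_ideal[OF U] in auto)
    moreover have "lcs br ?U (Suc n) \<subseteq> lcs br ?U n"
      using lcs_ideal[OF U] U(3) subspace_lcs[OF U(2)] unfolding lcs.simps
      by (intro span_in) auto
    ultimately have "dim (lcs br ?U (Suc n)) < dim (lcs br ?U n)"
      using subspace_dim_equal[of "lcs br ?U (Suc n)" "lcs br ?U n"] subspace_lcs[OF U(2)]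
      by (meson not_le)
    then show ?case using Suc by simp
  qed simp
  from this[of "Suc (dim ?U)"] show False by simp
qed

end

section \<open>The Chern connection of a Lie algebra\<close>

definition delbar :: "('a::real_vector \<Rightarrow> 'a \<Rightarrow> 'a) \<Rightarrow> ('a \<Rightarrow> 'a) \<Rightarrow> 'a \<Rightarrow> 'a \<Rightarrow> 'a" where
  "delbar br J x y = (1/2) *\<^sub>R (br x y + J (br (J x) y))"

locale complex_lie = lie_subalgebra S br for S :: "'a::euclidean_space set" and br +
  fixes J :: "'a \<Rightarrow> 'a"
  assumes linear_J: "linear J" and J_in: "x \<in> S \<Longrightarrow> J x \<in> S" and J_J: "x \<in> S \<Longrightarrow> J (J x) = - x"
    and J_inner: "x \<in> S \<Longrightarrow> y \<in> S \<Longrightarrow> J x \<bullet> J y = x \<bullet> y"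
    and nijenhuis: "x \<in> S \<Longrightarrow> y \<in> S \<Longrightarrow>
      br x y - br (J x) (J y) + J (br (J x) y) + J (br x (J y)) = 0"
begin

abbreviation B where "B \<equiv> delbar br J"

lemmas J_simps = linear_add[OF linear_J] linear_diff[OF linear_J] linear_cmul[OF linear_J]
  linear_neg[OF linear_J] linear_0[OF linear_J]

lemmas S_closed = subspace_0[OF subspace_S] subspace_add[OF subspace_S] subspace_diff[OF subspace_S]
  subspace_scale[OF subspace_S] subspace_neg[OF subspace_S] J_in br_closed

lemma B_simps:
  "B (x + y) z = B x z + B y z" "B x (y + z) = B x y + B x z"
  "B (c *\<^sub>R x) z = c *\<^sub>R B x z" "B x (c *\<^sub>R z) = c *\<^sub>R B x z"
  "B (- x) z = - B x z" "B x (- z) = - B x z"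
  "B (x - y) z = B x z - B y z" "B x (y - z) = B x y - B x z"
  "B 0 z = 0" "B x 0 = 0"
  by (simp_all add: delbar_def br_simps J_simps scaleR_add_right scaleR_diff_right
      mult.commute algebra_simps)

lemma linear_B: "linear (B x)" "linear (\<lambda>x. B x y)"
  by (auto intro!: linearI simp: B_simps)

lemma B_in: "x \<in> S \<Longrightarrow> y \<in> S \<Longrightarrow> B x y \<in> S"
  unfolding delbar_def by (intro S_closed)

lemma B_J1: assumes "x \<in> S" "y \<in> S" shows "B (J x) y = - J (B x y)"
  using assms by (simp add: delbar_def J_J br_closed J_in J_simps br_simps algebra_simps)

text \<open>Up to applying \<open>J\<close>, this is the vanishing of the Nijenhuis tensor, whereas
  antilinearity in the first argument follows from \<open>J_J\<close> alone.\<close>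

lemma B_J2: assumes "x \<in> S" "y \<in> S" shows "B x (J y) = J (B x y)"
proof -
  have "br (J x) (J y) = br x y + J (br (J x) y) + J (br x (J y))"
    using nijenhuis[OF assms] by (simp add: algebra_simps)
  then have "J (br (J x) (J y)) = J (br x y) - br (J x) y - br x (J y)"
    using assms by (simp add: J_J J_in br_closed J_simps)
  then show ?thesis using assms
    unfolding delbar_def by (simp only: J_simps J_J J_in br_closed) (simp add: algebra_simps)
qed

lemma J_skew: "x \<in> S \<Longrightarrow> y \<in> S \<Longrightarrow> J x \<bullet> y = - (x \<bullet> J y)"
  using J_inner[of x "J y"] by (simp add: J_J J_in)

lemma inner_ext: "a \<in> S \<Longrightarrow> b \<in> S \<Longrightarrow> (\<And>z. z \<in> S \<Longrightarrow> a \<bullet> z = b \<bullet> z) \<Longrightarrow> a = b"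
  using S_closed(3)[of a b] by (metis inner_diff_left inner_eq_zero_iff right_minus_eq)

text \<open>Flatness of the (0,1) part. With i acting as \<open>J\<close>, the map
  \<open>B x\<close> is the bracket with (x + i J x) / 2. For v =
  \<open>br x y - br (J x) (J y)\<close>, two such vectors have the bracket (v + i J v) / 4, whence
  the factor 1/2 in front of \<open>B\<close>.\<close>

lemma B_commutator:
  assumes "x \<in> S" "y \<in> S" "z \<in> S"
  shows "B x (B y z) - B y (B x z) = (1/2) *\<^sub>R B (br x y - br (J x) (J y)) z"
proof -
  have B2: "B a (br b z + J (br (J b) z)) = (1/2) *\<^sub>R ((br a (br b z) - br (J a) (br (J b) z))
      + J (br (J a) (br b z) + br a (br (J b) z)))" if "a \<in> S" "b \<in> S" for a b
  proof -
    have "B a (br b z + J (br (J b) z)) = B a (br b z) + J (B a (br (J b) z))"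
      using B_J2[of a "br (J b) z"] that assms S_closed by (simp add: B_simps)
    also have "\<dots> = (1/2) *\<^sub>R (br a (br b z) + J (br (J a) (br b z))) +
        J ((1/2) *\<^sub>R (br a (br (J b) z) + J (br (J a) (br (J b) z))))"
      by (simp add: delbar_def)
    also have "\<dots> = (1/2) *\<^sub>R ((br a (br b z) - br (J a) (br (J b) z))
      + J (br (J a) (br b z) + br a (br (J b) z)))"
      using J_J[of "br (J a) (br (J b) z)"] that assms S_closed
      by (simp add: J_simps algebra_simps)
    finally show ?thesis .
  qed
  have B3: "B a (B b z) = (1/4) *\<^sub>R ((br a (br b z) - br (J a) (br (J b) z))
      + J (br (J a) (br b z) + br a (br (J b) z)))" if "a \<in> S" "b \<in> S" for a b
  proof -
    have "B a (B b z) = (1/2) *\<^sub>R B a (br b z + J (br (J b) z))"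
      unfolding delbar_def[of br J b] by (simp add: B_simps)
    then show ?thesis unfolding B2[OF that] by simp
  qed
  let ?v = "br x y - br (J x) (J y)"
  \<comment> \<open>Integrability in the form that the bracket of two (0,1) vectors is of type
    (0,1): its imaginary part is \<open>J\<close> of its real part.\<close>
  have v: "br (J x) y + br x (J y) = J ?v"
  proof -
    have "?v = - J (br (J x) y + br x (J y))"
      using nijenhuis[OF assms(1,2)] by (simp add: J_simps eq_neg_iff_add_eq_0 algebra_simps)
    then have "J ?v = - J (J (br (J x) y + br x (J y)))" by (simp add: J_simps)
    then show ?thesis using assms S_closed by (simp add: J_J)
  qed
  have j: "br a (br b z) - br b (br a z) = br (br a b) z" for a b
    using jacobi[of a b z] by simp
  have "B x (B y z) - B y (B x z) = (1/4) *\<^sub>R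
     ((br x (br y z) - br y (br x z)) - (br (J x) (br (J y) z) - br (J y) (br (J x) z))
      + J ((br (J x) (br y z) - br y (br (J x) z)) + (br x (br (J y) z) - br (J y) (br x z))))"
    unfolding B3[OF assms(1,2)] B3[OF assms(2,1)] scaleR_diff_right[symmetric] J_simps by simp
  also have "\<dots> = (1/4) *\<^sub>R (br ?v z + J (br (br (J x) y + br x (J y)) z))"
    unfolding j by (simp add: br_simps)
  also have "\<dots> = (1/2) *\<^sub>R B ?v z"
    unfolding v delbar_def by simp
  finally show ?thesis .
qed

text \<open>The map \<open>K\<close> sending \<open>u\<close> to \<open>B u w\<close> is minus the
  antilinear part of \<open>M = br w\<close>; by integrability it is also \<open>J\<close> composed
  with the antilinear part of \<open>N = br (J w)\<close>. The trace of its square is thus half the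
  trace of \<open>J (M N - N M)\<close>, and \<open>M\<close> and \<open>N\<close> commute as
  \<open>br w (J w) = 0\<close>.\<close>

lemma antilinear_trace_zero:
  assumes U: "subspace U" "U \<subseteq> S" "\<And>u. u \<in> U \<Longrightarrow> J u \<in> U" "\<And>x u. x \<in> S \<Longrightarrow> u \<in> U \<Longrightarrow> br x u \<in> U"
    and E: "E \<subseteq> U" "\<And>x. x \<in> U \<Longrightarrow> (\<Sum>e\<in>E. (x \<bullet> e) *\<^sub>R e) = x"
    and w: "w \<in> S" "br w (J w) = 0"
  shows "(\<Sum>e\<in>E. B (B e w) w \<bullet> e) = 0"
proof -
  define M where "M = br w"
  define N where "N = br (J w)"
  define K where "K = (\<lambda>u. B u w)"
  have lin: "linear M" "linear N" "linear K"
    unfolding M_def N_def K_def using linear_br linear_B by auto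
  have in_U: "M u \<in> U" "N u \<in> U" "K u \<in> U" if "u \<in> U" for u
  proof -
    show "M u \<in> U" "N u \<in> U" unfolding M_def N_def using U(4) w(1) J_in that by auto
    have "br u w \<in> U" "br (J u) w \<in> U"
      using U(4)[OF w(1)] U(1,3) that br_anti[of u w] br_anti[of "J u" w] subspace_neg by auto
    then show "K u \<in> U" unfolding K_def delbar_def using U(1,3) by (intro subspace_scale subspace_add)
  qed
  have JJ: "J (J u) = - u" if "u \<in> U" for u using J_J U(2) that by auto
  have K: "K u = - (1/2) *\<^sub>R (M u + J (M (J u)))" for u
    unfolding K_def M_def delbar_def br_anti[of _ w] by (simp add: J_simps algebra_simps)
  have MN: "M (N u) = N (M u)" for u
    unfolding M_def N_def using jacobi[of w "J w" u] w(2) by (simp add: br_simps)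
  have KJ: "K (J u) = - J (K u)" if "u \<in> U" for u
    unfolding K_def using B_J1 U(2) that w(1) by auto
  \<comment> \<open>The antilinear part of \<open>N\<close> in terms of \<open>K\<close>; this is
    the Nijenhuis condition at \<open>w\<close> and \<open>u\<close>.\<close>
  have NK: "(1/2) *\<^sub>R (N u + J (N (J u))) = - J (K u)" if u: "u \<in> U" for u
  proof -
    have n: "M u - N (J u) + J (N u) + J (M (J u)) = 0"
      unfolding M_def N_def using nijenhuis[OF w(1), of u] u U(2) by auto
    have "- J (K u) = (1/2) *\<^sub>R J (M u + J (M (J u)))" by (simp add: K J_simps)
    also have "M u + J (M (J u)) = N (J u) - J (N u)" using n by (simp add: algebra_simps)
    also have "J \<dots> = J (N (J u)) + N u" using JJ[OF in_U(2)[OF u]] by (simp add: J_simps)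
    finally show ?thesis by (simp add: add.commute)
  qed
  have tc: "(\<Sum>e\<in>E. f (h e) \<bullet> e) = (\<Sum>e\<in>E. h (f e) \<bullet> e)"
    if "linear f" "linear h" "\<And>u. u \<in> U \<Longrightarrow> f u \<in> U" "\<And>u. u \<in> U \<Longrightarrow> h u \<in> U" for f h
    using trace_commute[OF that(1,2) E(2,1)] that(3,4) by blast
  have EU: "e \<in> U" if "e \<in> E" for e using E that by auto
  have a: "(\<Sum>e\<in>E. J (K (N e)) \<bullet> e) = 0"
  proof -
    have tr: "(\<Sum>e\<in>E. M (J (N e)) \<bullet> e) = (\<Sum>e\<in>E. J (N (M e)) \<bullet> e)"
      using tc[OF lin(1) linear_compose[OF lin(2) linear_J]] in_U U(3) by (simp add: o_def)
    have "J (K (N e)) \<bullet> e = (1/2) * (M (J (N e)) \<bullet> e - J (N (M e)) \<bullet> e)" if "e \<in> E" for e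
    proof -
      have "J (K (N e)) = - (1/2) *\<^sub>R (J (M (N e)) + J (J (M (J (N e)))))"
        by (simp add: K J_simps)
      also have "J (J (M (J (N e)))) = - M (J (N e))" using JJ in_U U(3) EU[OF that] by simp
      finally have k: "J (K (N e)) = - (1/2) *\<^sub>R (J (N (M e)) + - M (J (N e)))" unfolding MN .
      show ?thesis unfolding k inner_scaleR_left inner_add_left inner_minus_left by (simp add: field_simps)
    qed
    then have "(\<Sum>e\<in>E. J (K (N e)) \<bullet> e) = (\<Sum>e\<in>E. (1/2) * (M (J (N e)) \<bullet> e - J (N (M e)) \<bullet> e))"
      by (rule sum.cong[OF refl])
    also have "\<dots> = 0" unfolding sum_distrib_left[symmetric] sum_subtractf tr by simp
    finally show ?thesis .
  qed
  have b: "(\<Sum>e\<in>E. K (N (J e)) \<bullet> e) = 0"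
    using tc[OF linear_compose[OF lin(2,3)] linear_J] in_U U(3) a by (simp add: o_def)
  \<comment> \<open>By \<open>NK\<close>, the square of \<open>K\<close> is \<open>- J K\<close>
    applied to the antilinear part of \<open>N\<close>. Its two summands have the same trace by
    cyclicity.\<close>
  have "K (K e) = - (1/2) *\<^sub>R (J (K (N e)) + K (N (J e)))" if "e \<in> E" for e
  proof -
    note e = EU[OF that]
    have "- (1/2) *\<^sub>R (J (K (N e)) + J (K (J (N (J e))))) = - J (K ((1/2) *\<^sub>R (N e + J (N (J e)))))"
      using lin(3) by (simp add: linear_add linear_cmul J_simps algebra_simps)
    also have "\<dots> = J (K (J (K e)))" unfolding NK[OF e] using linear_neg[OF lin(3)] by (simp add: J_simps)
    also have "\<dots> = K (K e)" using KJ in_U(3) e JJ by (simp add: J_simps)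
    also have "J (K (J (N (J e)))) = K (N (J e))" using KJ JJ in_U U(3) e by (simp add: J_simps)
    finally show ?thesis by simp
  qed
  then have "(\<Sum>e\<in>E. K (K e) \<bullet> e) = (\<Sum>e\<in>E. - (1/2) * (J (K (N e)) \<bullet> e + K (N (J e)) \<bullet> e))"
    by (intro sum.cong) (simp_all add: inner_simps)
  also have "\<dots> = 0" unfolding sum_distrib_left[symmetric] sum.distrib a b by simp
  finally show ?thesis unfolding K_def .
qed

end

text \<open>
  \<open>delbar\<close> and \<open>- D\<close> are the (0,1) and (1,0) parts of the Chern connection. Up to a constant factor,
  \<open>hol\<close> is its unnormalised holomorphic sectional curvature.
\<close>

locale chern_lie = complex_lie S br J for S :: "'a::euclidean_space set" and br J +
  fixes D :: "'a \<Rightarrow> 'a \<Rightarrow> 'a"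
  assumes bilinear_D: "bilinear D" and D_in: "x \<in> S \<Longrightarrow> y \<in> S \<Longrightarrow> D x y \<in> S"
    and adjoint: "x \<in> S \<Longrightarrow> y \<in> S \<Longrightarrow> z \<in> S \<Longrightarrow> D x y \<bullet> z = y \<bullet> delbar br J x z"
begin

lemmas D_simps = bilinear_ladd[OF bilinear_D] bilinear_radd[OF bilinear_D]
  bilinear_lmul[OF bilinear_D] bilinear_rmul[OF bilinear_D]
  bilinear_lneg[OF bilinear_D] bilinear_rneg[OF bilinear_D]
  bilinear_lsub[OF bilinear_D] bilinear_rsub[OF bilinear_D]
  bilinear_lzero[OF bilinear_D] bilinear_rzero[OF bilinear_D]

lemma D_J1: assumes "x \<in> S" "y \<in> S" shows "D (J x) y = J (D x y)"
  using assms by (intro inner_ext) (simp_all add: S_closed D_in adjoint B_J1 B_J2 J_skew B_in)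

lemma D_J2: assumes "x \<in> S" "y \<in> S" shows "D x (J y) = J (D x y)"
  using assms by (intro inner_ext) (simp_all add: S_closed D_in adjoint B_J1 B_J2 J_skew B_in)

definition hol :: "'a \<Rightarrow> real" where
  "hol x = D x x \<bullet> D x x - B x x \<bullet> B x x - 2 * (B (B x x) x \<bullet> x)"

end

section \<open>Vanishing holomorphic curvature in the presence of a J-stable ideal that contains all
  brackets\<close>

locale hol_flat_ideal = chern_lie S br J D for S :: "'a::euclidean_space set" and br J D +
  fixes U :: "'a set"
  assumes hol_0: "x \<in> S \<Longrightarrow> hol x = 0"
    and subspace_U: "subspace U" and U_S: "u \<in> U \<Longrightarrow> u \<in> S" and J_U: "u \<in> U \<Longrightarrow> J u \<in> U"
    and br_U: "x \<in> S \<Longrightarrow> y \<in> S \<Longrightarrow> br x y \<in> U"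
begin

definition W where "W = {w \<in> S. \<forall>u\<in>U. w \<bullet> u = 0}"

lemma W_S: "w \<in> W \<Longrightarrow> w \<in> S" and W_U: "w \<in> W \<Longrightarrow> u \<in> U \<Longrightarrow> w \<bullet> u = 0"
  and U_W: "w \<in> W \<Longrightarrow> u \<in> U \<Longrightarrow> u \<bullet> w = 0"
  by (auto simp: W_def inner_commute)

lemma J_W: "w \<in> W \<Longrightarrow> J w \<in> W"
  using J_in J_skew J_U U_S by (auto simp: W_def)

lemma W_add: "w \<in> W \<Longrightarrow> w' \<in> W \<Longrightarrow> w + w' \<in> W"
  by (auto simp: W_def S_closed inner_simps)

lemma decompose: assumes "x \<in> S" obtains u w where "u \<in> U" "w \<in> W" "x = u + w"
proof -
  obtain u w where uw: "u \<in> span U" "\<And>v. v \<in> span U \<Longrightarrow> orthogonal w v" "x = u + w"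
    using orthogonal_subspace_decomp_exists[of U x] by blast
  have sU: "span U = U" using subspace_U by simp
  note uw = uw[unfolded sU]
  then have "u \<in> U" "w \<in> W"
    using assms U_S S_closed(3)[of x u] by (auto simp: W_def orthogonal_def)
  then show thesis using that uw(3) by blast
qed

lemma B_U: "x \<in> S \<Longrightarrow> y \<in> S \<Longrightarrow> B x y \<in> U"
  unfolding delbar_def using br_U J_U subspace_U J_in by (intro subspace_scale subspace_add) auto

lemma D_W: assumes "x \<in> S" "w \<in> W" shows "D x w = 0"
  by (rule inner_ext) (use assms W_S D_in S_closed adjoint B_U W_U in auto)

text \<open>Two of the three terms of \<open>hol\<close> drop out: \<open>D\<close> annihilates
  \<open>W\<close>, and the values of \<open>B\<close> are orthogonal to \<open>W\<close>. What is
  left is minus the squared norm of \<open>B w w\<close>.\<close>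

lemma B_W_self: assumes "w \<in> W" shows "B w w = 0"
proof -
  have "B (B w w) w \<bullet> w = 0" using assms W_S B_U U_S U_W by simp
  then have "B w w \<bullet> B w w = 0" using hol_0[OF W_S[OF assms]] D_W assms W_S unfolding hol_def by simp
  then show ?thesis by simp
qed

text \<open>Polarisation makes \<open>B\<close> skew on \<open>W\<close>. Polarisation with
  \<open>J w'\<close> makes it symmetric, since \<open>B\<close> is antilinear in the first and
  linear in the second argument.\<close>

lemma B_W_W: assumes "w \<in> W" "w' \<in> W" shows "B w w' = 0"
proof -
  have *: "B w v + B v w = 0" if "v \<in> W" for v
    using B_W_self[OF W_add[OF assms(1) that]] B_W_self[OF assms(1)] B_W_self[OF that]
    by (simp add: B_simps add.commute)
  have "J (B w w') - J (B w' w) = 0"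
    using *[OF J_W[OF assms(2)]] assms W_S by (simp add: B_J1 B_J2)
  then have "J (J (B w w' - B w' w)) = 0" by (simp add: J_simps)
  then have "B w w' = B w' w" using J_J[of "B w w' - B w' w"] B_in W_S assms S_closed by simp
  then have "2 *\<^sub>R B w w' = 0" using *[OF assms(2)] by (simp add: scaleR_2)
  then show ?thesis by simp
qed

lemma br_W_J: assumes "w \<in> W" shows "br w (J w) = 0"
proof -
  have "J (br (J w) w) = 0" using B_W_self[OF assms] by (simp add: delbar_def br_self)
  then have "br (J w) w = 0" using J_J[of "br (J w) w"] assms W_S S_closed J_simps(5) by simp
  then show ?thesis by (subst br_anti) simp
qed

text \<open>The coefficient of \<open>t\<^sup>2\<close> in the quartic polynomial
  \<open>hol (w + t *\<^sub>R u)\<close>, which has no constant and no linear term because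
  \<open>D\<close> and \<open>B\<close> vanish on pairs from \<open>W\<close>.\<close>

lemma hol_mixed: assumes w: "w \<in> W" and u: "u \<in> U"
  shows "D w u \<bullet> D w u - (B w u + B u w) \<bullet> (B w u + B u w) - 2 * (B (B w u + B u w) w \<bullet> u) = 0"
proof -
  have S: "w \<in> S" "u \<in> S" using w u W_S U_S by auto
  define a where "a = B w u + B u w"
  define b where "b = B u u"
  have aS: "a \<in> S" "b \<in> S" unfolding a_def b_def using S B_in S_closed by auto
  let ?c2 = "D w u \<bullet> D w u - a \<bullet> a - 2 * (B a w \<bullet> u)"
  let ?c3 = "2 * (D w u \<bullet> D u u) - 2 * (a \<bullet> b) - 2 * (B a u \<bullet> u + B b w \<bullet> u)"
  let ?c4 = "D u u \<bullet> D u u - b \<bullet> b - 2 * (B b u \<bullet> u)"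
  have h: "t\<^sup>2 * ?c2 + t ^ 3 * ?c3 + t ^ 4 * ?c4 = 0" for t :: real
  proof -
    let ?x = "w + t *\<^sub>R u"
    have Dx: "D ?x ?x = t *\<^sub>R D w u + t\<^sup>2 *\<^sub>R D u u"
      using D_W[OF S(1) w] D_W[OF S(2) w] by (simp add: D_simps power2_eq_square scaleR_add_right)
    have Bx: "B ?x ?x = t *\<^sub>R a + t\<^sup>2 *\<^sub>R b"
      using B_W_self[OF w] by (simp add: B_simps a_def b_def power2_eq_square algebra_simps)
    \<comment> \<open>Only the \<open>u\<close> component of the last argument contributes, as
      values of \<open>B\<close> are orthogonal to \<open>w\<close>.\<close>
    have "B (B ?x ?x) ?x \<bullet> w = 0"
      using U_W[OF w B_U] S S_closed B_in by simp
    then have e1: "B (B ?x ?x) ?x \<bullet> ?x = t * (B (B ?x ?x) ?x \<bullet> u)"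
      unfolding inner_add_right inner_scaleR_right by simp
    have e2: "B (B ?x ?x) ?x = t *\<^sub>R B a w + t\<^sup>2 *\<^sub>R B a u + t\<^sup>2 *\<^sub>R B b w + t ^ 3 *\<^sub>R B b u"
      unfolding Bx by (simp add: B_simps power2_eq_square power3_eq_cube algebra_simps)
    have BB: "B (B ?x ?x) ?x \<bullet> ?x =
        t\<^sup>2 * (B a w \<bullet> u) + t ^ 3 * (B a u \<bullet> u + B b w \<bullet> u) + t ^ 4 * (B b u \<bullet> u)"
      unfolding e1 unfolding e2 by (simp add: inner_simps) algebra
    have Dn: "D ?x ?x \<bullet> D ?x ?x = t\<^sup>2 * (D w u \<bullet> D w u) + t ^ 3 * (2 * (D w u \<bullet> D u u)) + t ^ 4 * (D u u \<bullet> D u u)"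
      unfolding Dx by (simp add: inner_simps inner_commute) algebra
    have Bn: "B ?x ?x \<bullet> B ?x ?x = t\<^sup>2 * (a \<bullet> a) + t ^ 3 * (2 * (a \<bullet> b)) + t ^ 4 * (b \<bullet> b)"
      unfolding Bx by (simp add: inner_simps inner_commute) algebra
    have "hol ?x = 0" using hol_0 S S_closed by simp
    then show ?thesis unfolding hol_def BB Dn Bn by algebra
  qed
  \<comment> \<open>Opposite values of \<open>t\<close> eliminate the cubic term; two different
    absolute values separate the quadratic term from the quartic one.\<close>
  have "?c2 = 0" using h[of 1] h[of "-1"] h[of 2] h[of "-2"] by simp
  then show ?thesis unfolding a_def .
qed

text \<open>Averaging over \<open>u\<close> and \<open>J u\<close> keeps the Hermitian part of the quadratic form of \<open>hol_mixed\<close>.\<close>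

lemma hol_mixed_averaged: assumes w: "w \<in> W" and u: "u \<in> U"
  shows "D w u \<bullet> D w u - B w u \<bullet> B w u - B u w \<bullet> B u w - 2 * (B (B u w) w \<bullet> u) = 0"
proof -
  have S: "w \<in> S" "u \<in> S" using w u W_S U_S by auto
  define p where "p = B w u"
  define q where "q = B u w"
  have pq: "p \<in> S" "q \<in> S" unfolding p_def q_def using S B_in by auto
  have 1: "D w u \<bullet> D w u - (p + q) \<bullet> (p + q) - 2 * (B (p + q) w \<bullet> u) = 0"
    using hol_mixed[OF w u] by (simp add: p_def q_def)
  \<comment> \<open>\<open>B w u\<close> is linear in \<open>u\<close> and \<open>B u w\<close>
    antilinear, so the second summand changes sign relative to the first.\<close>
  have e: "B w (J u) + B (J u) w = J (p - q)"
    using S by (simp add: B_J1 B_J2 p_def q_def J_simps)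
  have d: "D w (J u) \<bullet> D w (J u) = D w u \<bullet> D w u"
    using S by (simp add: D_J2 J_inner D_in)
  have f: "J (p - q) \<bullet> J (p - q) = (p - q) \<bullet> (p - q)"
    using pq S_closed by (simp add: J_inner)
  have g: "B (J (p - q)) w \<bullet> J u = - (B (p - q) w \<bullet> u)"
    using pq S S_closed B_in by (simp add: B_J1 J_inner)
  have 2: "D w u \<bullet> D w u - (p - q) \<bullet> (p - q) + 2 * (B (p - q) w \<bullet> u) = 0"
    using hol_mixed[OF w J_U[OF u]] unfolding e d f g by simp
  have "2 * (D w u \<bullet> D w u - p \<bullet> p - q \<bullet> q - 2 * (B q w \<bullet> u)) = 0"
    using 1 2 by (simp add: inner_simps B_simps algebra_simps)
  then show ?thesis unfolding p_def q_def by simp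
qed

text \<open>Taking adjoints in \<open>B_W_W\<close>. This case precedes the general invariance
  \<open>D_in_U\<close> because the trace argument for \<open>B_U_W\<close> already compares
  \<open>D w\<close> and \<open>B w\<close> as endomorphisms of \<open>U\<close>.\<close>

lemma D_U_W: assumes "w \<in> W" "u \<in> U" shows "D w u \<in> U"
proof -
  obtain a b where ab: "a \<in> U" "b \<in> W" "D w u = a + b"
    using decompose[OF D_in[OF W_S[OF assms(1)] U_S[OF assms(2)]]] by blast
  have "b \<bullet> b = (a + b) \<bullet> b" using ab U_W by (simp add: inner_simps)
  also have "\<dots> = u \<bullet> B w b" using ab adjoint assms W_S U_S by metis
  also have "\<dots> = 0" using B_W_W assms ab by simp
  finally show ?thesis using ab by simp
qed

text \<open>The averaged identity has terms of both signs for a single \<open>u\<close>. Only its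
  trace over \<open>U\<close> isolates a sum of squares, each of which then vanishes.\<close>

lemma B_U_W: assumes "w \<in> W" "u \<in> U" shows "B u w = 0"
proof -
  have wS: "w \<in> S" using assms W_S by auto
  obtain E where E: "finite E" "E \<subseteq> U" "card E = dim U"
    "\<And>x. x \<in> U \<Longrightarrow> (\<Sum>e\<in>E. (x \<bullet> e) *\<^sub>R e) = x" "\<And>e. e \<in> E \<Longrightarrow> e \<bullet> e = 1"
    by (rule orthonormal_basis_obtain[OF subspace_U]) (rule that)
  have EU: "e \<in> U" if "e \<in> E" for e using E that by auto
  have 1: "(\<Sum>e\<in>E. D w e \<bullet> D w e) = (\<Sum>e\<in>E. B w e \<bullet> B w e)"
    by (rule sum_adjoint_norm[OF E(4,2)]) (use assms wS D_U_W B_U U_S adjoint in auto)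
  have 2: "(\<Sum>e\<in>E. B (B e w) w \<bullet> e) = 0"
    by (rule antilinear_trace_zero[OF subspace_U _ J_U _ E(2,4) wS br_W_J[OF assms(1)]])
      (use U_S br_U in auto)
  have "(\<Sum>e\<in>E. B e w \<bullet> B e w) = (\<Sum>e\<in>E. D w e \<bullet> D w e - B w e \<bullet> B w e - 2 * (B (B e w) w \<bullet> e))"
    using hol_mixed_averaged[OF assms(1) EU] by (intro sum.cong refl) (simp add: algebra_simps)
  also have "\<dots> = 0" using 1 2 by (simp add: sum_subtractf flip: sum_distrib_left)
  finally have "\<forall>e\<in>E. B e w \<bullet> B e w = 0"
    using sum_nonneg_eq_0_iff[OF E(1), of "\<lambda>e. B e w \<bullet> B e w"] by auto
  then have "(\<Sum>e\<in>E. (u \<bullet> e) *\<^sub>R B e w) = 0" by (intro sum.neutral) auto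
  then have "B (\<Sum>e\<in>E. (u \<bullet> e) *\<^sub>R e) w = 0"
    using linear_sum[OF linear_B(2), of "\<lambda>e. (u \<bullet> e) *\<^sub>R e" E w] by (simp add: B_simps)
  then show ?thesis using E(4)[OF assms(2)] by simp
qed

lemma B_W: assumes "x \<in> S" "w \<in> W" shows "B x w = 0"
proof -
  obtain a b where "a \<in> U" "b \<in> W" "x = a + b" using decompose[OF assms(1)] by blast
  then show ?thesis using B_U_W B_W_W assms by (simp add: B_simps)
qed

lemma D_in_U: assumes "x \<in> S" "u \<in> U" shows "D x u \<in> U"
proof -
  obtain a b where ab: "a \<in> U" "b \<in> W" "D x u = a + b"
    using decompose[OF D_in[OF assms(1) U_S[OF assms(2)]]] by blast
  have "b \<bullet> b = (a + b) \<bullet> b" using ab U_W by (simp add: inner_simps)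
  also have "\<dots> = u \<bullet> B x b" using ab adjoint assms W_S U_S by metis
  also have "\<dots> = 0" using B_W assms ab by simp
  finally show ?thesis using ab by simp
qed

text \<open>With \<open>B u w = 0\<close> the averaged identity loses its last two terms. A map and
  its adjoint having the same norm at each vector means that \<open>B w\<close> is normal on
  \<open>U\<close>.\<close>

lemma D_B_norm: assumes "w \<in> W" "u \<in> U" shows "D w u \<bullet> D w u = B w u \<bullet> B w u"
  using hol_mixed_averaged[OF assms] B_U_W[OF assms] by (simp add: B_simps)

text \<open>Because \<open>D\<close> preserves \<open>U\<close>, the restriction of
  \<open>D x\<close> is the adjoint of the restriction of \<open>B x\<close>. The same
  \<open>D\<close> therefore serves for the ideal, and \<open>hol\<close> is literally the same
  function.\<close>

lemma sub_chern_lie: "chern_lie U br J D"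
proof
  fix x y z
  show "br x (br y z) = br (br x y) z + br y (br x z)" by (rule jacobi)
  show "br x x = 0" by (rule br_self)
  show "J x \<in> U" "J (J x) = - x" if "x \<in> U" using J_U J_J[OF U_S] that by blast+
  assume x: "x \<in> U" and y: "y \<in> U"
  show "br x y \<in> U" by (rule br_U[OF U_S[OF x] U_S[OF y]])
  show "J x \<bullet> J y = x \<bullet> y" by (rule J_inner[OF U_S[OF x] U_S[OF y]])
  show "br x y - br (J x) (J y) + J (br (J x) y) + J (br x (J y)) = 0"
    by (rule nijenhuis[OF U_S[OF x] U_S[OF y]])
  show "D x y \<in> U" by (rule D_in_U[OF U_S[OF x] y])
  show "D x y \<bullet> z = y \<bullet> B x z" if "z \<in> U" by (rule adjoint[OF U_S[OF x] U_S[OF y] U_S[OF that]])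
qed (rule subspace_U bilinear_br J_simps bilinear_D)+

end

section \<open>Nilpotent algebras\<close>

lemma nilpotent_bounded:
  assumes "chern_lie S br J D" and nil: "lcs br S k = {0}" and x: "x \<in> S" and y: "y \<in> S"
  shows "(delbar br J x ^^ k) y = 0"
proof -
  interpret chern_lie S br J D by fact
  have sub: "lcs br S n \<subseteq> S" "subspace (lcs br S n)" for n
    using lcs_subset[of S n] br_closed subspace_S subspace_lcs by auto
  \<comment> \<open>Powers of \<open>B x\<close> descend through the J-hulls of the lower central
    series: \<open>B x\<close> is made of \<open>br x\<close>, \<open>br (J x)\<close> and
    \<open>J\<close>, and it commutes with \<open>J\<close>.\<close>
  have "\<exists>a\<in>lcs br S n. \<exists>b\<in>lcs br S n. (B x ^^ n) y = a + J b" for n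
  proof (induction n)
    case 0
    then show ?case using y S_closed(1) by (intro bexI[of _ y] bexI[of _ 0]) (auto simp: J_simps)
  next
    case (Suc n)
    then obtain a b where ab: "a \<in> lcs br S n" "b \<in> lcs br S n" "(B x ^^ n) y = a + J b" by auto
    then have abS: "a \<in> S" "b \<in> S" using sub by auto
    have mem: "br x c \<in> lcs br S (Suc n)" "br (J x) c \<in> lcs br S (Suc n)" if "c \<in> lcs br S n" for c
      using that x J_in by (auto intro!: span_base)
    let ?a = "(1/2) *\<^sub>R (br x a - br (J x) b)" and ?b = "(1/2) *\<^sub>R (br (J x) a + br x b)"
    have "(B x ^^ Suc n) y = B x a + J (B x b)"
      using ab(3) x abS by (simp add: B_simps B_J2)
    also have "\<dots> = ?a + J ?b"
      using J_J[of "br (J x) b"] x abS S_closed by (simp add: delbar_def J_simps algebra_simps)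
    finally show ?case
      using mem ab sub(2)[of "Suc n"] by (intro bexI[of _ ?a] bexI[of _ ?b]) (auto intro!: subspace_scale subspace_diff subspace_add simp del: lcs.simps)
  qed
  from this[of k] show ?thesis using nil J_simps(5) by auto
qed

text \<open>
  If the \<open>J\<close>-hull of the commutator algebra were \<open>S\<close>, integrability of \<open>J\<close> would show that \<open>S\<close> is
  the \<open>J\<close>-hull of every term of the lower central series.
\<close>

lemma commutator_hull_proper:
  assumes "complex_lie S br J" and nil: "lcs br S k = {0}" and ne: "S \<noteq> {0}"
  shows "{a + J b |a b. a \<in> lcs br S 1 \<and> b \<in> lcs br S 1} \<noteq> S"
proof
  interpret complex_lie S br J by fact
  let ?h = "\<lambda>n. {a + J b |a b. a \<in> lcs br S n \<and> b \<in> lcs br S n}"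
  assume h1: "?h 1 = S"
  have sub: "lcs br S n \<subseteq> S" "subspace (lcs br S n)" for n
    using lcs_subset[of S n] br_closed subspace_S subspace_lcs by auto
  have subh: "subspace (?h n)" for n
    unfolding subspace_def
  proof (intro conjI ballI allI)
    have "0 = 0 + J 0" by (simp add: J_simps)
    then show "0 \<in> ?h n" using subspace_0[OF sub(2)] by blast
    show "x + y \<in> ?h n" if "x \<in> ?h n" "y \<in> ?h n" for x y
    proof -
      obtain a b c d where "a \<in> lcs br S n" "b \<in> lcs br S n" "c \<in> lcs br S n" "d \<in> lcs br S n"
        "x = a + J b" "y = c + J d" using \<open>x \<in> ?h n\<close> \<open>y \<in> ?h n\<close> by auto
      moreover from this have "x + y = (a + c) + J (b + d)" by (simp add: J_simps)
      ultimately show ?thesis using subspace_add[OF sub(2)] by blast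
    qed
    show "c *\<^sub>R x \<in> ?h n" if "x \<in> ?h n" for c x
    proof -
      obtain a b where "a \<in> lcs br S n" "b \<in> lcs br S n" "x = a + J b" using \<open>x \<in> ?h n\<close> by auto
      moreover from this have "c *\<^sub>R x = c *\<^sub>R a + J (c *\<^sub>R b)" by (simp add: J_simps scaleR_add_right)
      ultimately show ?thesis using subspace_scale[OF sub(2)] by blast
    qed
  qed
  have in_h: "a \<in> ?h n" if "a \<in> lcs br S n" for a n
  proof -
    have "a = a + J 0" by (simp add: J_simps)
    then show ?thesis using that subspace_0[OF sub(2)] by blast
  qed
  have Jh: "J x \<in> ?h n" if "x \<in> ?h n" for x n
  proof -
    obtain a b where ab: "a \<in> lcs br S n" "b \<in> lcs br S n" "x = a + J b" using \<open>x \<in> ?h n\<close> by auto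
    then have "b \<in> S" using sub(1) by blast
    then have "J x = - b + J a" unfolding ab(3) by (simp add: J_simps J_J)
    then show ?thesis using ab subspace_neg[OF sub(2)] by blast
  qed
  have "S \<subseteq> ?h n" for n
  proof (induction n)
    case 0
    show ?case
    proof
      fix x assume "x \<in> S"
      then show "x \<in> ?h 0" by (intro in_h) simp
    qed
  next
    case (Suc n)
    have gen: "br x y \<in> ?h (Suc n)" if "x \<in> S" "y \<in> S" for x y
    proof -
      have x: "x \<in> ?h n" and y: "y \<in> ?h n" using Suc that by (blast, blast)
      from x obtain a b where ab: "a \<in> lcs br S n" "b \<in> lcs br S n" "x = a + J b" by blast
      from y obtain c d where cd: "c \<in> lcs br S n" "d \<in> lcs br S n" "y = c + J d" by blast
      have S: "a \<in> S" "b \<in> S" "c \<in> S" "d \<in> S"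
        using ab(1,2) cd(1,2) by (auto intro: subsetD[OF sub(1)])
      have r: "br s t \<in> ?h (Suc n)" if "s \<in> S" "t \<in> lcs br S n" for s t
        using that by (intro in_h) (auto intro: span_base)
      have l: "br t s \<in> ?h (Suc n)" if "s \<in> S" "t \<in> lcs br S n" for s t
        using subspace_neg[OF subh r[OF that]] br_anti[of t s] by simp
      \<comment> \<open>The bracket of two images under \<open>J\<close> is traded, up to
        \<open>J\<close>, for brackets with one factor in \<open>lcs br S n\<close>.\<close>
      have "br (J b) (J d) = br b d + J (br (J b) d) + J (br b (J d))"
        using nijenhuis[OF S(2,4)] by (simp add: algebra_simps)
      then have "br x y = br a c + br a (J d) + br (J b) c + (br b d + J (br (J b) d) + J (br b (J d)))"
        unfolding ab(3) cd(3) br_simps by (simp only: add.assoc add.left_commute add.commute)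
      moreover have "\<dots> \<in> ?h (Suc n)"
        by (intro subspace_add[OF subh] Jh l[OF J_in[OF S(4)] ab(1)] l[OF J_in[OF S(4)] ab(2)]
            r[OF S(1) cd(1)] r[OF J_in[OF S(2)] cd(1)] r[OF S(2) cd(2)] r[OF J_in[OF S(2)] cd(2)])
      ultimately show ?thesis by (simp only:)
    qed
    have "lcs br S 1 \<subseteq> ?h (Suc n)"
      unfolding One_nat_def lcs.simps(2)[of br S 0] lcs.simps(1)
      by (rule span_in[of "?h (Suc n)" S S br, OF subh gen])
    then have in_hS: "a \<in> ?h (Suc n)" if "a \<in> lcs br S 1" for a using that by (rule subsetD)
    have "?h 1 \<subseteq> ?h (Suc n)"
    proof
      fix x assume "x \<in> ?h 1"
      then obtain a b where "a \<in> lcs br S 1" "b \<in> lcs br S 1" "x = a + J b" by blast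
      then show "x \<in> ?h (Suc n)" using subspace_add[OF subh in_hS Jh[OF in_hS]] by simp
    qed
    then show ?case unfolding h1 .
  qed
  from this[of k] have "S \<subseteq> {0}" unfolding nil by (simp add: J_simps)
  then show False using ne subspace_0[OF subspace_S] by auto
qed

lemma lcs_mono:
  assumes "U \<subseteq> S" shows "lcs br U n \<subseteq> lcs br S n"
proof (induction n)
  case (Suc n)
  then show ?case using assms unfolding lcs.simps by (intro span_mono) blast
qed (use assms in simp)

text \<open>All hypotheses pass to the J-hull \<open>U\<close> of the commutator algebra, whose
  dimension is smaller by \<open>commutator_hull_proper\<close>. Only \<open>B w u\<close> with
  \<open>w \<in> W\<close> and \<open>u \<in> U\<close> is left after the induction hypothesis and
  \<open>B_W\<close>.\<close>

lemma nilpotent_hol_flat: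
  assumes "chern_lie S br J D" "lcs br S k = {0}"
    and "\<And>x. x \<in> S \<Longrightarrow> chern_lie.hol br J D x = 0"
  shows "x \<in> S \<Longrightarrow> y \<in> S \<Longrightarrow> delbar br J x y = 0"
  using assms
proof (induction "dim S" arbitrary: S x y rule: less_induct)
  case less
  interpret chern_lie S br J D by fact
  show ?case
  proof (cases "S = {0}")
    case True
    then show ?thesis using less.prems by (simp add: B_simps)
  next
    case False
    define U where "U = {a + J b |a b. a \<in> lcs br S 1 \<and> b \<in> lcs br S 1}"
    have L: "subspace (lcs br S 1)" "lcs br S 1 \<subseteq> S"
      using subspace_lcs subspace_S lcs_subset[of S 1] br_closed by auto
    have US: "u \<in> S" if "u \<in> U" for u 
    proof -
      obtain a b where "a \<in> lcs br S 1" "b \<in> lcs br S 1" "u = a + J b"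
        using \<open>u \<in> U\<close> unfolding U_def by blast
      then show ?thesis using L(2) S_closed(2,6) by blast
    qed
    have subU: "subspace U"
      unfolding U_def
      by (rule subspace_sums[OF L(1) linear_subspace_image[OF linear_J L(1)], THEN back_subst[of subspace]]) blast
    interpret hol_flat_ideal S br J D U
    proof
      show "J u \<in> U" if "u \<in> U" for u
      proof -
        obtain a b where ab: "a \<in> lcs br S 1" "b \<in> lcs br S 1" "u = a + J b"
          using \<open>u \<in> U\<close> unfolding U_def by auto
        then have "b \<in> S" using L(2) by blast
        then have "J u = - b + J a" unfolding ab(3) by (simp add: J_simps J_J)
        then show ?thesis using ab subspace_neg[OF L(1)] unfolding U_def by blast
      qed
      show "br x y \<in> U" if "x \<in> S" "y \<in> S" for x y
      proof -
        have "br x y \<in> lcs br S 1" "br x y = br x y + J 0"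
          using that by (auto intro: span_base simp: J_simps)
        then show ?thesis unfolding U_def using subspace_0[OF L(1)] by blast
      qed
    qed (use less.prems(5) US subU in blast)+
    have "U \<noteq> S"
      unfolding U_def by (rule commutator_hull_proper[OF complex_lie_axioms less.prems(4) False])
    then have "dim U < dim S"
      using subspace_dim_equal[OF subU subspace_S] US by (meson not_le subsetI)
    moreover have "lcs br U k = {0}"
      using lcs_mono[of U S br k] US less.prems(4) subspace_0[OF subspace_lcs[OF subU]] by blast
    ultimately have BU: "B u v = 0" if "u \<in> U" "v \<in> U" for u v
      using less.hyps[of U u v] that sub_chern_lie hol_0 U_S by blast
    have BW: "B w u = 0" if w: "w \<in> W" and u: "u \<in> U" for w u
    proof -
      have wS: "w \<in> S" using w W_S by auto
      \<comment> \<open>Normality of \<open>B w\<close> on \<open>U\<close>: a vector annihilated by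
        \<open>B w\<close> is annihilated by the adjoint \<open>D w\<close> and hence orthogonal to
        the values of \<open>B w\<close>. So the kernel of the square is the kernel.\<close>
      have ker: "B w v = 0" if "v \<in> U" "B w (B w v) = 0" for v
      proof -
        have "B w v \<in> U" using B_U wS U_S that by auto
        then have "D w (B w v) = 0" using D_B_norm[OF w, of "B w v"] that by simp
        then have "B w v \<bullet> B w v = 0" using adjoint[OF wS B_in[OF wS] , of v v] wS U_S that by simp
        then show ?thesis by simp
      qed
      have pow_U: "(B w ^^ n) u \<in> U" for n
        using u B_U wS U_S by (induction n) auto
      have "(B w ^^ Suc n) u = 0 \<Longrightarrow> B w u = 0" for n
      proof (induction n)
        case (Suc n)
        then have "B w (B w ((B w ^^ n) u)) = 0" by simp
        then have "B w ((B w ^^ n) u) = 0" using ker pow_U by blast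
        then show ?case using Suc by simp
      qed simp
      moreover have "(B w ^^ Suc k) u = 0"
        using nilpotent_bounded[OF less.prems(3,4) wS U_S[OF u]] by (simp add: B_simps)
      ultimately show ?thesis by blast
    qed
    obtain a b where ab: "a \<in> U" "b \<in> W" "x = a + b" using decompose[OF less.prems(1)] by blast
    obtain c d where cd: "c \<in> U" "d \<in> W" "y = c + d" using decompose[OF less.prems(2)] by blast
    have "B x d = 0" using B_W less.prems(1) cd by blast
    then show ?thesis using ab cd BU BW by (simp add: B_simps)
  qed
qed

text \<open>The assumption \<open>nab_delbar\<close> is the torsion condition in algebraic form: it
  says that the (0,1) part of the connection is \<open>B\<close>. Metric and J-parallelism are
  \<open>nab_skew\<close> and \<open>nab_J\<close>.\<close>

locale chern_lie_connection = complex_lie S br J for S :: "'a::euclidean_space set" and br J +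
  fixes nab :: "'a \<Rightarrow> 'a \<Rightarrow> 'a"
  assumes bilinear_nab: "bilinear nab" and nab_in: "x \<in> S \<Longrightarrow> y \<in> S \<Longrightarrow> nab x y \<in> S"
    and nab_skew: "x \<in> S \<Longrightarrow> y \<in> S \<Longrightarrow> z \<in> S \<Longrightarrow> nab x y \<bullet> z + y \<bullet> nab x z = 0"
    and nab_J: "x \<in> S \<Longrightarrow> y \<in> S \<Longrightarrow> nab x (J y) = J (nab x y)"
    and nab_delbar: "x \<in> S \<Longrightarrow> y \<in> S \<Longrightarrow> nab x y + J (nab (J x) y) = br x y + J (br (J x) y)"
begin

definition D where "D x y = B x y - nab x y"

definition Rm where "Rm x y z = nab x (nab y z) - nab y (nab x z) - nab (br x y) z"

lemmas nab_simps = bilinear_ladd[OF bilinear_nab] bilinear_radd[OF bilinear_nab]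
  bilinear_lmul[OF bilinear_nab] bilinear_rmul[OF bilinear_nab]
  bilinear_lneg[OF bilinear_nab] bilinear_rneg[OF bilinear_nab]
  bilinear_lsub[OF bilinear_nab] bilinear_rsub[OF bilinear_nab]
  bilinear_lzero[OF bilinear_nab] bilinear_rzero[OF bilinear_nab]

text \<open>\<open>nab x\<close> is skew and \<open>J (nab (J x) _)\<close> is self-adjoint on
  \<open>S\<close>. As \<open>B x\<close> is half their sum, its adjoint is half the difference, and
  that is \<open>D x\<close>.\<close>

sublocale chern_lie S br J D
proof unfold_locales
  show "bilinear D"
    unfolding bilinear_def D_def
    by (auto intro!: linearI simp: B_simps nab_simps algebra_simps)
  show "D x y \<in> S" if "x \<in> S" "y \<in> S" for x y
    unfolding D_def using that nab_in B_in S_closed by auto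
  show "D x y \<bullet> z = y \<bullet> B x z" if xyz: "x \<in> S" "y \<in> S" "z \<in> S" for x y z
  proof -
    have a: "D x y = (1/2) *\<^sub>R (J (nab (J x) y) - nab x y)" if "y \<in> S" for y
    proof -
      have "2 *\<^sub>R D x y = 2 *\<^sub>R B x y - 2 *\<^sub>R nab x y" by (simp add: D_def scaleR_diff_right)
      also have "2 *\<^sub>R B x y = nab x y + J (nab (J x) y)" using nab_delbar[OF xyz(1) that] by (simp add: delbar_def)
      also have "nab x y + J (nab (J x) y) - 2 *\<^sub>R nab x y = J (nab (J x) y) - nab x y" by (simp add: scaleR_2)
      finally have "(1/2) *\<^sub>R (2 *\<^sub>R D x y) = (1/2) *\<^sub>R (J (nab (J x) y) - nab x y)" by simp
      then show ?thesis by simp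
    qed
    have 1: "J (nab (J x) y) \<bullet> z = y \<bullet> J (nab (J x) z)"
      using nab_skew[of "J x" y "J z"] xyz nab_in J_in by (simp add: J_skew nab_J)
    have 2: "nab x y \<bullet> z = - (y \<bullet> nab x z)" using nab_skew[OF xyz] by simp
    have "D x y \<bullet> z = (1/2) * (y \<bullet> (nab x z + J (nab (J x) z)))"
      unfolding a[OF xyz(2)] by (simp add: inner_simps 1 2)
    also have "\<dots> = y \<bullet> B x z" unfolding nab_delbar[OF xyz(1,3)] by (simp add: delbar_def)
    finally show ?thesis .
  qed
qed

lemma nab_B_D: "nab x y = B x y - D x y"
  by (simp add: D_def)

lemma J_nab_J: assumes "x \<in> S" "y \<in> S" shows "J (nab (J x) y) = B x y + D x y"
  unfolding nab_B_D[of "J x" y] B_J1[OF assms] D_J1[OF assms] J_simps J_J[OF B_in[OF assms]] J_J[OF D_in[OF assms]]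
  by simp

lemma br_J_self: assumes "x \<in> S" shows "br x (J x) = 2 *\<^sub>R J (B x x)"
proof -
  have "2 *\<^sub>R J (B x x) = J (J (br (J x) x))" by (simp add: delbar_def br_self J_simps)
  also have "\<dots> = br x (J x)" using assms S_closed by (simp add: J_J br_anti[of "J x" x])
  finally show ?thesis by simp
qed

text \<open>Every covariant derivative is expressed by \<open>B\<close> and \<open>D\<close> after
  \<open>J\<close> has been moved outside; \<open>br_J_self\<close> turns the bracket term into
  \<open>B (B x x) x\<close>. The factor 2 is the reason for \<open>c / 2\<close> later.\<close>

lemma Rm_hol: assumes x: "x \<in> S" shows "Rm x (J x) (J x) \<bullet> x = 2 * hol x"
proof -
  note c = x B_in[OF x x] D_in[OF x x] J_in[OF x]
  have 1: "nab (J x) (J x) = B x x + D x x" using x c by (simp add: nab_J J_nab_J)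
  have 2: "nab x (J x) = J (B x x - D x x)" using x c by (simp add: nab_J nab_B_D[of x x])
  have 3: "nab (J x) (J (B x x - D x x)) = B x (B x x - D x x) + D x (B x x - D x x)"
    using x c S_closed by (simp add: nab_J J_nab_J)
  have 4: "nab (br x (J x)) (J x) = 2 *\<^sub>R (B (B x x) x + D (B x x) x)"
    unfolding br_J_self[OF x] using x c by (simp add: nab_simps nab_J J_nab_J J_in)
  have a: "B x (D x x) \<bullet> x = D x x \<bullet> D x x" "D x (B x x) \<bullet> x = B x x \<bullet> B x x"
    "D (B x x) x \<bullet> x = B (B x x) x \<bullet> x"
    using adjoint[of x x "D x x"] adjoint[of x "B x x" x] adjoint[of "B x x" x x] c
    by (simp_all add: inner_commute)
  have "Rm x (J x) (J x) = 2 *\<^sub>R (B x (D x x) - D x (B x x)) - 2 *\<^sub>R (B (B x x) x + D (B x x) x)"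
    unfolding Rm_def 1 2 3 4 by (simp add: nab_B_D[of x "B x x + D x x"] B_simps D_simps scaleR_2 algebra_simps)
  then show ?thesis by (simp add: inner_simps a hol_def)
qed

text \<open>The last nonzero term of the lower central series is central.\<close>

lemma nilpotent_center:
  assumes "lcs br U n = {0}" "U \<noteq> {0}" "subspace U" "U \<subseteq> S" "\<And>x y. x \<in> U \<Longrightarrow> y \<in> U \<Longrightarrow> br x y \<in> U"
  shows "\<exists>x\<in>U. x \<noteq> 0 \<and> (\<forall>u\<in>U. br u x = 0)"
proof -
  define m where "m = (LEAST n. lcs br U n = {0})"
  have m: "lcs br U m = {0}" unfolding m_def by (rule LeastI) fact
  have "m \<noteq> 0" using m assms(2) by (metis lcs.simps(1))
  then obtain p where p: "m = Suc p" using not0_implies_Suc by blast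
  have "lcs br U p \<noteq> {0}" using not_less_Least[of p "\<lambda>n. lcs br U n = {0}"] p m_def by simp
  then obtain x where x: "x \<in> lcs br U p" "x \<noteq> 0" using subspace_0[OF subspace_lcs[OF assms(3)], of p] by blast
  have "br u x = 0" if "u \<in> U" for u
  proof -
    have "br u x \<in> lcs br U m" unfolding p using that x by (auto intro: span_base)
    then show ?thesis using m by simp
  qed
  moreover have "x \<in> U" using x lcs_subset[OF assms(5,3)] by blast
  ultimately show ?thesis using x by blast
qed

theorem constant_hol_flat:
  assumes solv: "der_ser br S k = {0}" and JU: "J ` der_ser br S 1 = der_ser br S 1"
    and const: "\<And>x. x \<in> S \<Longrightarrow> Rm x (J x) (J x) \<bullet> x = c * (x \<bullet> x)\<^sup>2"
    and xyz: "x \<in> S" "y \<in> S" "z \<in> S"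
  shows "Rm x y z = 0"
proof (cases "S = {0}")
  case True
  then show ?thesis using xyz by (simp add: Rm_def nab_simps)
next
  case False
  define U where "U = der_ser br S 1"
  have U: "subspace U" "U \<subseteq> S" unfolding U_def by (rule subspace_der_ser, rule der_ser_subset)
  have br_U: "br x y \<in> U" if "x \<in> S" "y \<in> S" for x y unfolding U_def by (rule der_ser_1_ideal[OF that])
  have J_U: "J u \<in> U" if "u \<in> U" for u using JU that unfolding U_def by blast
  have BU: "B x y \<in> U" if "x \<in> S" "y \<in> S" for x y
    unfolding delbar_def using br_U J_U U J_in that by (intro subspace_scale subspace_add) auto
  obtain n where nil: "lcs br U n = {0}" using derived_algebra_nilpotent[OF solv] U_def by blast
  \<comment> \<open>A perfect algebra has a constant derived series. Solvability thus provides a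
    nonzero vector \<open>w\<close> orthogonal to \<open>U\<close>, on which the sign of
    \<open>c\<close> is tested.\<close>
  have "U \<noteq> S"
  proof
    assume "U = S"
    have "der_ser br S j = S" for j
    proof (induction j)
      case (Suc j)
      then have "der_ser br S (Suc j) = der_ser br S 1" by simp
      then show ?case using \<open>U = S\<close> U_def by simp
    qed simp
    then show False using solv False by simp
  qed
  then obtain v where v: "v \<in> S" "v \<notin> U" using U by blast
  have sU: "span U = U" using U(1) by simp
  obtain a w where aw: "a \<in> U" "\<And>u. u \<in> U \<Longrightarrow> orthogonal w u" "v = a + w"
    using orthogonal_subspace_decomp_exists[of U v] unfolding sU by blast
  have w: "w \<in> S" "w \<noteq> 0" using aw v U S_closed(3)[of v a] by auto
  have hol_c: "hol x = c / 2 * (x \<bullet> x)\<^sup>2" if "x \<in> S" for x using const[OF that] Rm_hol[OF that] by simp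
  have Dw: "D w w = 0"
  proof -
    have "D w w \<bullet> D w w = w \<bullet> B w (D w w)" using adjoint w D_in by auto
    also have "\<dots> = 0" using aw(2)[OF BU[OF w(1) D_in[OF w(1) w(1)]]] by (simp add: orthogonal_def)
    finally show ?thesis by simp
  qed
  have "B (B w w) w \<bullet> w = 0"
    using aw(2)[OF BU[OF B_in[OF w(1) w(1)] w(1)]] by (simp add: orthogonal_def inner_commute)
  then have hw: "hol w = - (B w w \<bullet> B w w)" unfolding hol_def Dw by simp
  have pos: "(x \<bullet> x)\<^sup>2 > 0" if "x \<noteq> 0" for x :: 'a using that by simp
  have "c / 2 * (w \<bullet> w)\<^sup>2 \<le> 0" using hw hol_c[OF w(1)] by simp
  then have "c \<le> 0" using pos[OF w(2)] by (simp add: mult_le_0_iff)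
  moreover have "c \<ge> 0"
  proof (cases "U = {0}")
    \<comment> \<open>In the abelian case there is no central vector to choose in \<open>U\<close>,
      but \<open>B\<close> vanishes and \<open>hol w\<close> is zero.\<close>
    case True
    then have "B w w = 0" using BU[OF w(1) w(1)] by simp
    then have "c / 2 * (w \<bullet> w)\<^sup>2 = 0" using hw hol_c[OF w(1)] by simp
    then show ?thesis using w(2) by simp
  next
    case False
    obtain x where x: "x \<in> U" "x \<noteq> 0" "\<forall>u\<in>U. br u x = 0"
      using nilpotent_center[OF nil False U] br_U U(2) by blast
    then have xS: "x \<in> S" using U by blast
    \<comment> \<open>As \<open>J x\<close> lies in \<open>U\<close> too, it commutes with
      \<open>x\<close>, and \<open>hol x\<close> reduces to the squared norm of
      \<open>D x x\<close>.\<close>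
    have "B x x = 0" using x J_U by (simp add: delbar_def br_self J_simps)
    then have "hol x \<ge> 0" unfolding hol_def by (simp add: B_simps)
    then have "c / 2 * (x \<bullet> x)\<^sup>2 \<ge> 0" using hol_c[OF xS] by simp
    then show ?thesis using pos[OF x(2)] by (simp add: zero_le_mult_iff)
  qed
  ultimately have hol0: "hol x = 0" if "x \<in> S" for x using hol_c[OF that] by simp
  interpret hol_flat_ideal S br J D U
    by unfold_locales (use hol0 U J_U br_U in blast)+
  have BUU: "B u v = 0" if "u \<in> U" "v \<in> U" for u v
    by (rule nilpotent_hol_flat[OF sub_chern_lie nil _ that]) (use hol0 U in blast)
  have BU0: "B u v = 0" if uv: "u \<in> U" "v \<in> S" for u v
  proof -
    obtain a b where "a \<in> U" "b \<in> W" "v = a + b" using decompose[OF uv(2)] by blast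
    then show ?thesis using BUU[OF uv(1)] B_W[OF U_S[OF uv(1)]] by (simp add: B_simps)
  qed
  have DU0: "D u v = 0" if "u \<in> U" "v \<in> S" for u v
  proof -
    have "D u v \<bullet> D u v = v \<bullet> B u (D u v)" using adjoint U_S that D_in by auto
    then show ?thesis using BU0 that D_in U_S by simp
  qed
  have norm_eq: "D x z \<bullet> D x z = B x z \<bullet> B x z" if xz: "x \<in> S" "z \<in> S" for x z
  proof -
    obtain a w where x: "a \<in> U" "w \<in> W" "x = a + w" using decompose[OF xz(1)] by blast
    obtain b w' where z: "b \<in> U" "w' \<in> W" "z = b + w'" using decompose[OF xz(2)] by blast
    have "B x z = B w b" "D x z = D w b"
      using BU0[OF x(1) xz(2)] DU0[OF x(1) xz(2)] B_W[OF W_S[OF x(2)] z(2)] D_W[OF W_S[OF x(2)] z(2)] x z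
      by (simp_all add: B_simps D_simps)
    then show ?thesis using D_B_norm[OF x(2) z(1)] by simp
  qed
  \<comment> \<open>Polarising the equality of norms gives
    \<open>D x z \<bullet> D x v = B x z \<bullet> B x v\<close>; moving one factor across by
    adjunction yields normality of \<open>B x\<close> on all of \<open>S\<close>.\<close>
  have normal: "B x (D x v) = D x (B x v)" if xv: "x \<in> S" "v \<in> S" for x v
  proof (rule inner_ext)
    fix z assume z: "z \<in> S"
    have "D x (z + v) \<bullet> D x (z + v) = B x (z + v) \<bullet> B x (z + v)" using norm_eq xv z S_closed by blast
    then have "D x z \<bullet> D x v = B x z \<bullet> B x v"
      using norm_eq[OF xv(1) z] norm_eq[OF xv] by (simp add: B_simps D_simps inner_simps inner_commute)
    then show "B x (D x v) \<bullet> z = D x (B x v) \<bullet> z"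
      using adjoint[of x z "D x v"] adjoint[of x "B x v" z] xv z B_in D_in by (simp add: inner_commute)
  qed (use xv B_in D_in in auto)
  have comm: "B x (D y v) = D y (B x v)" if xyv: "x \<in> S" "y \<in> S" "v \<in> S" for x y v
  proof -
    \<comment> \<open>\<open>C\<close> is antilinear in \<open>x\<close>, linear in
      \<open>y\<close>, and zero on the diagonal by \<open>normal\<close>. As in
      \<open>B_W_W\<close>, the two polarisations make it vanish.\<close>
    define C where "C x y = B x (D y v) - D y (B x v)" for x y
    have C_in: "C x y \<in> S" if "x \<in> S" "y \<in> S" for x y unfolding C_def using that xyv B_in D_in S_closed by auto
    have "C x y + C y x = 0" if "x \<in> S" "y \<in> S" for x y
      using normal[of "x + y" v] normal[of x v] normal[of y v] that xyv S_closed
      by (simp add: C_def B_simps D_simps algebra_simps)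
    note sym = this
    have 1: "C x (J y) = J (C x y)" "C (J y) x = - J (C y x)"
      using xyv B_in D_in by (simp_all add: C_def B_J1 B_J2 D_J1 D_J2 J_simps D_simps)
    have "J (C x y - C y x) = 0" using sym[of x "J y"] xyv J_in 1 by (simp add: J_simps)
    then have "J (J (C x y - C y x)) = 0" by (simp only: J_simps)
    then have "C x y = C y x" using J_J[OF S_closed(3)[OF C_in C_in]] xyv by simp
    then have "2 *\<^sub>R C x y = 0" using sym[OF xyv(1,2)] by (simp add: scaleR_2)
    then show ?thesis by (simp add: C_def)
  qed
  have BB: "B x (B y v) = B y (B x v)" if "x \<in> S" "y \<in> S" "v \<in> S" for x y v
  proof -
    have "br x y - br (J x) (J y) \<in> U" using that br_U U J_in by (intro subspace_diff) auto
    then show ?thesis using B_commutator[OF that] BU0 that by simp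
  qed
  have DD: "D x (D y z) = D y (D x z)"
  proof (rule inner_ext)
    fix v assume v: "v \<in> S"
    show "D x (D y z) \<bullet> v = D y (D x z) \<bullet> v"
      using BB[OF xyz(1,2) v] xyz v D_in B_in by (simp add: adjoint)
  qed (use xyz D_in in auto)
  \<comment> \<open>What remains of the curvature is the commutator of \<open>B x - D x\<close> and
    \<open>B y - D y\<close>, all of whose parts commute.\<close>
  have "nab (br x y) z = 0" unfolding nab_B_D[of "br x y" z] using BU0 DU0 br_U xyz by simp
  then show ?thesis
    unfolding Rm_def nab_B_D[of x "nab y z"] nab_B_D[of y "nab x z"]
    unfolding nab_B_D[of y z] nab_B_D[of x z]
    by (simp add: B_simps D_simps BB[OF xyz] DD comm[OF xyz] comm[OF xyz(2,1,3)])
qed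

end

section \<open>Smooth functions\<close>

abbreviation fder :: "('v::real_normed_vector \<Rightarrow> 'w::real_normed_vector) \<Rightarrow> 'v \<Rightarrow> 'v \<Rightarrow> 'w" where
  "fder f x \<equiv> frechet_derivative f (at x)"

lemma fder_eq: "(f has_derivative f') (at x) \<Longrightarrow> fder f x = f'"
  using frechet_derivative_at by metis

lemma fder_works: "f differentiable (at x) \<Longrightarrow> (f has_derivative fder f x) (at x)"
  by (simp add: frechet_derivative_works)

lemma fder_linear: "f differentiable (at x) \<Longrightarrow> linear (fder f x)"
  using fder_works has_derivative_linear by blast

lemma fder_cong:
  assumes "open S" "x \<in> S" "\<And>y. y \<in> S \<Longrightarrow> f y = g y" "f differentiable (at x)"
  shows "fder g x = fder f x" "g differentiable (at x)"
proof -
  have "(g has_derivative fder f x) (at x)"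
    using has_derivative_transform_within_open[OF fder_works[OF assms(4)] assms(1,2,3)] .
  then show "fder g x = fder f x" "g differentiable (at x)"
    by (auto simp: fder_eq differentiable_def)
qed

lemma fder_compose:
  assumes "f differentiable (at x)" "h differentiable (at (f x))"
  shows "fder (\<lambda>x. h (f x)) x v = fder h (f x) (fder f x v)" "(\<lambda>x. h (f x)) differentiable (at x)"
proof -
  have "((\<lambda>x. h (f x)) has_derivative (\<lambda>v. fder h (f x) (fder f x v))) (at x)"
    using has_derivative_compose[OF fder_works[OF assms(1)] fder_works[OF assms(2)]] .
  then show "fder (\<lambda>x. h (f x)) x v = fder h (f x) (fder f x v)" "(\<lambda>x. h (f x)) differentiable (at x)"
    by (auto simp: fder_eq differentiable_def)
qed

text \<open>\<open>Ck_on\<close> speaks of derivatives in fixed directions. This expansion reduces a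
  derivative in a variable direction to them, with scalar coefficient functions.\<close>

lemma linear_expand:
  fixes f :: "'v::euclidean_space \<Rightarrow> 'w::real_vector"
  assumes "linear f"
  shows "f x = (\<Sum>b\<in>Basis. (x \<bullet> b) *\<^sub>R f b)"
proof -
  have "f x = f (\<Sum>b\<in>Basis. (x \<bullet> b) *\<^sub>R b)" by (simp only: euclidean_representation)
  also have "\<dots> = (\<Sum>b\<in>Basis. (x \<bullet> b) *\<^sub>R f b)" by (simp add: linear_sum[OF assms] linear_cmul[OF assms])
  finally show ?thesis .
qed

lemma Ck_on_cong:
  assumes "open S" "\<And>x. x \<in> S \<Longrightarrow> f x = g x" "Ck_on k S f" shows "Ck_on k S g"
  using assms(2,3)
proof (induction k arbitrary: f g)
  case 0
  then show ?case using continuous_on_cong[of S S f g] by auto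
next
  case (Suc k)
  have d: "f differentiable (at x)" if "x \<in> S" for x using Suc.prems(2) that by auto
  have "Ck_on k S (\<lambda>x. fder g x v)" for v
  proof (rule Suc.IH)
    show "fder f x v = fder g x v" if "x \<in> S" for x
      using fder_cong(1)[OF assms(1) that Suc.prems(1) d[OF that]] by auto
    show "Ck_on k S (\<lambda>x. fder f x v)" using Suc.prems(2) by auto
  qed
  then show ?case using fder_cong(2)[OF assms(1) _ Suc.prems(1) d] by auto
qed

lemma Ck_on_subset: "Ck_on k S f \<Longrightarrow> T \<subseteq> S \<Longrightarrow> Ck_on k T f"
proof (induction k arbitrary: f)
  case 0
  then show ?case using continuous_on_subset by auto
next
  case (Suc k)
  then show ?case by auto
qed

lemma Ck_on_Suc: "Ck_on (Suc k) S f \<Longrightarrow> Ck_on k S f"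
proof (induction k arbitrary: f)
  case 0
  then show ?case
    by (auto intro!: continuous_at_imp_continuous_on differentiable_imp_continuous_within)
next
  case (Suc k)
  have "Ck_on k S (\<lambda>x. fder f x v)" for v using Suc.IH Suc.prems by auto
  then show ?case using Suc.prems by auto
qed

lemma Ck_on_local:
  assumes "\<And>x. x \<in> S \<Longrightarrow> \<exists>T. open T \<and> x \<in> T \<and> Ck_on k T f" shows "Ck_on k S f"
  using assms
proof (induction k arbitrary: f)
  case 0
  show ?case
    unfolding Ck_on.simps
  proof (rule continuous_at_imp_continuous_on, rule ballI)
    fix x assume "x \<in> S"
    then obtain T where "open T" "x \<in> T" "Ck_on 0 T f" using 0 by blast
    then show "isCont f x" using continuous_on_eq_continuous_at[of T f] by auto
  qed
next
  case (Suc k)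
  have "Ck_on k S (\<lambda>x. fder f x v)" for v
    using Suc.prems by (intro Suc.IH) force
  then show ?case using Suc.prems by force
qed

lemma Ck_on_const: "Ck_on k S (\<lambda>x. c)"
  by (induction k arbitrary: c) auto

lemma Ck_on_add: "open S \<Longrightarrow> Ck_on k S f \<Longrightarrow> Ck_on k S g \<Longrightarrow> Ck_on k S (\<lambda>x. f x + g x)"
proof (induction k arbitrary: f g)
  case 0
  then show ?case by (auto intro: continuous_on_add)
next
  case (Suc k)
  have d: "f differentiable (at x)" "g differentiable (at x)" if "x \<in> S" for x using Suc.prems that by auto
  have e: "((\<lambda>x. f x + g x) has_derivative (\<lambda>v. fder f x v + fder g x v)) (at x)" if "x \<in> S" for x
    using d[OF that] by (intro has_derivative_add fder_works)
  have "Ck_on k S (\<lambda>x. fder (\<lambda>x. f x + g x) x v)" for v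
  proof (rule Ck_on_cong[OF Suc.prems(1)])
    show "fder f x v + fder g x v = fder (\<lambda>x. f x + g x) x v" if "x \<in> S" for x
      using fder_eq[OF e[OF that]] by simp
    show "Ck_on k S (\<lambda>x. fder f x v + fder g x v)" using Suc by auto
  qed
  then show ?case using e by (auto simp: differentiable_def)
qed

lemma Ck_on_bounded_linear:
  assumes "bounded_linear h" "open S" shows "Ck_on k S f \<Longrightarrow> Ck_on k S (\<lambda>x. h (f x))"
proof (induction k arbitrary: f)
  case 0
  then show ?case using bounded_linear.continuous_on[OF assms(1)] by auto
next
  case (Suc k)
  have e: "((\<lambda>x. h (f x)) has_derivative (\<lambda>v. h (fder f x v))) (at x)" if "x \<in> S" for x
    using Suc.prems that by (intro bounded_linear.has_derivative[OF assms(1)] fder_works) auto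
  have "Ck_on k S (\<lambda>x. fder (\<lambda>x. h (f x)) x v)" for v
  proof (rule Ck_on_cong[OF assms(2)])
    show "h (fder f x v) = fder (\<lambda>x. h (f x)) x v" if "x \<in> S" for x
      using fder_eq[OF e[OF that]] by simp
    show "Ck_on k S (\<lambda>x. h (fder f x v))" using Suc by auto
  qed
  then show ?case using e by (auto simp: differentiable_def)
qed

lemma Ck_on_scaleR:
  fixes f :: "'v::euclidean_space \<Rightarrow> real"
  shows "open S \<Longrightarrow> Ck_on k S f \<Longrightarrow> Ck_on k S g \<Longrightarrow> Ck_on k S (\<lambda>x. f x *\<^sub>R g x)"
proof (induction k arbitrary: f g)
  case 0
  then show ?case by (auto intro: continuous_on_scaleR)
next
  case (Suc k)
  have d: "f differentiable (at x)" "g differentiable (at x)" if "x \<in> S" for x using Suc.prems that by auto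
  have e: "((\<lambda>x. f x *\<^sub>R g x) has_derivative (\<lambda>v. f x *\<^sub>R fder g x v + fder f x v *\<^sub>R g x)) (at x)" if "x \<in> S" for x
    using d[OF that] by (intro has_derivative_scaleR fder_works)
  have "Ck_on k S (\<lambda>x. fder (\<lambda>x. f x *\<^sub>R g x) x v)" for v
  proof (rule Ck_on_cong[OF Suc.prems(1)])
    show "f x *\<^sub>R fder g x v + fder f x v *\<^sub>R g x = fder (\<lambda>x. f x *\<^sub>R g x) x v" if "x \<in> S" for x
      using fder_eq[OF e[OF that]] by simp
    have k: "Ck_on k S f" "Ck_on k S g" using Suc.prems Ck_on_Suc by blast+
    show "Ck_on k S (\<lambda>x. f x *\<^sub>R fder g x v + fder f x v *\<^sub>R g x)"
      using Suc.prems by (intro Ck_on_add Suc.IH k) auto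
  qed
  then show ?case using e by (auto simp: differentiable_def)
qed

lemma Ck_on_sum:
  "finite I \<Longrightarrow> open S \<Longrightarrow> (\<And>i. i \<in> I \<Longrightarrow> Ck_on k S (f i)) \<Longrightarrow> Ck_on k S (\<lambda>x. \<Sum>i\<in>I. f i x)"
  by (induction I rule: finite_induct) (auto intro: Ck_on_const Ck_on_add)

text \<open>By the chain rule, the derivative is a sum of products in which \<open>f\<close> is
  composed with a derivative of \<open>h\<close>. The induction therefore keeps \<open>f\<close>
  fixed and generalises \<open>h\<close>.\<close>

lemma Ck_on_compose:
  fixes f :: "'v::euclidean_space \<Rightarrow> 'w::euclidean_space"
  assumes "open S" "open T" "f ` S \<subseteq> T"
  shows "Ck_on k S f \<Longrightarrow> Ck_on k T h \<Longrightarrow> Ck_on k S (\<lambda>x. h (f x))"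
proof (induction k arbitrary: h)
  case 0
  then show ?case using assms(3) continuous_on_compose2 by (auto simp del: image_subset_iff)
next
  case (Suc k)
  have fT: "f x \<in> T" if "x \<in> S" for x using that assms(3) by blast
  have d: "f differentiable (at x)" "h differentiable (at (f x))" if "x \<in> S" for x
    using Suc.prems that fT by auto
  have k: "Ck_on k S f" using Suc.prems(1) by (rule Ck_on_Suc)
  have "Ck_on k S (\<lambda>x. fder (\<lambda>x. h (f x)) x v)" for v
  proof (rule Ck_on_cong[OF assms(1)])
    show "(\<Sum>b\<in>Basis. (fder f x v \<bullet> b) *\<^sub>R fder h (f x) b) = fder (\<lambda>x. h (f x)) x v" if "x \<in> S" for x
      unfolding fder_compose(1)[OF d[OF that]] by (rule linear_expand[OF fder_linear[OF d(2)[OF that]], symmetric])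
    show "Ck_on k S (\<lambda>x. \<Sum>b\<in>Basis. (fder f x v \<bullet> b) *\<^sub>R fder h (f x) b)"
    proof (intro Ck_on_sum Ck_on_scaleR assms)
      show "Ck_on k S (\<lambda>x. fder f x v \<bullet> b)" for b
        using Suc.prems by (intro Ck_on_bounded_linear[OF bounded_linear_inner_left assms(1)]) auto
      show "Ck_on k S (\<lambda>x. fder h (f x) b)" for b
        using Suc.prems by (intro Suc.IH[OF k]) auto
    qed simp
  qed
  then show ?case using fder_compose(2)[OF d] by simp
qed

lemma smooth_on_cong: "open S \<Longrightarrow> (\<And>x. x \<in> S \<Longrightarrow> f x = g x) \<Longrightarrow> smooth_on S f \<Longrightarrow> smooth_on S g"
  using Ck_on_cong unfolding smooth_on_def by blast

lemma smooth_on_subset: "smooth_on S f \<Longrightarrow> T \<subseteq> S \<Longrightarrow> smooth_on T f"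
  using Ck_on_subset unfolding smooth_on_def by blast

lemma smooth_on_local:
  "(\<And>x. x \<in> S \<Longrightarrow> \<exists>T. open T \<and> x \<in> T \<and> smooth_on T f) \<Longrightarrow> smooth_on S f"
  unfolding smooth_on_def by (rule allI, rule Ck_on_local) blast

lemma smooth_on_const: "smooth_on S (\<lambda>x. c)"
  by (simp add: smooth_on_def Ck_on_const)

lemma smooth_on_differentiable: "smooth_on S f \<Longrightarrow> x \<in> S \<Longrightarrow> f differentiable (at x)"
  unfolding smooth_on_def using Ck_on.simps(2) by blast

lemma smooth_on_fder: "smooth_on S f \<Longrightarrow> smooth_on S (\<lambda>x. fder f x v)"
  unfolding smooth_on_def using Ck_on.simps(2) by blast

lemma smooth_on_continuous: "smooth_on S f \<Longrightarrow> continuous_on S f"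
  unfolding smooth_on_def using Ck_on.simps(1) by blast

lemma smooth_on_add: "open S \<Longrightarrow> smooth_on S f \<Longrightarrow> smooth_on S g \<Longrightarrow> smooth_on S (\<lambda>x. f x + g x)"
  by (simp add: smooth_on_def Ck_on_add)

lemma smooth_on_bounded_linear:
  "bounded_linear h \<Longrightarrow> open S \<Longrightarrow> smooth_on S f \<Longrightarrow> smooth_on S (\<lambda>x. h (f x))"
  by (simp add: smooth_on_def Ck_on_bounded_linear)

lemma smooth_on_scaleR:
  fixes f :: "'v::euclidean_space \<Rightarrow> real"
  shows "open S \<Longrightarrow> smooth_on S f \<Longrightarrow> smooth_on S g \<Longrightarrow> smooth_on S (\<lambda>x. f x *\<^sub>R g x)"
  by (simp add: smooth_on_def Ck_on_scaleR)

lemma smooth_on_mult: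
  fixes f :: "'v::euclidean_space \<Rightarrow> real"
  shows "open S \<Longrightarrow> smooth_on S f \<Longrightarrow> smooth_on S g \<Longrightarrow> smooth_on S (\<lambda>x. f x * g x)"
  using smooth_on_scaleR[of S f g] by simp

lemma smooth_on_diff: "open S \<Longrightarrow> smooth_on S f \<Longrightarrow> smooth_on S g \<Longrightarrow> smooth_on S (\<lambda>x. f x - g x)"
  using smooth_on_add[of S f "\<lambda>x. - g x"]
    smooth_on_bounded_linear[OF bounded_linear_minus[OF bounded_linear_ident], of S g] by simp

lemma smooth_on_sum:
  "finite I \<Longrightarrow> open S \<Longrightarrow> (\<And>i. i \<in> I \<Longrightarrow> smooth_on S (f i)) \<Longrightarrow> smooth_on S (\<lambda>x. \<Sum>i\<in>I. f i x)"
  unfolding smooth_on_def by (blast intro: Ck_on_sum)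

lemma smooth_on_compose:
  fixes f :: "'v::euclidean_space \<Rightarrow> 'w::euclidean_space"
  assumes "open S" "open T" "f ` S \<subseteq> T" "smooth_on S f" "smooth_on T h"
  shows "smooth_on S (\<lambda>x. h (f x))"
  using assms Ck_on_compose unfolding smooth_on_def by blast

lemma smooth_on_affine:
  fixes f :: "'v::euclidean_space \<Rightarrow> 'w::real_normed_vector"
  assumes "bounded_linear f" shows "smooth_on S (\<lambda>x. f x + c)"
proof -
  have e: "((\<lambda>x. f x + c) has_derivative f) (at x)" for x
    by (auto intro!: derivative_eq_intros bounded_linear.has_derivative[OF assms])
  have "Ck_on k S (\<lambda>x. f x + c)" for k
  proof (cases k)
    case 0
    then show ?thesis using linear_continuous_on[OF assms] by (auto intro: continuous_on_add)
  next
    case (Suc j)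
    then show ?thesis using e fder_eq[OF e] by (auto simp: differentiable_def Ck_on_const)
  qed
  then show ?thesis by (simp add: smooth_on_def)
qed

lemma smooth_on_fder_field:
  fixes f :: "'v::euclidean_space \<Rightarrow> 'w::real_normed_vector"
  assumes "open S" "smooth_on S f" "smooth_on S \<xi>"
  shows "smooth_on S (\<lambda>x. fder f x (\<xi> x))"
proof (rule smooth_on_cong[OF assms(1)])
  show "(\<Sum>b\<in>Basis. (\<xi> x \<bullet> b) *\<^sub>R fder f x b) = fder f x (\<xi> x)" if "x \<in> S" for x
    by (rule linear_expand[OF fder_linear[OF smooth_on_differentiable[OF assms(2) that]], symmetric])
  show "smooth_on S (\<lambda>x. \<Sum>b\<in>Basis. (\<xi> x \<bullet> b) *\<^sub>R fder f x b)"
    by (intro smooth_on_sum smooth_on_scaleR smooth_on_fder assms finite_Basis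
        smooth_on_bounded_linear[OF bounded_linear_inner_left])
qed

text \<open>The mean value theorem twice: along \<open>u\<close> for the difference of
  \<open>f\<close> in direction \<open>v\<close>, then along \<open>v\<close> for the derivative of
  \<open>f\<close> in direction \<open>u\<close>.\<close>

lemma second_difference:
  fixes f :: "'v::euclidean_space \<Rightarrow> real"
  assumes f: "smooth_on S f" and s: "s > 0"
    and dom: "\<And>a b. 0 \<le> a \<Longrightarrow> a \<le> s \<Longrightarrow> 0 \<le> b \<Longrightarrow> b \<le> s \<Longrightarrow> x + a *\<^sub>R u + b *\<^sub>R v \<in> S"
  obtains a b where "0 \<le> a" "a \<le> s" "0 \<le> b" "b \<le> s"
    "f (x + s *\<^sub>R u + s *\<^sub>R v) - f (x + s *\<^sub>R u) - f (x + s *\<^sub>R v) + f x =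
       s\<^sup>2 * fder (\<lambda>y. fder f y u) (x + a *\<^sub>R u + b *\<^sub>R v) v"
proof -
  have der: "((\<lambda>t. h (z + t *\<^sub>R w)) has_real_derivative fder h (z + t *\<^sub>R w) w) (at t)"
    if "h differentiable (at (z + t *\<^sub>R w))" for h :: "'v \<Rightarrow> real" and z w t
  proof -
    have "((\<lambda>t. z + t *\<^sub>R w) has_derivative (\<lambda>t. t *\<^sub>R w)) (at t)"
      by (auto intro!: derivative_eq_intros)
    from has_derivative_compose[OF this fder_works[OF that]]
    have "((\<lambda>t. h (z + t *\<^sub>R w)) has_derivative (\<lambda>t'. fder h (z + t *\<^sub>R w) (t' *\<^sub>R w))) (at t)" .
    moreover have "(\<lambda>t'. fder h (z + t *\<^sub>R w) (t' *\<^sub>R w)) = (*) (fder h (z + t *\<^sub>R w) w)"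
      by (simp add: fun_eq_iff linear_cmul[OF fder_linear[OF that]] mult.commute)
    ultimately show ?thesis unfolding has_field_derivative_def by simp
  qed
  have df: "f differentiable (at z)" "(\<lambda>y. fder f y u) differentiable (at z)" if "z \<in> S" for z
    using smooth_on_differentiable f smooth_on_fder that by blast+
  let ?\<phi> = "\<lambda>t. f (x + s *\<^sub>R v + t *\<^sub>R u) - f (x + t *\<^sub>R u)"
  have in1: "x + s *\<^sub>R v + t *\<^sub>R u \<in> S" "x + t *\<^sub>R u \<in> S" if "0 \<le> t" "t \<le> s" for t
    using dom[of t s] dom[of t 0] s that by (simp_all add: algebra_simps)
  have d\<phi>: "(?\<phi> has_real_derivative (fder f (x + s *\<^sub>R v + t *\<^sub>R u) u - fder f (x + t *\<^sub>R u) u)) (at t)"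
    if "0 \<le> t" "t \<le> s" for t
    by (rule DERIV_diff[OF der[OF df(1)[OF in1(1)[OF that]]] der[OF df(1)[OF in1(2)[OF that]]]])
  have "\<exists>a. 0 < a \<and> a < s \<and> ?\<phi> s - ?\<phi> 0 = (s - 0) * (fder f (x + s *\<^sub>R v + a *\<^sub>R u) u - fder f (x + a *\<^sub>R u) u)"
    using MVT2[of 0 s ?\<phi>, OF s d\<phi>] by blast
  then obtain a where a: "0 < a" "a < s"
    "?\<phi> s - ?\<phi> 0 = s * (fder f (x + s *\<^sub>R v + a *\<^sub>R u) u - fder f (x + a *\<^sub>R u) u)" by auto
  let ?\<psi> = "\<lambda>t. fder f (x + a *\<^sub>R u + t *\<^sub>R v) u"
  have in2: "x + a *\<^sub>R u + t *\<^sub>R v \<in> S" if "0 \<le> t" "t \<le> s" for t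
    using dom[of a t] a that by simp
  have d\<psi>: "(?\<psi> has_real_derivative fder (\<lambda>y. fder f y u) (x + a *\<^sub>R u + t *\<^sub>R v) v) (at t)"
    if "0 \<le> t" "t \<le> s" for t
    by (rule der[OF df(2)[OF in2[OF that]]])
  have "\<exists>b. 0 < b \<and> b < s \<and> ?\<psi> s - ?\<psi> 0 = (s - 0) * fder (\<lambda>y. fder f y u) (x + a *\<^sub>R u + b *\<^sub>R v) v"
    using MVT2[of 0 s ?\<psi>, OF s d\<psi>] by blast
  then obtain b where b: "0 < b" "b < s"
    "?\<psi> s - ?\<psi> 0 = s * fder (\<lambda>y. fder f y u) (x + a *\<^sub>R u + b *\<^sub>R v) v" by auto
  have "fder f (x + s *\<^sub>R v + a *\<^sub>R u) u - fder f (x + a *\<^sub>R u) u = ?\<psi> s - ?\<psi> 0"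
    by (simp add: algebra_simps)
  then have "?\<phi> s - ?\<phi> 0 = s\<^sup>2 * fder (\<lambda>y. fder f y u) (x + a *\<^sub>R u + b *\<^sub>R v) v"
    using a(3) b(3) by (simp add: power2_eq_square)
  moreover have "f (x + s *\<^sub>R u + s *\<^sub>R v) - f (x + s *\<^sub>R u) - f (x + s *\<^sub>R v) + f x = ?\<phi> s - ?\<phi> 0"
    by (simp add: algebra_simps)
  ultimately show thesis using a b that[of a b] by simp
qed

text \<open>The second difference is symmetric in \<open>u\<close> and \<open>v\<close>, so the two
  mixed derivatives agree at suitable points of arbitrarily small parallelograms at
  \<open>x\<close>. Continuity carries this over to \<open>x\<close>.\<close>

lemma fder_symmetric:
  fixes f :: "'v::euclidean_space \<Rightarrow> real"
  assumes "open S" "smooth_on S f" "x \<in> S"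
  shows "fder (\<lambda>y. fder f y u) x v = fder (\<lambda>y. fder f y v) x u"
proof (rule ccontr)
  let ?g = "\<lambda>y. fder (\<lambda>y. fder f y u) y v" and ?h = "\<lambda>y. fder (\<lambda>y. fder f y v) y u"
  assume ne: "?g x \<noteq> ?h x"
  \<comment> \<open>Half the gap: two errors smaller than \<open>e\<close> cannot bridge it.\<close>
  define e where "e = \<bar>?g x - ?h x\<bar> / 2"
  have e: "e > 0" using ne by (simp add: e_def)
  have "continuous_on S ?g" "continuous_on S ?h"
    by (intro smooth_on_continuous smooth_on_fder assms)+
  then have "isCont ?g x" "isCont ?h x" using assms continuous_on_eq_continuous_at by blast+
  then have "\<exists>d>0. \<forall>y. dist y x < d \<longrightarrow> dist (?g y) (?g x) < e"
    "\<exists>d>0. \<forall>y. dist y x < d \<longrightarrow> dist (?h y) (?h x) < e"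
    unfolding continuous_at_eps_delta using e by simp_all
  then obtain d1 d2 where d: "d1 > 0" "\<And>y. dist y x < d1 \<Longrightarrow> dist (?g y) (?g x) < e"
    "d2 > 0" "\<And>y. dist y x < d2 \<Longrightarrow> dist (?h y) (?h x) < e" by blast
  obtain d3 where d3: "d3 > 0" "ball x d3 \<subseteq> S" using assms(1,3) openE by blast
  define \<delta> where "\<delta> = min d1 (min d2 d3)"
  have \<delta>: "\<delta> > 0" using d d3 by (simp add: \<delta>_def)
  \<comment> \<open>The summand 1 keeps the denominator positive when \<open>u\<close> and
    \<open>v\<close> are zero; the factor 2 makes the final bound strict.\<close>
  define s where "s = \<delta> / (2 * (norm u + norm v + 1))"
  have s: "s > 0" using \<delta> unfolding s_def by (intro divide_pos_pos) (auto intro: add_nonneg_pos)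
  have close: "dist (x + a *\<^sub>R u + b *\<^sub>R v) x < \<delta>" if "0 \<le> a" "a \<le> s" "0 \<le> b" "b \<le> s" for a b
  proof -
    have "dist (x + a *\<^sub>R u + b *\<^sub>R v) x = norm (a *\<^sub>R u + b *\<^sub>R v)" by (simp add: dist_norm algebra_simps)
    also have "\<dots> \<le> a * norm u + b * norm v"
      using norm_triangle_ineq[of "a *\<^sub>R u" "b *\<^sub>R v"] that by simp
    also have "\<dots> \<le> s * norm u + s * norm v" using that by (intro add_mono mult_right_mono) auto
    also have "\<dots> \<le> s * (norm u + norm v + 1)" using s by (simp add: algebra_simps)
    also have "\<dots> = \<delta> / 2"
    proof -
      have *: "d / (2 * r) * r = d / 2" if "r > 0" for d r :: real using that by simp
      show ?thesis unfolding s_def by (rule *) (intro add_nonneg_pos, auto)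
    qed
    also have "\<dots> < \<delta>" using \<delta> by simp
    finally show ?thesis .
  qed
  have in_S: "x + a *\<^sub>R u + b *\<^sub>R v \<in> S" if "0 \<le> a" "a \<le> s" "0 \<le> b" "b \<le> s" for a b
    using close[OF that] d3(2) by (auto simp: \<delta>_def dist_commute)
  have in_S': "x + a *\<^sub>R v + b *\<^sub>R u \<in> S" if "0 \<le> a" "a \<le> s" "0 \<le> b" "b \<le> s" for a b
    using in_S[OF that(3,4,1,2)] by (simp add: algebra_simps)
  obtain a b where ab: "0 \<le> a" "a \<le> s" "0 \<le> b" "b \<le> s"
    "f (x + s *\<^sub>R u + s *\<^sub>R v) - f (x + s *\<^sub>R u) - f (x + s *\<^sub>R v) + f x = s\<^sup>2 * ?g (x + a *\<^sub>R u + b *\<^sub>R v)"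
    by (rule second_difference[OF assms(2) s, of x u v]) ((rule in_S; assumption), (rule that; assumption))
  obtain a' b' where ab': "0 \<le> a'" "a' \<le> s" "0 \<le> b'" "b' \<le> s"
    "f (x + s *\<^sub>R v + s *\<^sub>R u) - f (x + s *\<^sub>R v) - f (x + s *\<^sub>R u) + f x = s\<^sup>2 * ?h (x + a' *\<^sub>R v + b' *\<^sub>R u)"
    by (rule second_difference[OF assms(2) s, of x v u]) ((rule in_S'; assumption), (rule that; assumption))
  have c: "x + s *\<^sub>R v + s *\<^sub>R u = x + s *\<^sub>R u + s *\<^sub>R v" "x + a' *\<^sub>R v + b' *\<^sub>R u = x + b' *\<^sub>R u + a' *\<^sub>R v"
    by (simp_all add: algebra_simps)
  have "s\<^sup>2 * ?g (x + a *\<^sub>R u + b *\<^sub>R v) = s\<^sup>2 * ?h (x + b' *\<^sub>R u + a' *\<^sub>R v)"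
    using ab(5) ab'(5)[unfolded c] by linarith
  then have "?g (x + a *\<^sub>R u + b *\<^sub>R v) = ?h (x + b' *\<^sub>R u + a' *\<^sub>R v)" using s by simp
  moreover have "dist (?g (x + a *\<^sub>R u + b *\<^sub>R v)) (?g x) < e" "dist (?h (x + b' *\<^sub>R u + a' *\<^sub>R v)) (?h x) < e"
    using d close[OF ab(1-4)] close[OF ab'(3,4,1,2)] by (auto simp: \<delta>_def)
  ultimately have "\<bar>?g x - ?h x\<bar> < 2 * e" unfolding dist_real_def by linarith
  then show False by (simp add: e_def)
qed

text \<open>Expanding \<open>\<eta>\<close> in the standard basis, the product rule splits off a
  first-order term. The second-order term is symmetric in the two directions and will cancel in a
  bracket of vector fields.\<close>

lemma fder_fder_field:
  fixes F :: "'v::euclidean_space \<Rightarrow> real"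
  assumes S: "open S" "x \<in> S" and F: "smooth_on S F" and \<eta>: "smooth_on S \<eta>"
  shows "fder (\<lambda>y. fder F y (\<eta> y)) x v = fder F x (fder \<eta> x v) + fder (\<lambda>y. fder F y v) x (\<eta> x)"
proof -
  have dF: "F differentiable (at y)" "\<eta> differentiable (at y)" "(\<lambda>y. fder F y b) differentiable (at y)"
    if "y \<in> S" for y b
    using that smooth_on_differentiable F \<eta> smooth_on_fder[OF F] by blast+
  let ?G = "\<lambda>y. \<Sum>b\<in>Basis. (\<eta> y \<bullet> b) * fder F y b"
  have G: "?G y = fder F y (\<eta> y)" if "y \<in> S" for y
    using linear_expand[OF fder_linear[OF dF(1)[OF that]], of "\<eta> y"] by simp
  have der: "(?G has_derivative (\<lambda>v. \<Sum>b\<in>Basis. (\<eta> x \<bullet> b) * fder (\<lambda>y. fder F y b) x v + (fder \<eta> x v \<bullet> b) * fder F x b)) (at x)"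
    by (intro has_derivative_sum has_derivative_mult has_derivative_inner_left fder_works dF S)
  have diff: "?G differentiable (at x)" using der by (auto simp: differentiable_def)
  have "fder (\<lambda>y. fder F y (\<eta> y)) x = fder ?G x"
    by (rule fder_cong(1)[OF S G diff])
  then have "fder (\<lambda>y. fder F y (\<eta> y)) x v =
     (\<Sum>b\<in>Basis. (\<eta> x \<bullet> b) * fder (\<lambda>y. fder F y b) x v) + (\<Sum>b\<in>Basis. (fder \<eta> x v \<bullet> b) * fder F x b)"
    unfolding fder_eq[OF der] sum.distrib by simp
  also have "(\<Sum>b\<in>Basis. (\<eta> x \<bullet> b) * fder (\<lambda>y. fder F y b) x v) = (\<Sum>b\<in>Basis. (\<eta> x \<bullet> b) * fder (\<lambda>y. fder F y v) x b)"
    using fder_symmetric[OF S(1) F S(2)] by (intro sum.cong refl) simp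
  also have "\<dots> = fder (\<lambda>y. fder F y v) x (\<eta> x)"
    using linear_expand[OF fder_linear[OF dF(3)[OF S(2)]], of v "\<eta> x"] by simp
  also have "(\<Sum>b\<in>Basis. (fder \<eta> x v \<bullet> b) * fder F x b) = fder F x (fder \<eta> x v)"
    using linear_expand[OF fder_linear[OF dF(1)[OF S(2)]], of "fder \<eta> x v"] by simp
  finally show ?thesis by simp
qed

section \<open>Vector fields\<close>

text \<open>The coordinate expression of a function. The chart remains one pair, which spares the
  case distinctions on pairs in the given definitions.\<close>

definition loc :: "('p, 'v) chart \<Rightarrow> ('p \<Rightarrow> 'w) \<Rightarrow> 'v \<Rightarrow> 'w" where
  "loc ch f = (\<lambda>x. f (inv_into (fst ch) (snd ch) x))"

definition im :: "('p, 'v) chart \<Rightarrow> 'v set" where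
  "im ch = snd ch ` fst ch"

lemma smooth_fun_loc: "smooth_fun A f \<longleftrightarrow> (\<forall>ch\<in>A. smooth_on (im ch) (loc ch f))"
  by (auto simp: smooth_fun_def loc_def im_def o_def split_beta)

lemma coord_tvec_loc: "coord_tvec A ch p \<xi> f = (if smooth_fun A f then fder (loc ch f) (snd ch p) \<xi> else 0)"
  by (auto simp: coord_tvec_def loc_def o_def split_beta)

lemma vector_fields_loc: "X \<in> vector_fields A \<longleftrightarrow> (\<forall>p. p \<notin> mcarrier A \<longrightarrow> X p = 0) \<and>
     (\<forall>ch\<in>A. \<exists>\<xi>. smooth_on (im ch) \<xi> \<and> (\<forall>p\<in>fst ch. X p = coord_tvec A ch p (\<xi> (snd ch p))))"
  by (auto simp: vector_fields_def im_def split_beta)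

locale smooth_mfd =
  fixes T :: "'p topology" and A :: "('p, 'v::euclidean_space) chart set"
  assumes smooth_mfd: "smooth_manifold T A"
begin

lemma topspace_carrier: "topspace T = mcarrier A"
  using smooth_mfd by (simp add: smooth_manifold_def mcarrier_def)

lemma chart_of: "p \<in> mcarrier A \<Longrightarrow> \<exists>ch\<in>A. p \<in> fst ch"
  unfolding mcarrier_def by blast

context
  fixes ch assumes ch: "ch \<in> A"
begin

lemma is_chart_ch: "openin T (fst ch)" "open (im ch)"
    "homeomorphic_map (subtopology T (fst ch)) (top_of_set (im ch)) (snd ch)"
  using smooth_mfd ch unfolding smooth_manifold_def is_chart_def im_def by auto

lemma fst_carrier: "fst ch \<subseteq> mcarrier A"
  using ch by (auto simp: mcarrier_def)

lemma inj_ch: "inj_on (snd ch) (fst ch)"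
  using homeomorphic_imp_injective_map[OF is_chart_ch(3)] openin_subset[OF is_chart_ch(1)]
  by (simp add: Int_absorb1)

lemma inv_ch: "p \<in> fst ch \<Longrightarrow> inv_into (fst ch) (snd ch) (snd ch p) = p"
  using inj_ch by simp

lemma loc_at: "p \<in> fst ch \<Longrightarrow> loc ch f (snd ch p) = f p"
  by (simp add: loc_def inv_ch)

lemma im_I: "p \<in> fst ch \<Longrightarrow> snd ch p \<in> im ch"
  by (simp add: im_def)

lemma inv_in: "x \<in> im ch \<Longrightarrow> inv_into (fst ch) (snd ch) x \<in> fst ch"
  by (simp add: im_def inv_into_into)

lemma ch_inv: "x \<in> im ch \<Longrightarrow> snd ch (inv_into (fst ch) (snd ch) x) = x"
  by (simp add: im_def f_inv_into_f)

lemma open_image_ch: assumes "openin T V" "V \<subseteq> fst ch" shows "open (snd ch ` V)"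
proof -
  have "openin (subtopology T (fst ch)) V" using assms by (auto simp: openin_subtopology)
  then have "openin (top_of_set (im ch)) (snd ch ` V)"
    using homeomorphic_imp_open_map[OF is_chart_ch(3)] by (auto simp: open_map_def)
  then show ?thesis using openin_open_trans is_chart_ch(2) by blast
qed

lemma loc_smooth: "smooth_fun A f \<Longrightarrow> smooth_on (im ch) (loc ch f)"
  using ch by (simp add: smooth_fun_loc)

lemma loc_differentiable: "smooth_fun A f \<Longrightarrow> p \<in> fst ch \<Longrightarrow> loc ch f differentiable (at (snd ch p))"
  using smooth_on_differentiable[OF loc_smooth] im_I by blast

end

lemma smooth_fun_cong:
  assumes "\<And>p. p \<in> mcarrier A \<Longrightarrow> f p = g p" "smooth_fun A f" shows "smooth_fun A g"
  unfolding smooth_fun_loc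
proof
  fix ch assume ch: "ch \<in> A"
  show "smooth_on (im ch) (loc ch g)"
    by (rule smooth_on_cong[OF is_chart_ch(2)[OF ch] _ loc_smooth[OF ch assms(2)]])
      (use assms(1) inv_in[OF ch] fst_carrier[OF ch] in \<open>auto simp: loc_def\<close>)
qed

lemma smooth_fun_const: "smooth_fun A (\<lambda>_. c)"
  by (simp add: smooth_fun_loc loc_def smooth_on_const)

lemma smooth_fun_add: "smooth_fun A f \<Longrightarrow> smooth_fun A g \<Longrightarrow> smooth_fun A (\<lambda>p. f p + g p)"
  using is_chart_ch(2) by (auto simp: smooth_fun_loc loc_def intro!: smooth_on_add)

lemma smooth_fun_diff: "smooth_fun A f \<Longrightarrow> smooth_fun A g \<Longrightarrow> smooth_fun A (\<lambda>p. f p - g p)"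
  using is_chart_ch(2) by (auto simp: smooth_fun_loc loc_def intro!: smooth_on_diff)

lemma smooth_fun_mult: "smooth_fun A f \<Longrightarrow> smooth_fun A g \<Longrightarrow> smooth_fun A (\<lambda>p. f p * g p)"
  using is_chart_ch(2) by (auto simp: smooth_fun_loc loc_def intro!: smooth_on_mult)

lemma transition_smooth:
  assumes "ch \<in> A" "ch' \<in> A"
  shows "smooth_on (snd ch ` (fst ch \<inter> fst ch')) (loc ch (snd ch'))"
proof -
  have "\<forall>(U, \<phi>)\<in>A. \<forall>(V, \<psi>)\<in>A. smooth_on (\<phi> ` (U \<inter> V)) (\<psi> \<circ> inv_into U \<phi>)"
    using smooth_mfd by (simp add: smooth_manifold_def)
  then show ?thesis using assms by (auto simp: loc_def o_def case_prod_unfold)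
qed

text \<open>The chain rule for the transition map. It makes one chart at \<open>p\<close> sufficient
  for describing the whole tangent space.\<close>

lemma coord_change:
  assumes ch: "ch \<in> A" "ch' \<in> A" and p: "p \<in> fst ch" "p \<in> fst ch'"
  shows "coord_tvec A ch p \<xi> = coord_tvec A ch' p (fder (loc ch (snd ch')) (snd ch p) \<xi>)"
proof
  fix f
  let ?W = "snd ch ` (fst ch \<inter> fst ch')" and ?\<tau> = "loc ch (snd ch')"
  show "coord_tvec A ch p \<xi> f = coord_tvec A ch' p (fder ?\<tau> (snd ch p) \<xi>) f"
  proof (cases "smooth_fun A f")
    case True
    have W: "open ?W" "snd ch p \<in> ?W"
      using open_image_ch[OF ch(1) openin_Int[OF is_chart_ch(1)[OF ch(1)] is_chart_ch(1)[OF ch(2)]]] p by auto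
    have d: "?\<tau> differentiable (at (snd ch p))" "loc ch' f differentiable (at (?\<tau> (snd ch p)))"
      using smooth_on_differentiable[OF transition_smooth[OF ch] W(2)]
        loc_differentiable[OF ch(2) True p(2)] by (auto simp: loc_at[OF ch(1) p(1)])
    have "fder (loc ch f) (snd ch p) = fder (\<lambda>x. loc ch' f (?\<tau> x)) (snd ch p)"
    proof (rule fder_cong(1)[OF W _ fder_compose(2)[OF d]])
      show "loc ch' f (?\<tau> y) = loc ch f y" if y: "y \<in> ?W" for y
      proof -
        obtain q where "q \<in> fst ch" "q \<in> fst ch'" "y = snd ch q" using y by blast
        then show ?thesis by (simp add: loc_at[OF ch(1)] loc_at[OF ch(2)])
      qed
    qed
    then show ?thesis using fder_compose(1)[OF d] True by (simp add: coord_tvec_loc loc_at[OF ch(1) p(1)])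
  qed (simp add: coord_tvec_loc)
qed

lemma tangent_space_chart:
  assumes "ch \<in> A" "p \<in> fst ch" shows "tangent_space A p = range (coord_tvec A ch p)"
proof -
  have "coord_tvec A ch' p \<xi> \<in> range (coord_tvec A ch p)" if "ch' \<in> A" "p \<in> fst ch'" for ch' \<xi>
    unfolding coord_change[OF that(1) assms(1) that(2) assms(2)] by blast
  then show ?thesis using assms unfolding tangent_space_def by blast
qed

lemma tangent_spaceE: "x \<in> tangent_space A p \<Longrightarrow> \<exists>ch\<in>A. \<exists>\<xi>. p \<in> fst ch \<and> x = coord_tvec A ch p \<xi>"
  unfolding tangent_space_def by blast

lemma tangent_carrier: "x \<in> tangent_space A p \<Longrightarrow> p \<in> mcarrier A"
  using fst_carrier tangent_spaceE by blast

lemma coord_tvec_add: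
  assumes "ch \<in> A" "p \<in> fst ch"
  shows "coord_tvec A ch p (\<xi> + \<eta>) = coord_tvec A ch p \<xi> + coord_tvec A ch p \<eta>"
  using linear_add[OF fder_linear[OF loc_differentiable[OF assms(1) _ assms(2)]]]
  by (auto simp: coord_tvec_loc fun_eq_iff)

lemma coord_tvec_scale:
  assumes "ch \<in> A" "p \<in> fst ch"
  shows "coord_tvec A ch p (c *\<^sub>R \<xi>) = (\<lambda>f. c * coord_tvec A ch p \<xi> f)"
  using linear_cmul[OF fder_linear[OF loc_differentiable[OF assms(1) _ assms(2)]]]
  by (auto simp: coord_tvec_loc fun_eq_iff)

context
  fixes x p assumes x: "x \<in> tangent_space A p"
begin

text \<open>Functions are total in HOL, but a tangent vector sees only their values on the manifold.
  Identities that hold just there, such as associativity in a group, can thus be used under a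
  tangent vector.\<close>

lemma tangent_cong:
  assumes "\<And>q. q \<in> mcarrier A \<Longrightarrow> f q = h q" shows "x f = x h"
proof -
  obtain ch \<xi> where ch: "ch \<in> A" "p \<in> fst ch" "x = coord_tvec A ch p \<xi>" using tangent_spaceE[OF x] by blast
  have s: "smooth_fun A f \<longleftrightarrow> smooth_fun A h" using smooth_fun_cong assms by metis
  have "fder (loc ch h) (snd ch p) = fder (loc ch f) (snd ch p)" if "smooth_fun A f"
    by (rule fder_cong(1)[OF is_chart_ch(2)[OF ch(1)] im_I[OF ch(1,2)] _ loc_differentiable[OF ch(1) that ch(2)]])
      (use assms inv_in[OF ch(1)] fst_carrier[OF ch(1)] in \<open>auto simp: loc_def\<close>)
  then show ?thesis using s by (simp add: ch coord_tvec_loc)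
qed

lemma tangent_not_smooth: "\<not> smooth_fun A f \<Longrightarrow> x f = 0"
  using tangent_spaceE[OF x] by (auto simp: coord_tvec_loc)

lemma tangent_const: "x (\<lambda>_. c) = 0"
proof -
  obtain ch \<xi> where ch: "ch \<in> A" "p \<in> fst ch" "x = coord_tvec A ch p \<xi>" using tangent_spaceE[OF x] by blast
  then show ?thesis by (simp add: coord_tvec_loc loc_def)
qed

lemma tangent_fun_ops:
  assumes f: "smooth_fun A f" and h: "smooth_fun A h"
  shows "x (\<lambda>q. f q + h q) = x f + x h" "x (\<lambda>q. f q - h q) = x f - x h"
    "x (\<lambda>q. f q * h q) = f p * x h + x f * h p"
proof -
  obtain ch \<xi> where ch: "ch \<in> A" "p \<in> fst ch" "x = coord_tvec A ch p \<xi>" using tangent_spaceE[OF x] by blast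
  note d = fder_works[OF loc_differentiable[OF ch(1) f ch(2)]] fder_works[OF loc_differentiable[OF ch(1) h ch(2)]]
  have l: "loc ch (\<lambda>q. f q + h q) = (\<lambda>y. loc ch f y + loc ch h y)"
    "loc ch (\<lambda>q. f q - h q) = (\<lambda>y. loc ch f y - loc ch h y)"
    "loc ch (\<lambda>q. f q * h q) = (\<lambda>y. loc ch f y * loc ch h y)" by (simp_all add: loc_def)
  show "x (\<lambda>q. f q + h q) = x f + x h"
    using f h smooth_fun_add[OF f h] fder_eq[OF has_derivative_add[OF d]] by (simp add: ch coord_tvec_loc l)
  show "x (\<lambda>q. f q - h q) = x f - x h"
    using f h smooth_fun_diff[OF f h] fder_eq[OF has_derivative_diff[OF d]] by (simp add: ch coord_tvec_loc l)
  show "x (\<lambda>q. f q * h q) = f p * x h + x f * h p"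
    using f h smooth_fun_mult[OF f h] fder_eq[OF has_derivative_mult[OF d]]
    by (simp add: ch coord_tvec_loc l loc_at[OF ch(1,2)])
qed

end

section \<open>Vector fields as derivations, and their bracket\<close>

abbreviation VF where "VF \<equiv> vector_fields A"

lemma vf_outside: "X \<in> VF \<Longrightarrow> p \<notin> mcarrier A \<Longrightarrow> X p = 0"
  by (simp add: vector_fields_loc)

lemma vf_chart:
  "X \<in> VF \<Longrightarrow> ch \<in> A \<Longrightarrow>
    \<exists>\<xi>. smooth_on (im ch) \<xi> \<and> (\<forall>p\<in>fst ch. X p = coord_tvec A ch p (\<xi> (snd ch p)))"
  unfolding vector_fields_loc by blast

lemma vfI:
  assumes "\<And>p. p \<notin> mcarrier A \<Longrightarrow> X p = 0"
    "\<And>ch. ch \<in> A \<Longrightarrow> \<exists>\<xi>. smooth_on (im ch) \<xi> \<and> (\<forall>p\<in>fst ch. X p = coord_tvec A ch p (\<xi> (snd ch p)))"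
  shows "X \<in> VF"
  using assms by (simp add: vector_fields_loc)

lemma vf_tangent: assumes "X \<in> VF" "p \<in> mcarrier A" shows "X p \<in> tangent_space A p"
proof -
  obtain ch where ch: "ch \<in> A" "p \<in> fst ch" using chart_of[OF assms(2)] by blast
  obtain \<xi> where "X p = coord_tvec A ch p (\<xi> (snd ch p))" using vf_chart[OF assms(1) ch(1)] ch(2) by blast
  then show ?thesis using tangent_space_chart[OF ch] by blast
qed

text \<open>Fields are zero off the manifold, so the rules for tangent vectors hold at every
  \<open>p\<close>, and equations between fields can be shown without case distinctions on the
  point.\<close>

lemma vf_ops:
  assumes X: "X \<in> VF"
  shows "(\<And>q. q \<in> mcarrier A \<Longrightarrow> f q = h q) \<Longrightarrow> X p f = X p h"
    "\<not> smooth_fun A f \<Longrightarrow> X p f = 0" "X p (\<lambda>_. c) = 0"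
    "smooth_fun A f \<Longrightarrow> smooth_fun A h \<Longrightarrow> X p (\<lambda>q. f q + h q) = X p f + X p h"
    "smooth_fun A f \<Longrightarrow> smooth_fun A h \<Longrightarrow> X p (\<lambda>q. f q - h q) = X p f - X p h"
    "smooth_fun A f \<Longrightarrow> smooth_fun A h \<Longrightarrow> X p (\<lambda>q. f q * h q) = f p * X p h + X p f * h p"
proof -
  have "X p \<in> tangent_space A p \<or> X p = 0" using vf_tangent[OF X] vf_outside[OF X] by blast
  note t = this
  show "(\<And>q. q \<in> mcarrier A \<Longrightarrow> f q = h q) \<Longrightarrow> X p f = X p h" using t tangent_cong[of "X p" p f h] by auto
  show "\<not> smooth_fun A f \<Longrightarrow> X p f = 0" using t tangent_not_smooth[of "X p" p f] by auto
  show "X p (\<lambda>_. c) = 0" using t tangent_const[of "X p" p c] by auto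
  assume fh: "smooth_fun A f" "smooth_fun A h"
  show "X p (\<lambda>q. f q + h q) = X p f + X p h" "X p (\<lambda>q. f q - h q) = X p f - X p h"
    "X p (\<lambda>q. f q * h q) = f p * X p h + X p f * h p"
    using t tangent_fun_ops[of "X p" p, OF _ fh] by auto
qed

text \<open>If \<open>f\<close> is not smooth, the convention for tangent vectors makes its
  derivative the zero function.\<close>

lemma smooth_vderiv: assumes X: "X \<in> VF" shows "smooth_fun A (vderiv X f)"
proof (cases "smooth_fun A f")
  case True
  show ?thesis
    unfolding smooth_fun_loc
  proof
    fix ch assume ch: "ch \<in> A"
    obtain \<xi> where \<xi>: "smooth_on (im ch) \<xi>" "\<And>p. p \<in> fst ch \<Longrightarrow> X p = coord_tvec A ch p (\<xi> (snd ch p))"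
      using vf_chart[OF X ch] by blast
    show "smooth_on (im ch) (loc ch (vderiv X f))"
    proof (rule smooth_on_cong[OF is_chart_ch(2)[OF ch]])
      show "smooth_on (im ch) (\<lambda>x. fder (loc ch f) x (\<xi> x))"
        by (rule smooth_on_fder_field[OF is_chart_ch(2)[OF ch] loc_smooth[OF ch True] \<xi>(1)])
      show "fder (loc ch f) x (\<xi> x) = loc ch (vderiv X f) x" if "x \<in> im ch" for x
        using \<xi>(2)[OF inv_in[OF ch that]] ch_inv[OF ch that] True
        by (simp add: vderiv_def loc_def[of ch "\<lambda>p. X p f"] coord_tvec_loc)
    qed
  qed
next
  case False
  then have "vderiv X f = (\<lambda>_. 0)" using vf_ops(2)[OF X] by (simp add: vderiv_def)
  then show ?thesis using smooth_fun_const by simp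
qed

lemma vf_zero: "0 \<in> VF"
proof (rule vfI)
  fix ch assume ch: "ch \<in> A"
  have "coord_tvec A ch p 0 = 0" if "p \<in> fst ch" for p
    using coord_tvec_scale[OF ch that, of 0 0] by (simp add: zero_fun_def)
  then show "\<exists>\<xi>. smooth_on (im ch) \<xi> \<and> (\<forall>p\<in>fst ch. 0 p = coord_tvec A ch p (\<xi> (snd ch p)))"
    by (intro exI[of _ "\<lambda>_. 0"]) (simp add: smooth_on_const)
qed simp

lemma vf_add: assumes "X \<in> VF" "Y \<in> VF" shows "X + Y \<in> VF"
proof (rule vfI)
  fix ch assume ch: "ch \<in> A"
  obtain \<xi> where \<xi>: "smooth_on (im ch) \<xi>" "\<And>p. p \<in> fst ch \<Longrightarrow> X p = coord_tvec A ch p (\<xi> (snd ch p))"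
    using vf_chart[OF assms(1) ch] by blast
  obtain \<eta> where \<eta>: "smooth_on (im ch) \<eta>" "\<And>p. p \<in> fst ch \<Longrightarrow> Y p = coord_tvec A ch p (\<eta> (snd ch p))"
    using vf_chart[OF assms(2) ch] by blast
  show "\<exists>\<xi>. smooth_on (im ch) \<xi> \<and> (\<forall>p\<in>fst ch. (X + Y) p = coord_tvec A ch p (\<xi> (snd ch p)))"
    using \<xi> \<eta> smooth_on_add[OF is_chart_ch(2)[OF ch]] coord_tvec_add[OF ch]
    by (intro exI[of _ "\<lambda>x. \<xi> x + \<eta> x"]) simp
qed (use assms vf_outside in auto)

lemma vf_fscale: assumes "X \<in> VF" "smooth_fun A h" shows "fscale h X \<in> VF"
proof (rule vfI)
  fix ch assume ch: "ch \<in> A"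
  obtain \<xi> where \<xi>: "smooth_on (im ch) \<xi>" "\<And>p. p \<in> fst ch \<Longrightarrow> X p = coord_tvec A ch p (\<xi> (snd ch p))"
    using vf_chart[OF assms(1) ch] by blast
  have "smooth_on (im ch) (\<lambda>x. loc ch h x *\<^sub>R \<xi> x)"
    by (rule smooth_on_scaleR[OF is_chart_ch(2)[OF ch] loc_smooth[OF ch assms(2)] \<xi>(1)])
  then show "\<exists>\<xi>. smooth_on (im ch) \<xi> \<and> (\<forall>p\<in>fst ch. fscale h X p = coord_tvec A ch p (\<xi> (snd ch p)))"
    using \<xi>(2) coord_tvec_scale[OF ch]
    by (intro exI[of _ "\<lambda>x. loc ch h x *\<^sub>R \<xi> x"]) (simp add: fscale_def loc_at[OF ch])
qed (use assms vf_outside in \<open>auto simp: fscale_def zero_fun_def\<close>)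

lemma vf_neg: assumes "X \<in> VF" shows "- X \<in> VF"
proof -
  have "- X = fscale (\<lambda>_. -1) X" by (simp add: fscale_def fun_eq_iff)
  then show ?thesis using vf_fscale[OF assms smooth_fun_const] by simp
qed

lemma vf_diff: "X \<in> VF \<Longrightarrow> Y \<in> VF \<Longrightarrow> X - Y \<in> VF"
  using vf_add[of X "- Y"] vf_neg[of Y] by simp

text \<open>In a chart the second derivatives of \<open>f\<close> cancel by symmetry, and what
  remains is the derivative along the coordinate field
  \<open>fder \<eta> x (\<xi> x) - fder \<xi> x (\<eta> x)\<close>.\<close>

lemma vf_bracket: assumes X: "X \<in> VF" and Y: "Y \<in> VF" shows "lie_bracket X Y \<in> VF"
proof (rule vfI)
  fix p assume "p \<notin> mcarrier A"
  then show "lie_bracket X Y p = 0"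
    using vf_outside[OF X] vf_outside[OF Y] by (simp add: lie_bracket_def zero_fun_def)
next
  fix ch assume ch: "ch \<in> A"
  note S = is_chart_ch(2)[OF ch]
  obtain \<xi> where \<xi>: "smooth_on (im ch) \<xi>" "\<And>p. p \<in> fst ch \<Longrightarrow> X p = coord_tvec A ch p (\<xi> (snd ch p))"
    using vf_chart[OF X ch] by blast
  obtain \<eta> where \<eta>: "smooth_on (im ch) \<eta>" "\<And>p. p \<in> fst ch \<Longrightarrow> Y p = coord_tvec A ch p (\<eta> (snd ch p))"
    using vf_chart[OF Y ch] by blast
  let ?\<zeta> = "\<lambda>x. fder \<eta> x (\<xi> x) - fder \<xi> x (\<eta> x)"
  have "smooth_on (im ch) ?\<zeta>"
    by (intro smooth_on_diff smooth_on_fder_field S \<xi>(1) \<eta>(1))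
  moreover have "lie_bracket X Y p f = coord_tvec A ch p (?\<zeta> (snd ch p)) f" if p: "p \<in> fst ch" for p f
  proof (cases "smooth_fun A f")
    case True
    note F = loc_smooth[OF ch True]
    let ?x = "snd ch p"
    have *: "Z p (vderiv Z' f) = fder (loc ch f) ?x (fder \<zeta>' ?x (\<zeta> ?x)) + fder (\<lambda>y. fder (loc ch f) y (\<zeta> ?x)) ?x (\<zeta>' ?x)"
      if Z: "Z' \<in> VF" "\<And>p. p \<in> fst ch \<Longrightarrow> Z p = coord_tvec A ch p (\<zeta> (snd ch p))"
        "\<And>p. p \<in> fst ch \<Longrightarrow> Z' p = coord_tvec A ch p (\<zeta>' (snd ch p))" "smooth_on (im ch) \<zeta>'" for Z Z' \<zeta> \<zeta>'
    proof -
      have e: "fder (loc ch f) y (\<zeta>' y) = loc ch (vderiv Z' f) y" if "y \<in> im ch" for y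
        using Z(3)[OF inv_in[OF ch that]] ch_inv[OF ch that] True
        by (simp add: vderiv_def loc_def[of ch "\<lambda>p. Z' p f"] coord_tvec_loc)
      have "Z p (vderiv Z' f) = fder (loc ch (vderiv Z' f)) ?x (\<zeta> ?x)"
        using Z(2)[OF p] smooth_vderiv[OF Z(1)] by (simp add: coord_tvec_loc)
      also have "fder (loc ch (vderiv Z' f)) ?x = fder (\<lambda>y. fder (loc ch f) y (\<zeta>' y)) ?x"
        by (rule fder_cong(1)[OF S im_I[OF ch p] e
            smooth_on_differentiable[OF smooth_on_fder_field[OF S F Z(4)] im_I[OF ch p]]])
      finally show ?thesis using fder_fder_field[OF S im_I[OF ch p] F Z(4)] by simp
    qed
    have XY: "X p (vderiv Y f) = fder (loc ch f) ?x (fder \<eta> ?x (\<xi> ?x)) + fder (\<lambda>y. fder (loc ch f) y (\<xi> ?x)) ?x (\<eta> ?x)"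
      by (rule *[OF Y \<xi>(2) \<eta>(2) \<eta>(1)])
    have YX: "Y p (vderiv X f) = fder (loc ch f) ?x (fder \<xi> ?x (\<eta> ?x)) + fder (\<lambda>y. fder (loc ch f) y (\<eta> ?x)) ?x (\<xi> ?x)"
      by (rule *[OF X \<eta>(2) \<xi>(2) \<xi>(1)])
    have "lie_bracket X Y p f = fder (loc ch f) ?x (fder \<eta> ?x (\<xi> ?x)) - fder (loc ch f) ?x (fder \<xi> ?x (\<eta> ?x))"
      using XY YX fder_symmetric[OF S F im_I[OF ch p], of "\<xi> ?x" "\<eta> ?x"] by (simp add: lie_bracket_def)
    also have "\<dots> = coord_tvec A ch p (?\<zeta> ?x) f"
      using linear_diff[OF fder_linear[OF loc_differentiable[OF ch True p]]] True by (simp add: coord_tvec_loc)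
    finally show ?thesis .
  next
    case False
    then have "vderiv X f = (\<lambda>_. 0)" "vderiv Y f = (\<lambda>_. 0)"
      using vf_ops(2)[OF X] vf_ops(2)[OF Y] by (simp_all add: vderiv_def)
    then show ?thesis using False vf_ops(3)[OF X] vf_ops(3)[OF Y] by (simp add: lie_bracket_def coord_tvec_loc)
  qed
  ultimately show "\<exists>\<xi>. smooth_on (im ch) \<xi> \<and> (\<forall>p\<in>fst ch. lie_bracket X Y p = coord_tvec A ch p (\<xi> (snd ch p)))"
    by blast
qed

lemma bracket_anti: "lie_bracket X Y = - lie_bracket Y X"
  by (simp add: lie_bracket_def fun_eq_iff)

lemma vderiv_ops:
  "vderiv (X + Y) f = (\<lambda>p. vderiv X f p + vderiv Y f p)"
  "vderiv (fscale h X) f = (\<lambda>p. h p * vderiv X f p)"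
  "vderiv (lie_bracket X Y) f = (\<lambda>p. vderiv X (vderiv Y f) p - vderiv Y (vderiv X f) p)"
  by (simp_all add: vderiv_def fscale_def lie_bracket_def)

lemma bracket_add_right:
  assumes "X \<in> VF" "Y \<in> VF" "Z \<in> VF" shows "lie_bracket X (Y + Z) = lie_bracket X Y + lie_bracket X Z"
  using assms vf_ops(4)[OF assms(1) smooth_vderiv smooth_vderiv]
  by (simp add: lie_bracket_def fun_eq_iff vderiv_ops)

lemma bracket_add_left:
  assumes "X \<in> VF" "Y \<in> VF" "Z \<in> VF" shows "lie_bracket (X + Y) Z = lie_bracket X Z + lie_bracket Y Z"
  using bracket_add_right[OF assms(3,1,2)] bracket_anti[of _ Z] by simp

lemma bracket_fscale_right:
  assumes X: "X \<in> VF" and Y: "Y \<in> VF" and h: "smooth_fun A h"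
  shows "lie_bracket X (fscale h Y) = fscale h (lie_bracket X Y) + fscale (vderiv X h) Y"
proof (intro ext)
  fix p f
  have "X p (vderiv (fscale h Y) f) = h p * X p (vderiv Y f) + X p h * vderiv Y f p"
    unfolding vderiv_ops by (rule vf_ops(6)[OF X h smooth_vderiv[OF Y]])
  then show "lie_bracket X (fscale h Y) p f = (fscale h (lie_bracket X Y) + fscale (vderiv X h) Y) p f"
    by (simp add: lie_bracket_def fscale_def vderiv_def algebra_simps)
qed

lemma bracket_const_right:
  assumes X: "X \<in> VF" and Y: "Y \<in> VF"
  shows "lie_bracket X (fscale (\<lambda>_. c) Y) = fscale (\<lambda>_. c) (lie_bracket X Y)"
  using bracket_fscale_right[OF X Y smooth_fun_const] vf_ops(3)[OF X]
  by (simp add: vderiv_def fscale_def fun_eq_iff)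

text \<open>The bracket is a commutator of derivations. Smoothness of the functions
  \<open>vderiv V (vderiv W f)\<close> is what allows a tangent vector to be distributed over their
  difference.\<close>

lemma bracket_jacobi:
  assumes X: "X \<in> VF" and Y: "Y \<in> VF" and Z: "Z \<in> VF"
  shows "lie_bracket X (lie_bracket Y Z) = lie_bracket (lie_bracket X Y) Z + lie_bracket Y (lie_bracket X Z)"
proof (intro ext)
  fix p f
  note s = smooth_vderiv[OF X] smooth_vderiv[OF Y] smooth_vderiv[OF Z]
  have a: "U p (vderiv (lie_bracket V W) f) = U p (vderiv V (vderiv W f)) - U p (vderiv W (vderiv V f))"
    if "U \<in> VF" "V \<in> VF" "W \<in> VF" for U V W
    unfolding vderiv_ops by (rule vf_ops(5)[OF that(1) smooth_vderiv[OF that(2)] smooth_vderiv[OF that(3)]])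
  show "lie_bracket X (lie_bracket Y Z) p f = (lie_bracket (lie_bracket X Y) Z + lie_bracket Y (lie_bracket X Z)) p f"
    unfolding lie_bracket_def[of X "lie_bracket Y Z"] lie_bracket_def[of "lie_bracket X Y" Z]
      lie_bracket_def[of Y "lie_bracket X Z"] plus_fun_def a[OF X Y Z] a[OF Z X Y] a[OF Y X Z]
    by (simp add: lie_bracket_def vderiv_def)
qed

end

section \<open>Chern connections in an invariant frame\<close>

text \<open>The connection is \<open>B x\<close> minus its adjoint on \<open>S\<close>, as the (0,1)
  part and compatibility with the metric dictate. Expanding it in an orthonormal basis of
  \<open>S\<close> makes it total, bilinear and \<open>S\<close>-valued.\<close>

lemma (in complex_lie) chern_lie_connection_exists:
  "\<exists>nab. chern_lie_connection S br J nab \<and> (\<forall>x\<in>S. \<forall>y\<in>S. \<forall>z\<in>S. nab x y \<bullet> z = B x y \<bullet> z - y \<bullet> B x z)"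
proof -
  obtain E where E: "finite E" "E \<subseteq> S" "card E = dim S"
    "\<And>x. x \<in> S \<Longrightarrow> (\<Sum>e\<in>E. (x \<bullet> e) *\<^sub>R e) = x" "\<And>e. e \<in> E \<Longrightarrow> e \<bullet> e = 1"
    by (rule orthonormal_basis_obtain[OF subspace_S]) (rule that)
  define nab where "nab x y = (\<Sum>e\<in>E. (B x y \<bullet> e - y \<bullet> B x e) *\<^sub>R e)" for x y
  have bil: "bilinear nab"
    unfolding bilinear_def
  proof (intro conjI allI linearI)
    show "nab x (v + w) = nab x v + nab x w" "nab (x + y) v = nab x v + nab y v" for x y v w
      by (simp_all add: nab_def B_simps inner_simps algebra_simps flip: sum.distrib)
    show "nab x (c *\<^sub>R v) = c *\<^sub>R nab x v" "nab (c *\<^sub>R x) v = c *\<^sub>R nab x v" for c x v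
      by (simp_all add: nab_def B_simps inner_simps scaleR_sum_right algebra_simps)
  qed
  have nab_in: "nab x y \<in> S" for x y
    unfolding nab_def using E(2) subspace_S by (intro subspace_sum subspace_scale) auto
  have nab: "nab x y \<bullet> z = B x y \<bullet> z - y \<bullet> B x z" if "z \<in> S" for x y z
  proof -
    have "B x y \<bullet> z - y \<bullet> B x z = B x y \<bullet> (\<Sum>e\<in>E. (z \<bullet> e) *\<^sub>R e) - y \<bullet> B x (\<Sum>e\<in>E. (z \<bullet> e) *\<^sub>R e)"
      unfolding E(4)[OF that] ..
    also have "\<dots> = (\<Sum>e\<in>E. (z \<bullet> e) * (B x y \<bullet> e - y \<bullet> B x e))"
      by (simp add: linear_sum[OF linear_B(1)] B_simps inner_sum_right right_diff_distrib sum_subtractf)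
    also have "\<dots> = nab x y \<bullet> z"
      by (simp add: nab_def inner_sum_left inner_commute[of z] mult.commute)
    finally show ?thesis by simp
  qed
  have "chern_lie_connection S br J nab"
  proof
    fix x y z assume x: "x \<in> S" and y: "y \<in> S"
    show "nab x y \<in> S" by (rule nab_in)
    show "nab x y \<bullet> z + y \<bullet> nab x z = 0" if "z \<in> S"
      using nab[OF that, of x y] nab[OF y, of x z] by (simp add: inner_commute)
    show "nab x (J y) = J (nab x y)"
    proof (rule inner_ext)
      fix z assume z: "z \<in> S"
      have "J (nab x y) \<bullet> z = - (nab x y \<bullet> J z)" using J_skew nab_in z by simp
      also have "\<dots> = - (B x y \<bullet> J z) + y \<bullet> J (B x z)" using nab[OF J_in[OF z]] B_J2[OF x z] by simp
      also have "\<dots> = J (B x y) \<bullet> z - J y \<bullet> B x z" using J_skew B_in x y z by simp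
      finally show "nab x (J y) \<bullet> z = J (nab x y) \<bullet> z" using nab[OF z, of x "J y"] B_J2[OF x y] by simp
    qed (use nab_in J_in in auto)
    have "nab x y + J (nab (J x) y) = 2 *\<^sub>R B x y"
    proof (rule inner_ext)
      fix z assume z: "z \<in> S"
      have "J (nab (J x) y) \<bullet> z = - (nab (J x) y \<bullet> J z)" using J_skew nab_in z by simp
      also have "\<dots> = J (B x y) \<bullet> J z + y \<bullet> B x z"
        using nab[OF J_in[OF z]] B_J1[OF x y] B_J1[OF x J_in[OF z]] B_J2[OF x z] J_J B_in x z by simp
      also have "J (B x y) \<bullet> J z = B x y \<bullet> z" using J_inner B_in x y z by simp
      finally show "(nab x y + J (nab (J x) y)) \<bullet> z = 2 *\<^sub>R B x y \<bullet> z"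
        using nab[OF z, of x y] by (simp add: inner_simps)
    qed (use nab_in J_in B_in x y S_closed in auto)
    then show "nab x y + J (nab (J x) y) = br x y + J (br (J x) y)" by (simp add: delbar_def)
  qed (rule bil)
  then show ?thesis using nab by blast
qed

section \<open>The Chern connection of a Hermitian manifold and the tensoriality of its
  curvature\<close>

locale chern_manifold = smooth_mfd T A
  for T :: "'p topology" and A :: "('p, 'v::euclidean_space) chart set" +
  fixes J :: "'p endo_field" and g :: "'p metric_field" and D :: "'p connection"
  assumes hermitian: "hermitian_manifold T A J g" and chern: "chern_connection A J g D"
begin

abbreviation "JV \<equiv> endo_app J"

lemma complex_structure: "complex_structure A J"
  and riemannian: "riemannian_metric A g"
  using hermitian unfolding hermitian_manifold_def by simp_all

lemma g_J: "x \<in> tangent_space A p \<Longrightarrow> y \<in> tangent_space A p \<Longrightarrow> g p (J p x) (J p y) = g p x y"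
  using hermitian tangent_carrier unfolding hermitian_manifold_def by simp

lemma J_tangent:
  assumes "x \<in> tangent_space A p"
  shows "J p x \<in> tangent_space A p" "J p (J p x) = - x"
    "y \<in> tangent_space A p \<Longrightarrow> J p (x + y) = J p x + J p y" "J p (\<lambda>f. c * x f) = (\<lambda>f. c * J p x f)"
  using complex_structure assms tangent_carrier[OF assms] unfolding complex_structure_def by simp_all

lemma JV_vf: "X \<in> VF \<Longrightarrow> JV X \<in> VF"
  using complex_structure unfolding complex_structure_def by simp

lemma JV_nijenhuis: "X \<in> VF \<Longrightarrow> Y \<in> VF \<Longrightarrow>
  lie_bracket X Y - lie_bracket (JV X) (JV Y) + JV (lie_bracket (JV X) Y) + JV (lie_bracket X (JV Y)) = 0"
  using complex_structure unfolding complex_structure_def by simp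

text \<open>The value of \<open>J\<close> off the manifold is controlled only through its preserving
  vector fields; applying it to the zero field gives this case.\<close>

lemma J_outside: assumes "p \<notin> mcarrier A" shows "J p 0 = 0"
  using vf_outside[OF JV_vf[OF vf_zero] assms] by (simp add: endo_app_def)

lemma JV_ops:
  assumes X: "X \<in> VF" and Y: "Y \<in> VF"
  shows "JV (X + Y) = JV X + JV Y" "JV (fscale h X) = fscale h (JV X)" "JV (JV X) = - X"
    "JV (- X) = - JV X" "JV (X - Y) = JV X - JV Y"
proof -
  have add: "JV (X + Y) = JV X + JV Y" if "Y \<in> VF" for Y
  proof
    fix p show "JV (X + Y) p = (JV X + JV Y) p"
      using J_tangent(3)[OF vf_tangent[OF X] vf_tangent[OF that]] vf_outside[OF X] vf_outside[OF that] J_outside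
      by (cases "p \<in> mcarrier A") (simp_all add: endo_app_def)
  qed
  show sc: "JV (fscale h X) = fscale h (JV X)" for h
  proof
    fix p show "JV (fscale h X) p = fscale h (JV X) p"
      using J_tangent(4)[OF vf_tangent[OF X]] vf_outside[OF X] J_outside
      by (cases "p \<in> mcarrier A") (simp_all add: endo_app_def fscale_def flip: zero_fun_def)
  qed
  show "JV (JV X) = - X"
  proof
    fix p show "JV (JV X) p = (- X) p"
      using J_tangent(2)[OF vf_tangent[OF X]] vf_outside[OF X] J_outside
      by (cases "p \<in> mcarrier A") (simp_all add: endo_app_def)
  qed
  have m: "- Z = fscale (\<lambda>_. -1) Z" for Z :: "'p vfield" by (simp add: fscale_def fun_eq_iff)
  have neg: "JV (- Z) = - JV Z" if "Z \<in> VF" for Z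
  proof
    fix p show "JV (- Z) p = (- JV Z) p"
      using J_tangent(4)[OF vf_tangent[OF that], where c = "-1"] vf_outside[OF that] J_outside
      by (cases "p \<in> mcarrier A") (simp_all add: endo_app_def fun_Compl_def flip: zero_fun_def)
  qed
  show "JV (X + Y) = JV X + JV Y" "JV (- X) = - JV X" by (rule add[OF Y], rule neg[OF X])
  show "JV (X - Y) = JV X - JV Y"
    using add[OF vf_neg[OF Y]] neg[OF Y] by simp
qed

lemma g_tangent:
  assumes "x \<in> tangent_space A p"
  shows "x \<noteq> 0 \<Longrightarrow> g p x x > 0" "y \<in> tangent_space A p \<Longrightarrow> g p x y = g p y x"
    "y \<in> tangent_space A p \<Longrightarrow> z \<in> tangent_space A p \<Longrightarrow> g p (x + y) z = g p x z + g p y z"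
    "y \<in> tangent_space A p \<Longrightarrow> g p (\<lambda>f. c * x f) y = c * g p x y"
proof -
  have r: "(x \<noteq> 0 \<longrightarrow> g p x x > 0) \<and>
        (\<forall>y\<in>tangent_space A p. g p x y = g p y x \<and>
           (\<forall>z\<in>tangent_space A p. g p (x + y) z = g p x z + g p y z) \<and>
           (\<forall>c. g p (\<lambda>f. c * x f) y = c * g p x y))"
    using riemannian assms tangent_carrier[OF assms] unfolding riemannian_metric_def by blast
  show "x \<noteq> 0 \<Longrightarrow> g p x x > 0" using r by blast
  assume "y \<in> tangent_space A p"
  with r have y: "g p x y = g p y x" "\<And>z. z \<in> tangent_space A p \<Longrightarrow> g p (x + y) z = g p x z + g p y z"
    "\<And>c. g p (\<lambda>f. c * x f) y = c * g p x y" by blast+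
  show "g p x y = g p y x" "g p (\<lambda>f. c * x f) y = c * g p x y" by (rule y(1), rule y(3))
  show "g p (x + y) z = g p x z + g p y z" if "z \<in> tangent_space A p" by (rule y(2)[OF that])
qed

lemma g_smooth: "X \<in> VF \<Longrightarrow> Y \<in> VF \<Longrightarrow> smooth_fun A (metric_app g X Y)"
  using conjunct2[OF riemannian[unfolded riemannian_metric_def]] by blast

lemma g_fields:
  assumes "p \<in> mcarrier A" and X: "X \<in> VF" and Y: "Y \<in> VF" and Z: "Z \<in> VF"
  shows "g p (X p) (Y p) = g p (Y p) (X p)" "g p ((X + Y) p) (Z p) = g p (X p) (Z p) + g p (Y p) (Z p)"
    "g p (fscale h X p) (Y p) = h p * g p (X p) (Y p)" "g p ((- X) p) (Y p) = - g p (X p) (Y p)"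
    "g p (JV X p) (JV Y p) = g p (X p) (Y p)"
proof -
  note t = vf_tangent[OF X assms(1)] vf_tangent[OF Y assms(1)] vf_tangent[OF Z assms(1)]
  show "g p (X p) (Y p) = g p (Y p) (X p)" by (rule g_tangent(2)[OF t(1,2)])
  show "g p ((X + Y) p) (Z p) = g p (X p) (Z p) + g p (Y p) (Z p)"
    using g_tangent(3)[OF t] by simp
  show "g p (fscale h X p) (Y p) = h p * g p (X p) (Y p)"
    using g_tangent(4)[OF t(1,2)] by (simp add: fscale_def)
  show "g p (JV X p) (JV Y p) = g p (X p) (Y p)"
    using g_J[OF t(1,2)] by (simp add: endo_app_def)
  have "(- X) p = (\<lambda>f. -1 * X p f)" by (simp add: fun_eq_iff)
  then show "g p ((- X) p) (Y p) = - g p (X p) (Y p)"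
    using g_tangent(4)[OF t(1,2), where c = "-1"] by simp
qed

lemma g_JV_skew:
  assumes "p \<in> mcarrier A" "X \<in> VF" "Y \<in> VF"
  shows "g p (JV X p) (Y p) = - g p (X p) (JV Y p)"
proof -
  have "g p (JV X p) (Y p) = g p (JV (JV X) p) (JV Y p)"
    using g_fields(5)[OF assms(1) JV_vf[OF assms(2)] assms(3) assms(3)] by simp
  also have "\<dots> = - g p (X p) (JV Y p)"
    unfolding JV_ops(3)[OF assms(2,2)] by (rule g_fields(4)[OF assms(1,2) JV_vf[OF assms(3)] assms(3)])
  finally show ?thesis .
qed

lemma affine: "affine_connection A D"
  and metric_compat: "X \<in> VF \<Longrightarrow> Y \<in> VF \<Longrightarrow> Z \<in> VF \<Longrightarrow> p \<in> mcarrier A \<Longrightarrow>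
    vderiv X (metric_app g Y Z) p = metric_app g (D X Y) Z p + metric_app g Y (D X Z) p"
  and D_JV: "X \<in> VF \<Longrightarrow> Y \<in> VF \<Longrightarrow> D X (JV Y) = JV (D X Y)"
  using chern unfolding chern_connection_def by blast+

lemma torsion_10: "Z \<in> type10_fields A J \<Longrightarrow> W \<in> type10_fields A J \<Longrightarrow>
    complex_bilinear_ext (torsion D) Z (conj_field W) = (0, 0)"
  using chern unfolding chern_connection_def by blast

lemma D_ops:
  assumes "X \<in> VF" "Y \<in> VF"
  shows "D X Y \<in> VF" "Z \<in> VF \<Longrightarrow> D (X + Y) Z = D X Z + D Y Z" "Z \<in> VF \<Longrightarrow> D X (Y + Z) = D X Y + D X Z"
    "smooth_fun A f \<Longrightarrow> D (fscale f X) Y = fscale f (D X Y)"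
    "smooth_fun A f \<Longrightarrow> D X (fscale f Y) = fscale (vderiv X f) Y + fscale f (D X Y)"
  using affine assms unfolding affine_connection_def by simp_all

lemma minus_fscale: "- X = fscale (\<lambda>_. -1) X" for X :: "'p vfield"
  by (simp add: fscale_def fun_eq_iff)

lemma D_const: assumes "X \<in> VF" "Y \<in> VF" shows "D X (fscale (\<lambda>_. c) Y) = fscale (\<lambda>_. c) (D X Y)"
  using D_ops(5)[OF assms smooth_fun_const] vf_ops(3)[OF assms(1)]
  by (simp add: vderiv_def fscale_def fun_eq_iff)

lemma D_neg: assumes "X \<in> VF" "Y \<in> VF" shows "D (- X) Y = - D X Y" "D X (- Y) = - D X Y"
  unfolding minus_fscale using D_ops(4)[OF assms smooth_fun_const] D_const[OF assms] by simp_all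

lemma D_diff:
  assumes "X \<in> VF" "Y \<in> VF" "Z \<in> VF" shows "D (X - Y) Z = D X Z - D Y Z" "D X (Y - Z) = D X Y - D X Z"
  using D_ops(2)[OF assms(1) vf_neg[OF assms(2)] assms(3)] D_neg(1)[OF assms(2,3)]
    D_ops(3)[OF assms(1,2) vf_neg[OF assms(3)]] D_neg(2)[OF assms(1,3)] by simp_all

text \<open>The real part of the torsion condition for the type (1,0) fields X - i J X and Y - i J
  Y.\<close>

lemma torsion_real:
  assumes X: "X \<in> VF" and Y: "Y \<in> VF"
  shows "torsion D X Y + torsion D (JV X) (JV Y) = 0"
proof -
  have t: "(X, - JV X) \<in> type10_fields A J" if "X \<in> VF" for X
    using that JV_ops(3,4)[of "JV X"] JV_ops(3)[of X] JV_vf vf_neg by (simp add: type10_fields_def)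
  have "torsion D X Y - torsion D (- JV X) (JV Y) = 0"
    using torsion_10[OF t[OF X] t[OF Y]] by (simp add: complex_bilinear_ext_def conj_field_def)
  moreover have "torsion D (- JV X) (JV Y) = - torsion D (JV X) (JV Y)"
  proof -
    have "lie_bracket (- JV X) (JV Y) = - lie_bracket (JV X) (JV Y)"
      using bracket_const_right[OF JV_vf[OF Y] JV_vf[OF X], of "-1"] bracket_anti[of _ "JV Y"]
      unfolding minus_fscale[symmetric] by simp
    then show ?thesis using D_neg JV_vf X Y by (simp add: torsion_def)
  qed
  ultimately show ?thesis by simp
qed

text \<open>\<open>P\<close> is twice the (0,1) part of the connection. The torsion condition gives
  \<open>P X Y - P Y X\<close>; applied to \<open>X\<close> and \<open>J Y\<close> it gives
  \<open>P X Y + P Y X\<close>, as \<open>P\<close> is antilinear in the first and linear in the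
  second argument. Adding the two determines \<open>P\<close>.\<close>

lemma D_delbar:
  assumes X: "X \<in> VF" and Y: "Y \<in> VF"
  shows "D X Y + JV (D (JV X) Y) = lie_bracket X Y + JV (lie_bracket (JV X) Y)"
proof -
  define P where "P X Y = D X Y + JV (D (JV X) Y)" for X Y
  note vf = JV_vf D_ops(1) vf_bracket vf_add vf_neg vf_diff
  have P_vf: "P X Y \<in> VF" if "X \<in> VF" "Y \<in> VF" for X Y unfolding P_def using that vf by simp
  have 1: "P X Y - P Y X = lie_bracket X Y + lie_bracket (JV X) (JV Y)" if "X \<in> VF" "Y \<in> VF" for X Y
    using torsion_real[OF that] that vf by (simp add: torsion_def P_def D_JV algebra_simps)
  have "P X (JV Y) = JV (P X Y)" unfolding P_def using X Y vf by (simp add: D_JV JV_ops)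
  moreover have "P (JV Y) X = - JV (P Y X)"
    unfolding P_def using X Y vf by (simp add: JV_ops D_neg)
  ultimately have "JV (P X Y) + JV (P Y X) = lie_bracket X (JV Y) + lie_bracket (JV X) (JV (JV Y))"
    using 1[OF X JV_vf[OF Y]] by simp
  also have "\<dots> = lie_bracket X (JV Y) - lie_bracket (JV X) Y"
    using bracket_const_right[OF JV_vf[OF X] Y, of "-1"] JV_ops(3)[OF Y Y]
    unfolding minus_fscale[symmetric] by simp
  finally have "JV (JV (P X Y + P Y X)) = JV (lie_bracket X (JV Y) - lie_bracket (JV X) Y)"
    using JV_ops(1)[OF P_vf[OF X Y] P_vf[OF Y X]] by simp
  then have 2: "P X Y + P Y X = JV (lie_bracket (JV X) Y) - JV (lie_bracket X (JV Y))"
    using JV_ops(3)[OF vf_add[OF P_vf[OF X Y] P_vf[OF Y X]]] JV_ops(5)[OF vf_bracket[OF X JV_vf[OF Y]] vf_bracket[OF JV_vf[OF X] Y]] P_vf X Y vf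
    by (metis (no_types, lifting) minus_diff_eq minus_minus)
  have 3: "lie_bracket (JV X) (JV Y) = lie_bracket X Y + JV (lie_bracket (JV X) Y) + JV (lie_bracket X (JV Y))"
    using JV_nijenhuis[OF X Y] by (simp add: algebra_simps)
  have "P X Y + P X Y = (P X Y - P Y X) + (P X Y + P Y X)" by simp
  also have "\<dots> = (lie_bracket X Y + JV (lie_bracket (JV X) Y)) + (lie_bracket X Y + JV (lie_bracket (JV X) Y))"
    unfolding 1[OF X Y] 2 3 by simp
  finally have PP: "P X Y + P X Y = (lie_bracket X Y + JV (lie_bracket (JV X) Y)) + (lie_bracket X Y + JV (lie_bracket (JV X) Y))" .
  have "P X Y = lie_bracket X Y + JV (lie_bracket (JV X) Y)"
  proof (intro ext)
    fix p f show "P X Y p f = (lie_bracket X Y + JV (lie_bracket (JV X) Y)) p f"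
      using fun_cong[OF fun_cong[OF PP, of p], of f] by simp
  qed
  then show ?thesis by (simp add: P_def)
qed

definition Riem where "Riem X Y Z = D X (D Y Z) - D Y (D X Z) - D (lie_bracket X Y) Z"

lemma Riem_anti: assumes "X \<in> VF" "Y \<in> VF" "Z \<in> VF" shows "Riem X Y Z = - Riem Y X Z"
  using D_neg(1)[OF vf_bracket[OF assms(2,1)] assms(3)] bracket_anti[of X Y] by (simp add: Riem_def)

lemma Riem_add_left:
  assumes "X \<in> VF" "X' \<in> VF" "Y \<in> VF" "Z \<in> VF" shows "Riem (X + X') Y Z = Riem X Y Z + Riem X' Y Z"
  using assms by (simp add: Riem_def D_ops vf_bracket bracket_add_left)

lemma Riem_add_right:
  assumes "X \<in> VF" "Y \<in> VF" "Z \<in> VF" "Z' \<in> VF" shows "Riem X Y (Z + Z') = Riem X Y Z + Riem X Y Z'"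
  using assms by (simp add: Riem_def D_ops vf_bracket)

text \<open>The derivative of \<open>f\<close> along \<open>Y\<close> enters once from the product
  rule for \<open>D Y\<close> and once from the bracket, and the two contributions cancel.\<close>

lemma Riem_fscale_left:
  assumes X: "X \<in> VF" and Y: "Y \<in> VF" and Z: "Z \<in> VF" and f: "smooth_fun A f"
  shows "Riem (fscale f X) Y Z = fscale f (Riem X Y Z)"
proof -
  note vf = D_ops(1) vf_bracket vf_fscale smooth_vderiv
  have "lie_bracket (fscale f X) Y = - lie_bracket Y (fscale f X)" by (rule bracket_anti)
  also have "\<dots> = fscale f (lie_bracket X Y) - fscale (vderiv Y f) X"
    unfolding bracket_fscale_right[OF Y X f] bracket_anti[of X Y] by (simp add: fscale_def fun_eq_iff)
  finally have "D (lie_bracket (fscale f X) Y) Z = fscale f (D (lie_bracket X Y) Z) - fscale (vderiv Y f) (D X Z)"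
    using X Y Z f vf by (simp add: D_diff D_ops)
  moreover have "D (fscale f X) (D Y Z) = fscale f (D X (D Y Z))" using X Y Z f vf by (simp add: D_ops)
  moreover have "D Y (D (fscale f X) Z) = fscale (vderiv Y f) (D X Z) + fscale f (D Y (D X Z))"
    using X Y Z f vf by (simp add: D_ops)
  ultimately show ?thesis by (simp add: Riem_def fscale_def fun_eq_iff algebra_simps)
qed

text \<open>The mixed first-order terms cancel in the commutator, and the second derivatives of
  \<open>f\<close> combine to its derivative along the bracket.\<close>

lemma Riem_fscale_right:
  assumes X: "X \<in> VF" and Y: "Y \<in> VF" and Z: "Z \<in> VF" and f: "smooth_fun A f"
  shows "Riem X Y (fscale f Z) = fscale f (Riem X Y Z)"
proof -
  note vf = D_ops(1) vf_bracket vf_fscale smooth_vderiv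
  have e: "D U (D V (fscale f Z)) = (fscale (vderiv U (vderiv V f)) Z + fscale (vderiv V f) (D U Z))
      + (fscale (vderiv U f) (D V Z) + fscale f (D U (D V Z)))" if "U \<in> VF" "V \<in> VF" for U V
    using that Z f vf by (simp add: D_ops)
  have b: "D (lie_bracket X Y) (fscale f Z) = fscale (vderiv (lie_bracket X Y) f) Z + fscale f (D (lie_bracket X Y) Z)"
    using X Y Z f vf by (simp add: D_ops)
  show ?thesis
    unfolding Riem_def e[OF X Y] e[OF Y X] b vderiv_ops
    by (simp add: fscale_def fun_eq_iff algebra_simps)
qed

end

text \<open>\<open>\<Phi>\<close> models the tangent spaces on a metric Lie algebra
  \<open>S\<close>: the fields \<open>\<Phi> x\<close> have constant inner products, span every
  tangent space, and reproduce bracket and complex structure. As \<open>br\<close> and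
  \<open>j\<close> map everything into \<open>S\<close>, these identities carry no side
  conditions.\<close>

locale chern_frame = chern_manifold T A J g D
  for T :: "'p topology" and A :: "('p, 'v::euclidean_space) chart set" and J g D +
  fixes S :: "'a::euclidean_space set" and br :: "'a \<Rightarrow> 'a \<Rightarrow> 'a" and j :: "'a \<Rightarrow> 'a"
    and \<Phi> :: "'a \<Rightarrow> 'p vfield"
  assumes nonempty: "mcarrier A \<noteq> {}"
    and subspace_S: "subspace S" and bilinear_br: "bilinear br" and br_in: "br x y \<in> S"
    and linear_j: "linear j" and j_in: "j x \<in> S"
    and \<Phi>_vf: "\<Phi> x \<in> VF" and \<Phi>_add: "\<Phi> (x + y) = \<Phi> x + \<Phi> y"
    and \<Phi>_scale: "\<Phi> (c *\<^sub>R x) = fscale (\<lambda>_. c) (\<Phi> x)"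
    and \<Phi>_br: "\<Phi> (br x y) = lie_bracket (\<Phi> x) (\<Phi> y)" and \<Phi>_j: "\<Phi> (j x) = JV (\<Phi> x)"
    and \<Phi>_inner: "x \<in> S \<Longrightarrow> y \<in> S \<Longrightarrow> p \<in> mcarrier A \<Longrightarrow> g p (\<Phi> x p) (\<Phi> y p) = x \<bullet> y"
    and \<Phi>_surj: "p \<in> mcarrier A \<Longrightarrow> t \<in> tangent_space A p \<Longrightarrow> \<exists>x\<in>S. \<Phi> x p = t"
begin

lemma \<Phi>_neg: "\<Phi> (- x) = - \<Phi> x"
  using \<Phi>_scale[of "-1" x] by (simp add: minus_fscale)

lemma \<Phi>_diff: "\<Phi> (x - y) = \<Phi> x - \<Phi> y"
  using \<Phi>_add[of x "- y"] by (simp add: \<Phi>_neg)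

lemma \<Phi>_zero: "\<Phi> 0 = 0"
  using \<Phi>_diff[of 0 0] by simp

lemma \<Phi>_inj: assumes "x \<in> S" "y \<in> S" "\<Phi> x = \<Phi> y" shows "x = y"
proof -
  obtain p where p: "p \<in> mcarrier A" using nonempty by blast
  have d: "x - y \<in> S" using assms subspace_S subspace_diff by blast
  have "(x - y) \<bullet> (x - y) = g p (\<Phi> (x - y) p) (\<Phi> (x - y) p)" using \<Phi>_inner[OF d d p] by simp
  also have "\<Phi> (x - y) = \<Phi> 0" by (simp add: \<Phi>_diff \<Phi>_zero assms)
  also have "g p (\<Phi> 0 p) (\<Phi> 0 p) = 0" using \<Phi>_inner[OF _ _ p, of 0 0] subspace_0[OF subspace_S] by simp
  finally show ?thesis by simp
qed

text \<open>Each axiom is the corresponding identity of vector fields, reflected by the injectivity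
  of \<open>\<Phi>\<close> on \<open>S\<close>; isometry of \<open>j\<close> is read off at one
  point.\<close>

lemma complex_lie: "complex_lie S br j"
proof
  fix x y z
  show "br x x = 0"
    by (rule \<Phi>_inj[OF br_in subspace_0[OF subspace_S]]) (simp add: \<Phi>_br \<Phi>_zero lie_bracket_def fun_eq_iff)
  show "br x (br y z) = br (br x y) z + br y (br x z)"
    by (rule \<Phi>_inj[OF br_in subspace_add[OF subspace_S br_in br_in]])
      (simp add: \<Phi>_br \<Phi>_add bracket_jacobi[OF \<Phi>_vf \<Phi>_vf \<Phi>_vf, of x y z])
  show "br x y \<in> S" by (rule br_in)
  show "j x \<in> S" by (rule j_in)
  show "j (j x) = - x" if "x \<in> S"
    by (rule \<Phi>_inj[OF j_in subspace_neg[OF subspace_S that]]) (simp add: \<Phi>_j \<Phi>_neg JV_ops(3)[OF \<Phi>_vf \<Phi>_vf])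
  assume xy: "x \<in> S" "y \<in> S"
  show "j x \<bullet> j y = x \<bullet> y"
  proof -
    obtain p where p: "p \<in> mcarrier A" using nonempty by blast
    show ?thesis
      using \<Phi>_inner[OF j_in j_in p, of x y] \<Phi>_inner[OF xy p] g_fields(5)[OF p \<Phi>_vf \<Phi>_vf \<Phi>_vf]
      by (simp add: \<Phi>_j)
  qed
  show "br x y - br (j x) (j y) + j (br (j x) y) + j (br x (j y)) = 0"
    by (rule \<Phi>_inj)
      (use JV_nijenhuis[OF \<Phi>_vf \<Phi>_vf, of x y] subspace_S in
        \<open>auto simp: \<Phi>_br \<Phi>_j \<Phi>_add \<Phi>_diff \<Phi>_zero intro!: subspace_add subspace_diff br_in j_in subspace_0\<close>)
qed (use subspace_S bilinear_br linear_j in \<open>auto simp: linear_add linear_cmul\<close>)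

sublocale C: complex_lie S br j by (rule complex_lie)

text \<open>\<open>D_delbar\<close> in the frame. The left side is doubled to absorb the factor 1/2
  in \<open>B\<close>.\<close>

lemma \<Phi>_delbar: "\<Phi> (C.B x y) + \<Phi> (C.B x y) = D (\<Phi> x) (\<Phi> y) + JV (D (JV (\<Phi> x)) (\<Phi> y))"
proof -
  have "\<Phi> (C.B x y) + \<Phi> (C.B x y) = \<Phi> (2 *\<^sub>R C.B x y)" by (simp add: scaleR_2 \<Phi>_add)
  also have "\<dots> = lie_bracket (\<Phi> x) (\<Phi> y) + JV (lie_bracket (JV (\<Phi> x)) (\<Phi> y))"
    by (simp add: delbar_def \<Phi>_add \<Phi>_br \<Phi>_j)
  finally show ?thesis using D_delbar[OF \<Phi>_vf \<Phi>_vf] by simp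
qed

text \<open>Frame fields have constant inner products, so the derivative in the compatibility with
  the metric is zero.\<close>

lemma metric_skew:
  assumes "p \<in> mcarrier A" "X \<in> VF" "y \<in> S" "z \<in> S"
  shows "g p (D X (\<Phi> y) p) (\<Phi> z p) = - g p (\<Phi> y p) (D X (\<Phi> z) p)"
proof -
  have "X p (metric_app g (\<Phi> y) (\<Phi> z)) = X p (\<lambda>_. y \<bullet> z)"
    by (rule vf_ops(1)[OF assms(2)]) (simp add: metric_app_def \<Phi>_inner assms)
  also have "\<dots> = 0" by (rule vf_ops(3)[OF assms(2)])
  finally have "vderiv X (metric_app g (\<Phi> y) (\<Phi> z)) p = 0" by (simp add: vderiv_def)
  then show ?thesis
    using metric_compat[OF assms(2) \<Phi>_vf \<Phi>_vf assms(1), of y z] by (simp add: metric_app_def)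
qed

text \<open>Two linear equations for the inner products of \<open>\<Phi> z\<close> with
  \<open>D X Y\<close> and with \<open>J (D (J X) Y)\<close>: the (0,1) part gives their sum in
  \<open>d\<close>, and the metric gives their difference in \<open>m\<close>.\<close>

lemma D_\<Phi>_inner:
  assumes p: "p \<in> mcarrier A" and S: "x \<in> S" "y \<in> S" "z \<in> S"
  shows "g p (D (\<Phi> x) (\<Phi> y) p) (\<Phi> z p) = C.B x y \<bullet> z - y \<bullet> C.B x z"
proof -
  let ?X = "\<Phi> x" and ?Y = "\<Phi> y" and ?Z = "\<Phi> z"
  note vf = \<Phi>_vf D_ops(1) JV_vf vf_add vf_neg
  have d: "g p (D ?X (\<Phi> w) p) (\<Phi> v p) + g p (JV (D (JV ?X) (\<Phi> w)) p) (\<Phi> v p) = 2 * (C.B x w \<bullet> v)"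
    if "w \<in> S" "v \<in> S" for w v
  proof -
    have "g p (D ?X (\<Phi> w) p) (\<Phi> v p) + g p (JV (D (JV ?X) (\<Phi> w)) p) (\<Phi> v p) = g p ((D ?X (\<Phi> w) + JV (D (JV ?X) (\<Phi> w))) p) (\<Phi> v p)"
      using g_fields(2)[OF p, of "D ?X (\<Phi> w)" "JV (D (JV ?X) (\<Phi> w))" "\<Phi> v"] that vf by simp
    also have "\<dots> = 2 * (C.B x w \<bullet> v)"
      unfolding \<Phi>_delbar[symmetric] g_fields(2)[OF p \<Phi>_vf \<Phi>_vf \<Phi>_vf]
        \<Phi>_inner[OF C.B_in[OF S(1) that(1)] that(2) p] by simp
    finally show ?thesis .
  qed
  have m: "g p (D ?X ?Y p) (?Z p) - g p (JV (D (JV ?X) ?Y) p) (?Z p) = - (2 * (C.B x z \<bullet> y))"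
  proof -
    have "g p (JV (D (JV ?X) ?Y) p) (?Z p) = - g p (D (JV ?X) ?Y p) (\<Phi> (j z) p)"
      unfolding \<Phi>_j by (rule g_JV_skew[OF p]) (use vf in auto)
    also have "\<dots> = g p (?Y p) (D (JV ?X) (\<Phi> (j z)) p)"
      using metric_skew[OF p JV_vf[OF \<Phi>_vf] S(2) j_in] by simp
    also have "D (JV ?X) (\<Phi> (j z)) = JV (D (JV ?X) ?Z)"
      unfolding \<Phi>_j using D_JV vf by simp
    also have "g p (?Y p) (JV (D (JV ?X) ?Z) p) = g p (JV (D (JV ?X) ?Z) p) (?Y p)"
      by (rule g_fields(1)[OF p _ _ \<Phi>_vf]) (use vf in auto)
    finally have 1: "g p (JV (D (JV ?X) ?Y) p) (?Z p) = g p (JV (D (JV ?X) ?Z) p) (?Y p)" .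
    have 2: "g p (D ?X ?Y p) (?Z p) = - g p (D ?X ?Z p) (?Y p)"
      using metric_skew[OF p \<Phi>_vf S(2,3)] g_fields(1)[OF p \<Phi>_vf D_ops(1)[OF \<Phi>_vf \<Phi>_vf] \<Phi>_vf] by simp
    show ?thesis using d[OF S(3,2)] unfolding 1 2 by simp
  qed
  show ?thesis using m d[OF S(2,3)] by (simp add: inner_commute)
qed

text \<open>A fixed solution of the existence lemma, so that the algebraic theory can be imported as
  a sublocale; its inner products with elements of \<open>S\<close> are prescribed, hence it is
  determined on \<open>S\<close>.\<close>

definition nab where
  "nab = (SOME nab. chern_lie_connection S br j nab \<and>
     (\<forall>x\<in>S. \<forall>y\<in>S. \<forall>z\<in>S. nab x y \<bullet> z = C.B x y \<bullet> z - y \<bullet> C.B x z))"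

lemma nab: "chern_lie_connection S br j nab"
  "x \<in> S \<Longrightarrow> y \<in> S \<Longrightarrow> z \<in> S \<Longrightarrow> nab x y \<bullet> z = C.B x y \<bullet> z - y \<bullet> C.B x z"
  using someI_ex[OF C.chern_lie_connection_exists] unfolding nab_def by blast+

sublocale N: chern_lie_connection S br j nab by (rule nab(1))

lemma field_ext:
  assumes "X \<in> VF" "Y \<in> VF"
    "\<And>p z. p \<in> mcarrier A \<Longrightarrow> z \<in> S \<Longrightarrow> g p (X p) (\<Phi> z p) = g p (Y p) (\<Phi> z p)"
  shows "X = Y"
proof
  fix p show "X p = Y p"
  proof (cases "p \<in> mcarrier A")
    case True
    have "(X - Y) p \<in> tangent_space A p" using vf_tangent[OF vf_diff[OF assms(1,2)] True] .
    then obtain z where z: "z \<in> S" "\<Phi> z p = (X - Y) p" using \<Phi>_surj[OF True] by blast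
    have "g p ((X - Y) p) (\<Phi> z p) = 0"
      using g_fields(2)[OF True assms(1) vf_neg[OF assms(2)] \<Phi>_vf] g_fields(4)[OF True assms(2) \<Phi>_vf \<Phi>_vf]
        assms(3)[OF True z(1)] by simp
    then have "z \<bullet> z = 0" using \<Phi>_inner[OF z(1,1) True] z(2) by simp
    then have "(X - Y) p = 0" using z(2) by (simp add: \<Phi>_zero)
    then show ?thesis by simp
  qed (use assms vf_outside in auto)
qed

lemma D_\<Phi>: assumes "x \<in> S" "y \<in> S" shows "D (\<Phi> x) (\<Phi> y) = \<Phi> (nab x y)"
  by (rule field_ext[OF D_ops(1)[OF \<Phi>_vf \<Phi>_vf] \<Phi>_vf])
    (simp add: D_\<Phi>_inner \<Phi>_inner N.nab_in nab(2) assms)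

lemma Riem_\<Phi>: assumes "x \<in> S" "y \<in> S" "z \<in> S" shows "Riem (\<Phi> x) (\<Phi> y) (\<Phi> z) = \<Phi> (N.Rm x y z)"
  unfolding Riem_def N.Rm_def \<Phi>_diff \<Phi>_br[symmetric]
  using assms by (simp add: D_\<Phi> N.nab_in br_in)

text \<open>Every field is the combination of an orthonormal frame with the smooth coefficients
  \<open>metric_app g X (\<Phi> e)\<close>. A tensorial statement thus has to be checked on frame
  fields only.\<close>

lemma frame_induct:
  assumes "X \<in> VF" "\<And>x. x \<in> S \<Longrightarrow> P (\<Phi> x)"
    "\<And>X Y. X \<in> VF \<Longrightarrow> Y \<in> VF \<Longrightarrow> P X \<Longrightarrow> P Y \<Longrightarrow> P (X + Y)"
    "\<And>X f. X \<in> VF \<Longrightarrow> smooth_fun A f \<Longrightarrow> P X \<Longrightarrow> P (fscale f X)"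
  shows "P X"
proof -
  obtain E where E: "finite E" "E \<subseteq> S" "card E = dim S"
    "\<And>x. x \<in> S \<Longrightarrow> (\<Sum>e\<in>E. (x \<bullet> e) *\<^sub>R e) = x" "\<And>e. e \<in> E \<Longrightarrow> e \<bullet> e = 1"
    by (rule orthonormal_basis_obtain[OF subspace_S]) (rule that)
  let ?X = "\<lambda>F. \<Sum>e\<in>F. fscale (metric_app g X (\<Phi> e)) (\<Phi> e)"
  have s: "?X F \<in> VF \<and> P (?X F)" if "F \<subseteq> E" for F
    using finite_subset[OF that E(1)] that
  proof (induction F rule: finite_induct)
    case empty
    have "P 0" using assms(2)[OF subspace_0[OF subspace_S]] unfolding \<Phi>_zero .
    with vf_zero show ?case unfolding sum.empty by (rule conjI)
  next
    case (insert e F)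
    have "fscale (metric_app g X (\<Phi> e)) (\<Phi> e) \<in> VF" "P (fscale (metric_app g X (\<Phi> e)) (\<Phi> e))"
      using vf_fscale[OF \<Phi>_vf g_smooth[OF assms(1) \<Phi>_vf]] assms(4)[OF \<Phi>_vf g_smooth[OF assms(1) \<Phi>_vf]]
        assms(2) insert.prems E(2) by auto
    then show ?case
      unfolding sum.insert[OF insert.hyps(1,2)] using insert.IH insert.prems assms(3) vf_add by blast
  qed
  have "X = ?X E"
  proof (rule field_ext[OF assms(1)])
    show "?X E \<in> VF" using s by blast
    fix p z assume p: "p \<in> mcarrier A" and z: "z \<in> S"
    obtain x where x: "x \<in> S" "\<Phi> x p = X p" using \<Phi>_surj[OF p vf_tangent[OF assms(1) p]] by blast
    have "g p (?X F p) (\<Phi> z p) = (\<Sum>e\<in>F. (x \<bullet> e) * (e \<bullet> z))" if "F \<subseteq> E" for F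
      using finite_subset[OF that E(1)] that
    proof (induction F rule: finite_induct)
      case empty
      have "g p (\<Phi> 0 p) (\<Phi> z p) = 0" using \<Phi>_inner[OF subspace_0[OF subspace_S] z p] by simp
      then show ?case by (simp add: \<Phi>_zero zero_fun_def)
    next
      case (insert e F)
      have "g p (fscale (metric_app g X (\<Phi> e)) (\<Phi> e) p) (\<Phi> z p) = (x \<bullet> e) * (e \<bullet> z)"
        using g_fields(3)[OF p \<Phi>_vf \<Phi>_vf \<Phi>_vf] \<Phi>_inner[OF _ z p] \<Phi>_inner[OF x(1) _ p] insert.prems E(2)
        by (auto simp: metric_app_def simp flip: x(2))
      moreover have "?X F \<in> VF" using s[of F] insert.prems by blast
      ultimately show ?case
        unfolding sum.insert[OF insert.hyps(1,2)]
          g_fields(2)[OF p vf_fscale[OF \<Phi>_vf g_smooth[OF assms(1) \<Phi>_vf]] \<open>?X F \<in> VF\<close> \<Phi>_vf]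
        using insert.IH insert.prems by simp
    qed
    then have "g p (?X E p) (\<Phi> z p) = (\<Sum>e\<in>E. (x \<bullet> e) *\<^sub>R e) \<bullet> z" by (simp add: inner_sum_left)
    then show "g p (X p) (\<Phi> z p) = g p (?X E p) (\<Phi> z p)"
      using E(4)[OF x(1)] \<Phi>_inner[OF x(1) z p] x(2) by simp
  qed
  then show ?thesis using s[of E] by simp
qed

lemma Riem_zero:
  assumes "\<And>x y z. x \<in> S \<Longrightarrow> y \<in> S \<Longrightarrow> z \<in> S \<Longrightarrow> N.Rm x y z = 0"
    and "X \<in> VF" "Y \<in> VF" "Z \<in> VF"
  shows "Riem X Y Z = 0"
proof -
  have f0: "fscale f 0 = (0 :: 'p vfield)" for f by (simp add: fscale_def fun_eq_iff)
  have 1: "Riem (\<Phi> x) (\<Phi> y) Z = 0" if "x \<in> S" "y \<in> S" "Z \<in> VF" for x y Z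
  proof (rule frame_induct[where P = "\<lambda>Z. Riem (\<Phi> x) (\<Phi> y) Z = 0", OF that(3)])
    show "Riem (\<Phi> x) (\<Phi> y) (\<Phi> z) = 0" if "z \<in> S" for z
      unfolding Riem_\<Phi>[OF \<open>x \<in> S\<close> \<open>y \<in> S\<close> that] assms(1)[OF \<open>x \<in> S\<close> \<open>y \<in> S\<close> that] by (rule \<Phi>_zero)
    fix Z assume Z: "Z \<in> VF" "Riem (\<Phi> x) (\<Phi> y) Z = 0"
    show "Riem (\<Phi> x) (\<Phi> y) (Z + Z') = 0" if "Z' \<in> VF" "Riem (\<Phi> x) (\<Phi> y) Z' = 0" for Z'
      unfolding Riem_add_right[OF \<Phi>_vf \<Phi>_vf Z(1) that(1)] Z(2) that(2) by (rule add_0_left)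
    show "Riem (\<Phi> x) (\<Phi> y) (fscale f Z) = 0" if "smooth_fun A f" for f
      unfolding Riem_fscale_right[OF \<Phi>_vf \<Phi>_vf Z(1) that] Z(2) by (rule f0)
  qed
  have left: "Riem X Y Z = 0" if XYZ: "X \<in> VF" "Y \<in> VF" "Z \<in> VF" and
    base: "\<And>x. x \<in> S \<Longrightarrow> Riem (\<Phi> x) Y Z = 0" for X Y Z
  proof (rule frame_induct[where P = "\<lambda>X. Riem X Y Z = 0", OF XYZ(1) base])
    fix X assume X: "X \<in> VF" "Riem X Y Z = 0"
    show "Riem (X + X') Y Z = 0" if "X' \<in> VF" "Riem X' Y Z = 0" for X'
      unfolding Riem_add_left[OF X(1) that(1) XYZ(2,3)] X(2) that(2) by (rule add_0_left)
    show "Riem (fscale f X) Y Z = 0" if "smooth_fun A f" for f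
      unfolding Riem_fscale_left[OF X(1) XYZ(2,3) that] X(2) by (rule f0)
  qed
  have 2: "Riem X (\<Phi> y) Z = 0" if "X \<in> VF" "y \<in> S" "Z \<in> VF" for X y Z
    by (rule left[OF that(1) \<Phi>_vf that(3) 1[OF _ that(2,3)]])
  have "Riem Y X Z = 0" if "X \<in> VF" "Y \<in> VF" "Z \<in> VF" for X Y Z
  proof (rule left[OF that(2,1,3)])
    fix x assume "x \<in> S"
    show "Riem (\<Phi> x) X Z = 0"
      unfolding Riem_anti[OF \<Phi>_vf that(1,3)] 2[OF that(1) \<open>x \<in> S\<close> that(3)] by (rule minus_zero)
  qed
  then show ?thesis using assms by blast
qed

theorem chern_flat:
  assumes solv: "der_ser br S k = {0}" and JU: "j ` der_ser br S 1 = der_ser br S 1"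
    and const: "const_hol_sect_curv A J g D c"
  shows "flat_connection A g D"
proof -
  \<comment> \<open>One point suffices, since the curvature of frame fields has constant
    coefficients in the frame.\<close>
  obtain p where p: "p \<in> mcarrier A" using nonempty by blast
  have zero: "g p 0 (\<Phi> x p) = 0" if "p \<in> mcarrier A" "x \<in> S" for x p
    using \<Phi>_inner[OF subspace_0[OF subspace_S] that(2,1)] by (simp add: \<Phi>_zero)
  have hol: "N.Rm x (j x) (j x) \<bullet> x = c * (x \<bullet> x)\<^sup>2" if x: "x \<in> S" for x
  proof (cases "x = 0")
    case False
    have gx: "g p (\<Phi> x p) (\<Phi> x p) = x \<bullet> x" by (rule \<Phi>_inner[OF x x p])
    have "\<Phi> x p \<noteq> 0" using zero[OF p x] gx False by auto
    then have "hol_sect_curv J g D (\<Phi> x) p = c"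
      using const vf_tangent[OF \<Phi>_vf p] p \<Phi>_vf unfolding const_hol_sect_curv_def by blast
    moreover have "curvature g D (\<Phi> x) (JV (\<Phi> x)) (JV (\<Phi> x)) (\<Phi> x) p = N.Rm x (j x) (j x) \<bullet> x"
    proof -
      have "curvature g D (\<Phi> x) (JV (\<Phi> x)) (JV (\<Phi> x)) (\<Phi> x) p = g p (\<Phi> (N.Rm x (j x) (j x)) p) (\<Phi> x p)"
        using Riem_\<Phi>[OF x j_in j_in] by (simp add: curvature_def Riem_def metric_app_def \<Phi>_j)
      also have "\<dots> = N.Rm x (j x) (j x) \<bullet> x"
        using x j_in br_in by (intro \<Phi>_inner p) (auto simp: N.Rm_def intro!: subspace_diff[OF subspace_S] N.nab_in)
      finally show ?thesis .
    qed
    ultimately show ?thesis using False by (simp add: hol_sect_curv_def gx field_simps)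
  qed (simp add: N.Rm_def N.nab_simps)
  have "N.Rm x y z = 0" if "x \<in> S" "y \<in> S" "z \<in> S" for x y z
    by (rule N.constant_hol_flat[OF solv JU hol that])
  then have R: "Riem X Y Z = 0" if "X \<in> VF" "Y \<in> VF" "Z \<in> VF" for X Y Z
    using Riem_zero that by blast
  have z: "g p 0 (W p) = 0" if "p \<in> mcarrier A" "W \<in> VF" for p W
    using g_fields(3)[OF that(1) vf_zero that(2,2), of "\<lambda>_. 0"] by (simp add: fscale_def flip: zero_fun_def)
  show ?thesis
    unfolding flat_connection_def curvature_def metric_app_def
    using R z unfolding Riem_def by simp
qed

end

section \<open>Left-invariant vector fields\<close>

lemma differential_eq: "differential B F x f = (if smooth_fun B f then x (\<lambda>q. f (F q)) else 0)"
  by (simp add: differential_def o_def)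

lemma differential_add: "differential B F (x + y) = differential B F x + differential B F y"
  by (auto simp: differential_eq fun_eq_iff)

lemma differential_scale: "differential B F (\<lambda>f. c * x f) = (\<lambda>f. c * differential B F x f)"
  by (auto simp: differential_eq fun_eq_iff)

locale smooth_group = smooth_mfd T A
  for G :: "('g, 'b) monoid_scheme" (structure) and T :: "'g topology" and A :: "('g, 'v::euclidean_space) chart set" +
  assumes lie_group: "lie_group G T A"
begin

sublocale group G
  using lie_group by (simp add: lie_group_def)

lemma carrier_eq: "mcarrier A = carrier G" "topspace T = carrier G"
  using lie_group topspace_carrier by (simp_all add: lie_group_def)

text \<open>The multiplication in charts of both factors and of the product. The inverses of the two
  factor charts are written separately, so that fixing one variable is visible in the
  formula.\<close>

definition mult_loc :: "('g, 'v) chart \<Rightarrow> ('g, 'v) chart \<Rightarrow> ('g, 'v) chart \<Rightarrow> 'v \<times> 'v \<Rightarrow> 'v" where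
  "mult_loc ch ch0 ch' = (\<lambda>(y, z). snd ch' (inv_into (fst ch) (snd ch) y \<otimes> inv_into (fst ch0) (snd ch0) z))"

definition mult_dom :: "('g, 'v) chart \<Rightarrow> ('g, 'v) chart \<Rightarrow> ('g, 'v) chart \<Rightarrow> ('v \<times> 'v) set" where
  "mult_dom ch ch0 ch' = {(snd ch p, snd ch0 q) |p q. p \<in> fst ch \<and> q \<in> fst ch0 \<and> p \<otimes> q \<in> fst ch'}"

context
  fixes ch ch0 ch' assumes ch: "ch \<in> A" "ch0 \<in> A" "ch' \<in> A"
begin

lemma mult_loc_at: "p \<in> fst ch \<Longrightarrow> q \<in> fst ch0 \<Longrightarrow> mult_loc ch ch0 ch' (snd ch p, snd ch0 q) = snd ch' (p \<otimes> q)"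
  by (simp add: mult_loc_def inv_ch[OF ch(1)] inv_ch[OF ch(2)])

lemma mult_loc_im: "w \<in> mult_dom ch ch0 ch' \<Longrightarrow> mult_loc ch ch0 ch' w \<in> im ch'"
  using mult_loc_at im_I[OF ch(3)] by (auto simp: mult_dom_def)

lemma open_mult_dom: "open (mult_dom ch ch0 ch')"
proof -
  let ?m = "\<lambda>(a, b). a \<otimes> b"
  let ?W = "{x \<in> topspace (prod_topology T T). ?m x \<in> fst ch'} \<inter> fst ch \<times> fst ch0"
  have cont: "continuous_map (prod_topology T T) T ?m"
    using lie_group by (simp add: lie_group_def smooth_map_def)
  have "openin (prod_topology T T) ?W"
    using openin_continuous_map_preimage[OF cont is_chart_ch(1)[OF ch(3)]]
      is_chart_ch(1)[OF ch(1)] is_chart_ch(1)[OF ch(2)]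
    by (intro openin_Int) (auto simp: openin_prod_Times_iff)
  then have W: "\<exists>U V. openin T U \<and> openin T V \<and> p \<in> U \<and> q \<in> V \<and> U \<times> V \<subseteq> ?W" if "(p, q) \<in> ?W" for p q
    using that unfolding openin_prod_topology_alt by blast
  show ?thesis
  proof (subst open_subopen, rule ballI)
    fix w assume "w \<in> mult_dom ch ch0 ch'"
    then obtain p q where pq: "p \<in> fst ch" "q \<in> fst ch0" "p \<otimes> q \<in> fst ch'" "w = (snd ch p, snd ch0 q)"
      by (auto simp: mult_dom_def)
    have "p \<in> topspace T" "q \<in> topspace T"
      using subsetD[OF openin_subset[OF is_chart_ch(1)[OF ch(1)]] pq(1)]
        subsetD[OF openin_subset[OF is_chart_ch(1)[OF ch(2)]] pq(2)] .
    then have "(p, q) \<in> ?W" using pq by simp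
    from W[OF this] obtain U V where UV: "openin T U" "openin T V" "p \<in> U" "q \<in> V" "U \<times> V \<subseteq> ?W" by blast
    have sub: "U \<subseteq> fst ch" "V \<subseteq> fst ch0" using UV(3-5) by blast+
    have "open (snd ch ` U \<times> snd ch0 ` V)"
      by (intro open_Times open_image_ch[OF ch(1) UV(1) sub(1)] open_image_ch[OF ch(2) UV(2) sub(2)])
    moreover have "snd ch ` U \<times> snd ch0 ` V \<subseteq> mult_dom ch ch0 ch'"
    proof
      fix u assume "u \<in> snd ch ` U \<times> snd ch0 ` V"
      then obtain p' q' where "p' \<in> U" "q' \<in> V" "u = (snd ch p', snd ch0 q')" by auto
      moreover from this have "(p', q') \<in> ?W" using UV(5) by blast
      ultimately show "u \<in> mult_dom ch ch0 ch'" by (auto simp: mult_dom_def)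
    qed
    ultimately show "\<exists>T. open T \<and> w \<in> T \<and> T \<subseteq> mult_dom ch ch0 ch'" using UV pq by blast
  qed
qed

lemma smooth_mult_loc: "smooth_on (mult_dom ch ch0 ch') (mult_loc ch ch0 ch')"
proof -
  let ?m = "\<lambda>(a, b). a \<otimes> b"
  let ?U = "fst ch \<times> fst ch0" and ?\<phi> = "map_prod (snd ch) (snd ch0)"
  have "(fst ch, snd ch) \<in> A" "(fst ch0, snd ch0) \<in> A" using ch by simp_all
  then have "(?U, ?\<phi>) \<in> prod_atlas A A" unfolding prod_atlas_def by blast
  moreover have "\<forall>(U, \<phi>)\<in>prod_atlas A A. \<forall>(V, \<psi>)\<in>A. smooth_on (\<phi> ` (U \<inter> ?m -` V)) (\<psi> \<circ> ?m \<circ> inv_into U \<phi>)"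
    using lie_group by (simp add: lie_group_def smooth_map_def)
  ultimately have "smooth_on (?\<phi> ` (?U \<inter> ?m -` fst ch')) (snd ch' \<circ> ?m \<circ> inv_into ?U ?\<phi>)"
    using ch(3) by fastforce
  moreover have dom: "?\<phi> ` (?U \<inter> ?m -` fst ch') = mult_dom ch ch0 ch'"
    by (force simp: mult_dom_def)
  ultimately have s: "smooth_on (mult_dom ch ch0 ch') (snd ch' \<circ> ?m \<circ> inv_into ?U ?\<phi>)" by simp
  have inj: "inj_on ?\<phi> ?U"
    using inj_ch[OF ch(1)] inj_ch[OF ch(2)] by (auto simp: inj_on_def)
  show ?thesis
  proof (rule smooth_on_cong[OF open_mult_dom _ s])
    fix w assume "w \<in> mult_dom ch ch0 ch'"
    then obtain p q where pq: "p \<in> fst ch" "q \<in> fst ch0" "w = ?\<phi> (p, q)" by (auto simp: mult_dom_def)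
    then have "inv_into ?U ?\<phi> w = (p, q)" using inv_into_f_f[OF inj, of "(p, q)"] by simp
    then show "(snd ch' \<circ> ?m \<circ> inv_into ?U ?\<phi>) w = mult_loc ch ch0 ch' w"
      using pq mult_loc_at by simp
  qed
qed

end

lemma open_slice:
  fixes W :: "('x::topological_space \<times> 'y::topological_space) set"
  assumes "open W" shows "open {z. (y, z) \<in> W}" "open {y. (y, z) \<in> W}"
proof -
  have "{z. (y, z) \<in> W} = (\<lambda>z. (y, z)) -` W" "{y. (y, z) \<in> W} = (\<lambda>y. (y, z)) -` W" by auto
  then show "open {z. (y, z) \<in> W}" "open {y. (y, z) \<in> W}"
    using assms by (auto intro!: open_vimage continuous_intros)
qed

lemma bounded_linear_slice: "bounded_linear (\<lambda>z. (0, z))" "bounded_linear (\<lambda>y. (y, 0))"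
  by (auto intro!: bounded_linear_Pair bounded_linear_zero bounded_linear_ident)

lemma smooth_slice:
  fixes F :: "'v \<times> 'v \<Rightarrow> 'w::real_normed_vector"
  assumes "open W" "smooth_on W F"
  shows "smooth_on {z. (y, z) \<in> W} (\<lambda>z. F (y, z))" "smooth_on {y. (y, z) \<in> W} (\<lambda>y. F (y, z))"
proof -
  have "smooth_on {z. (y, z) \<in> W} (\<lambda>z. F ((0, z) + (y, 0)))"
    by (rule smooth_on_compose[OF open_slice(1)[OF assms(1)] assms(1) _ smooth_on_affine[OF bounded_linear_slice(1)] assms(2)]) auto
  then show "smooth_on {z. (y, z) \<in> W} (\<lambda>z. F (y, z))" by simp
  have "smooth_on {y. (y, z) \<in> W} (\<lambda>y. F ((y, 0) + (0, z)))"
    by (rule smooth_on_compose[OF open_slice(2)[OF assms(1)] assms(1) _ smooth_on_affine[OF bounded_linear_slice(2)] assms(2)]) auto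
  then show "smooth_on {y. (y, z) \<in> W} (\<lambda>y. F (y, z))" by simp
qed

lemma chart_of_carrier: "p \<in> carrier G \<Longrightarrow> \<exists>ch\<in>A. p \<in> fst ch"
  using chart_of carrier_eq by simp

lemma fst_in_carrier: "ch \<in> A \<Longrightarrow> p \<in> fst ch \<Longrightarrow> p \<in> carrier G"
  using fst_carrier carrier_eq by blast

lemma translation_loc:
  assumes ch: "ch \<in> A" "ch0 \<in> A" "ch' \<in> A" and p: "p \<in> fst ch" "q \<in> fst ch0" "p \<otimes> q \<in> fst ch'"
  defines "W \<equiv> {z. (snd ch p, z) \<in> mult_dom ch ch0 ch'}"
  shows "open W" "snd ch0 q \<in> W" "smooth_on W (\<lambda>z. mult_loc ch ch0 ch' (snd ch p, z))"
    "\<And>z. z \<in> W \<Longrightarrow> loc ch0 (\<lambda>r. f (p \<otimes> r)) z = loc ch' f (mult_loc ch ch0 ch' (snd ch p, z))"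
proof -
  show "open W" unfolding W_def by (rule open_slice(1)[OF open_mult_dom[OF ch]])
  show "snd ch0 q \<in> W" using p by (auto simp: W_def mult_dom_def)
  show "smooth_on W (\<lambda>z. mult_loc ch ch0 ch' (snd ch p, z))"
    unfolding W_def by (rule smooth_slice(1)[OF open_mult_dom[OF ch] smooth_mult_loc[OF ch]])
  fix z assume "z \<in> W"
  then obtain p' r where r: "p' \<in> fst ch" "snd ch p = snd ch p'" "z = snd ch0 r" "r \<in> fst ch0" "p' \<otimes> r \<in> fst ch'"
    by (auto simp: W_def mult_dom_def)
  have "p' = p" using inj_onD[OF inj_ch[OF ch(1)] r(2) p(1) r(1)] by simp
  then show "loc ch0 (\<lambda>r. f (p \<otimes> r)) z = loc ch' f (mult_loc ch ch0 ch' (snd ch p, z))"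
    using r p by (simp add: loc_at[OF ch(2)] loc_at[OF ch(3)] mult_loc_at[OF ch])
qed

lemma smooth_translation:
  assumes a: "a \<in> carrier G" and f: "smooth_fun A f" shows "smooth_fun A (\<lambda>q. f (a \<otimes> q))"
  unfolding smooth_fun_loc
proof (intro ballI smooth_on_local)
  fix ch0 y assume ch0: "ch0 \<in> A" and "y \<in> im ch0"
  then obtain q where q: "q \<in> fst ch0" "y = snd ch0 q" by (auto simp: im_def)
  obtain ch where ch: "ch \<in> A" "a \<in> fst ch" using chart_of_carrier[OF a] by blast
  obtain ch' where ch': "ch' \<in> A" "a \<otimes> q \<in> fst ch'"
    using chart_of_carrier[OF m_closed[OF a fst_in_carrier[OF ch0 q(1)]]] by blast
  note W = translation_loc[OF ch(1) ch0 ch'(1) ch(2) q(1) ch'(2)]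
  let ?W = "{z. (snd ch a, z) \<in> mult_dom ch ch0 ch'}"
  have s: "smooth_on ?W (\<lambda>z. loc ch' f (mult_loc ch ch0 ch' (snd ch a, z)))"
    by (rule smooth_on_compose[OF W(1) is_chart_ch(2)[OF ch'(1)] _ W(3) loc_smooth[OF ch'(1) f]])
      (use mult_loc_im[OF ch(1) ch0 ch'(1)] in auto)
  have e: "loc ch' f (mult_loc ch ch0 ch' (snd ch a, z)) = loc ch0 (\<lambda>q. f (a \<otimes> q)) z" if "z \<in> ?W" for z
    using W(4)[OF that, of f] by simp
  have "smooth_on ?W (loc ch0 (\<lambda>q. f (a \<otimes> q)))"
    by (rule smooth_on_cong[OF W(1) e s])
  then show "\<exists>T. open T \<and> y \<in> T \<and> smooth_on T (loc ch0 (\<lambda>q. f (a \<otimes> q)))"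
    using W(1,2) q(2) by blast
qed

section \<open>Differentials of left translations and the fields invariant under them\<close>

abbreviation dL :: "'g \<Rightarrow> 'g tvec \<Rightarrow> 'g tvec" where "dL a \<equiv> differential A (\<lambda>q. a \<otimes> q)"

lemma dL_coord:
  assumes ch: "ch \<in> A" "ch0 \<in> A" "ch' \<in> A" and p: "p \<in> fst ch" "q \<in> fst ch0" "p \<otimes> q \<in> fst ch'"
  shows "dL p (coord_tvec A ch0 q \<xi>) =
    coord_tvec A ch' (p \<otimes> q) (fder (\<lambda>z. mult_loc ch ch0 ch' (snd ch p, z)) (snd ch0 q) \<xi>)"
proof
  fix f
  let ?F = "\<lambda>z. mult_loc ch ch0 ch' (snd ch p, z)"
  note W = translation_loc[OF ch p]
  show "dL p (coord_tvec A ch0 q \<xi>) f = coord_tvec A ch' (p \<otimes> q) (fder ?F (snd ch0 q) \<xi>) f"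
  proof (cases "smooth_fun A f")
    case True
    have F: "?F (snd ch0 q) = snd ch' (p \<otimes> q)" using mult_loc_at[OF ch p(1,2)] .
    have d: "?F differentiable (at (snd ch0 q))" "loc ch' f differentiable (at (?F (snd ch0 q)))"
      using smooth_on_differentiable[OF W(3,2)] loc_differentiable[OF ch(3) True p(3)] F by auto
    have "fder (loc ch0 (\<lambda>r. f (p \<otimes> r))) (snd ch0 q) = fder (\<lambda>z. loc ch' f (?F z)) (snd ch0 q)"
      by (rule fder_cong(1)[OF W(1,2) W(4)[symmetric] fder_compose(2)[OF d]])
    then show ?thesis
      using fder_compose(1)[OF d, of \<xi>] F True smooth_translation[OF fst_in_carrier[OF ch(1) p(1)] True]
      by (simp add: differential_eq coord_tvec_loc)
  qed (simp add: differential_eq coord_tvec_loc)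
qed

lemma dL_tangent:
  assumes a: "a \<in> carrier G" and x: "x \<in> tangent_space A q" shows "dL a x \<in> tangent_space A (a \<otimes> q)"
proof -
  obtain ch0 \<xi> where ch0: "ch0 \<in> A" "q \<in> fst ch0" "x = coord_tvec A ch0 q \<xi>" using tangent_spaceE[OF x] by blast
  obtain ch where ch: "ch \<in> A" "a \<in> fst ch" using chart_of_carrier[OF a] by blast
  obtain ch' where ch': "ch' \<in> A" "a \<otimes> q \<in> fst ch'"
    using chart_of_carrier[OF m_closed[OF a fst_in_carrier[OF ch0(1,2)]]] by blast
  show ?thesis
    unfolding ch0(3) dL_coord[OF ch(1) ch0(1) ch'(1) ch(2) ch0(2) ch'(2)]
    using tangent_space_chart[OF ch'] by blast
qed

lemma dL_compose:
  assumes "a \<in> carrier G" "b \<in> carrier G" "x \<in> tangent_space A q"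
  shows "dL a (dL b x) = dL (a \<otimes> b) x"
proof
  fix f
  show "dL a (dL b x) f = dL (a \<otimes> b) x f"
  proof (cases "smooth_fun A f")
    case True
    have "x (\<lambda>q. f (a \<otimes> (b \<otimes> q))) = x (\<lambda>q. f (a \<otimes> b \<otimes> q))"
      by (rule tangent_cong[OF assms(3)]) (use assms m_assoc carrier_eq in auto)
    then show ?thesis using True smooth_translation[OF assms(1) True] by (simp add: differential_eq)
  qed (simp add: differential_eq)
qed

lemma dL_one: assumes "x \<in> tangent_space A q" shows "dL \<one> x = x"
proof
  fix f
  have "x (\<lambda>q. f (\<one> \<otimes> q)) = x f" by (rule tangent_cong[OF assms]) (use carrier_eq in auto)
  then show "dL \<one> x f = x f" using tangent_not_smooth[OF assms] by (simp add: differential_eq)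
qed

abbreviation LF where "LF \<equiv> left_invariant_fields G A"

lemma LF_vf: "X \<in> LF \<Longrightarrow> X \<in> VF"
  and LF_inv: "X \<in> LF \<Longrightarrow> a \<in> carrier G \<Longrightarrow> p \<in> carrier G \<Longrightarrow> X (a \<otimes> p) = dL a (X p)"
  by (auto simp: left_invariant_fields_def)

lemma LFI: "X \<in> VF \<Longrightarrow> (\<And>a p. a \<in> carrier G \<Longrightarrow> p \<in> carrier G \<Longrightarrow> X (a \<otimes> p) = dL a (X p)) \<Longrightarrow> X \<in> LF"
  by (auto simp: left_invariant_fields_def)

lemma LF_tangent: "X \<in> LF \<Longrightarrow> p \<in> carrier G \<Longrightarrow> X p \<in> tangent_space A p"
  using vf_tangent LF_vf carrier_eq by simp

definition ext :: "'g tvec \<Rightarrow> 'g vfield" where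
  "ext x = (\<lambda>p. if p \<in> carrier G then dL p x else 0)"

text \<open>In charts the field is the partial derivative of the multiplication in its second factor
  at the identity, as a function of the first factor. Its smoothness rests on the joint smoothness
  of the multiplication rather than on that of each translation.\<close>

lemma ext_LF: assumes x: "x \<in> tangent_space A \<one>" shows "ext x \<in> LF"
proof (rule LFI)
  fix a p assume "a \<in> carrier G" "p \<in> carrier G"
  then show "ext x (a \<otimes> p) = dL a (ext x p)" using x by (simp add: ext_def dL_compose)
next
  obtain ch0 \<xi> where ch0: "ch0 \<in> A" "\<one> \<in> fst ch0" "x = coord_tvec A ch0 \<one> \<xi>" using tangent_spaceE[OF x] by blast
  show "ext x \<in> VF"
  proof (rule vfI)
    show "ext x p = 0" if "p \<notin> mcarrier A" for p using that carrier_eq by (simp add: ext_def)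
    fix ch assume ch: "ch \<in> A"
    let ?M = "mult_loc ch ch0 ch" and ?z = "snd ch0 \<one>"
    let ?\<zeta> = "\<lambda>y. fder ?M (y, ?z) (0, \<xi>)"
    note W = open_mult_dom[OF ch ch0(1) ch] and s = smooth_mult_loc[OF ch ch0(1) ch]
    have dom: "(snd ch p, ?z) \<in> mult_dom ch ch0 ch" if "p \<in> fst ch" for p
    proof -
      have "p \<otimes> \<one> \<in> fst ch" using that fst_in_carrier[OF ch that] by simp
      then show ?thesis using that ch0(2) unfolding mult_dom_def by blast
    qed
    have "smooth_on {y. (y, ?z) \<in> mult_dom ch ch0 ch} ?\<zeta>"
      by (rule smooth_slice(2)[OF W smooth_on_fder[OF s]])
    moreover have "im ch \<subseteq> {y. (y, ?z) \<in> mult_dom ch ch0 ch}" using dom by (auto simp: im_def)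
    ultimately have "smooth_on (im ch) ?\<zeta>" by (rule smooth_on_subset)
    moreover have "ext x p = coord_tvec A ch p (?\<zeta> (snd ch p))" if p: "p \<in> fst ch" for p
    proof -
      have pG: "p \<in> carrier G" "p \<otimes> \<one> \<in> fst ch" using p fst_in_carrier[OF ch p] by simp_all
      have d: "?M differentiable (at (snd ch p, ?z))" by (rule smooth_on_differentiable[OF s dom[OF p]])
      have "((\<lambda>z. (snd ch p, z)) has_derivative (\<lambda>v. (0, v))) (at ?z)"
        by (auto intro!: derivative_eq_intros)
      from has_derivative_compose[OF this fder_works[OF d]]
      have "fder (\<lambda>z. ?M (snd ch p, z)) ?z \<xi> = ?\<zeta> (snd ch p)" using fder_eq by metis
      then show ?thesis
        using dL_coord[OF ch ch0(1) ch p ch0(2) pG(2), of \<xi>] pG by (simp add: ext_def ch0(3))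
    qed
    ultimately show "\<exists>\<xi>. smooth_on (im ch) \<xi> \<and> (\<forall>p\<in>fst ch. ext x p = coord_tvec A ch p (\<xi> (snd ch p)))"
      by blast
  qed
qed

lemma LF_ext: assumes X: "X \<in> LF" shows "X = ext (X \<one>)"
proof
  fix p show "X p = ext (X \<one>) p"
    using LF_inv[OF X, of p \<one>] vf_outside[OF LF_vf[OF X], of p] carrier_eq by (simp add: ext_def)
qed

lemma LF_surj: assumes p: "p \<in> carrier G" and x: "x \<in> tangent_space A p" shows "\<exists>X\<in>LF. X p = x"
proof -
  let ?x = "dL (inv p) x"
  have t: "?x \<in> tangent_space A \<one>" using dL_tangent[OF inv_closed[OF p] x] p by simp
  have "ext ?x p = x" using p x by (simp add: ext_def dL_compose dL_one)
  then show ?thesis using ext_LF[OF t] by blast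
qed

lemma LF_add: "X \<in> LF \<Longrightarrow> Y \<in> LF \<Longrightarrow> X + Y \<in> LF"
  by (rule LFI) (simp_all add: LF_vf vf_add LF_inv differential_add)

lemma LF_scale: assumes "X \<in> LF" shows "fscale (\<lambda>_. c) X \<in> LF"
proof (rule LFI)
  show "fscale (\<lambda>_. c) X \<in> VF" using assms LF_vf vf_fscale smooth_fun_const by blast
  show "fscale (\<lambda>_. c) X (a \<otimes> p) = dL a (fscale (\<lambda>_. c) X p)" if "a \<in> carrier G" "p \<in> carrier G" for a p
    using LF_inv[OF assms that] by (simp add: fscale_def differential_scale)
qed

text \<open>Differentiating by an invariant field commutes with pulling functions back along a left
  translation, and so does a commutator of two such operators.\<close>

lemma LF_bracket: assumes X: "X \<in> LF" and Y: "Y \<in> LF" shows "lie_bracket X Y \<in> LF"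
proof (rule LFI)
  show v: "lie_bracket X Y \<in> VF" using X Y LF_vf vf_bracket by blast
  fix a p assume a: "a \<in> carrier G" and p: "p \<in> carrier G"
  show "lie_bracket X Y (a \<otimes> p) = dL a (lie_bracket X Y p)"
  proof
    fix f
    show "lie_bracket X Y (a \<otimes> p) f = dL a (lie_bracket X Y p) f"
    proof (cases "smooth_fun A f")
      case True
      have *: "U (a \<otimes> p) (vderiv V f) = U p (vderiv V (\<lambda>q. f (a \<otimes> q)))" if UV: "U \<in> LF" "V \<in> LF" for U V
      proof -
        have "U (a \<otimes> p) (vderiv V f) = U p (\<lambda>q. vderiv V f (a \<otimes> q))"
          using LF_inv[OF UV(1) a p] smooth_vderiv[OF LF_vf[OF UV(2)]] by (simp add: differential_eq)
        also have "\<dots> = U p (vderiv V (\<lambda>q. f (a \<otimes> q)))"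
          by (rule vf_ops(1)[OF LF_vf[OF UV(1)]])
            (use LF_inv[OF UV(2) a] True carrier_eq in \<open>simp add: vderiv_def differential_eq\<close>)
        finally show ?thesis .
      qed
      show ?thesis using True by (simp add: lie_bracket_def differential_eq *[OF X Y] *[OF Y X])
    next
      case False
      then show ?thesis using vf_ops(2)[OF v] by (simp add: differential_eq)
    qed
  qed
qed

end

text \<open>Gram-Schmidt that discards residues of seminorm zero. The form is pulled back from
  invariant fields to chart coordinates, a map whose injectivity would call for bump functions, so
  it is only taken to be semidefinite. The bound on the cardinality lets the result fit into the
  chart space.\<close>

lemma gram_schmidt_degenerate:
  fixes q :: "'v::real_vector \<Rightarrow> 'v \<Rightarrow> real"
  assumes bil: "\<And>x y z. q (x + y) z = q x z + q y z" "\<And>c x z. q (c *\<^sub>R x) z = c * q x z"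
    and sym: "\<And>x y. q x y = q y x" and null: "\<And>x y. q x x = 0 \<Longrightarrow> q x y = 0" and pos: "\<And>x. q x x \<ge> 0"
    and "finite B"
  shows "\<exists>E. finite E \<and> card E \<le> card B \<and> (\<forall>e\<in>E. \<forall>d\<in>E. q e d = (if e = d then 1 else 0)) \<and>
    (\<forall>x\<in>B. q (x - (\<Sum>e\<in>E. q x e *\<^sub>R e)) (x - (\<Sum>e\<in>E. q x e *\<^sub>R e)) = 0)"
  using \<open>finite B\<close>
proof (induction B rule: finite_induct)
  case empty
  show ?case by (rule exI[of _ "{}"]) simp
next
  case (insert b B)
  then obtain E where E: "finite E" "card E \<le> card B" "\<And>e d. e \<in> E \<Longrightarrow> d \<in> E \<Longrightarrow> q e d = (if e = d then 1 else 0)"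
    and res: "\<And>x. x \<in> B \<Longrightarrow> q (x - (\<Sum>e\<in>E. q x e *\<^sub>R e)) (x - (\<Sum>e\<in>E. q x e *\<^sub>R e)) = 0" by auto
  have q0: "q 0 z = 0" for z using bil(2)[of 0 0 z] by simp
  have qneg: "q (- x) z = - q x z" for x z using bil(2)[of "-1" x z] by simp
  have qdiff: "q (x - y) z = q x z - q y z" for x y z using bil(1)[of x "- y" z] qneg by simp
  have qsum: "q (\<Sum>e\<in>F. f e) z = (\<Sum>e\<in>F. q (f e) z)" for F f z
    by (induction F rule: infinite_finite_induct) (simp_all add: q0 bil)
  have orth: "q (x - (\<Sum>e\<in>E. q x e *\<^sub>R e)) d = 0" if "d \<in> E" for x d
  proof -
    have "(\<Sum>e\<in>E. q x e * q e d) = (\<Sum>e\<in>E. if e = d then q x e else 0)"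
      using E(3)[OF _ that] by (intro sum.cong) auto
    then show ?thesis using that E(1) by (simp add: qdiff qsum bil)
  qed
  define r where "r = b - (\<Sum>e\<in>E. q b e *\<^sub>R e)"
  show ?case
  proof (cases "q r r = 0")
    case True
    then show ?thesis using E res insert.hyps unfolding r_def by (intro exI[of _ E]) auto
  next
    case False
    define s where "s = sqrt (q r r)"
    have s: "s > 0" "s * s = q r r" using False pos[of r] by (simp_all add: s_def)
    define d where "d = (1 / s) *\<^sub>R r"
    have dd: "q d d = 1"
      using s False by (simp add: d_def bil sym[of r "(1/s) *\<^sub>R r"] field_simps)
    have de: "q d e = 0" "q e d = 0" if "e \<in> E" for e
      using orth[OF that, of b] sym[of e d] by (simp_all add: d_def bil flip: r_def)
    have dE: "d \<notin> E" using dd de(1) by force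
    have sum_ins: "(\<Sum>e\<in>insert d E. q x e *\<^sub>R e) = q x d *\<^sub>R d + (\<Sum>e\<in>E. q x e *\<^sub>R e)" for x
      using E(1) dE by simp
    have sum_d: "q (\<Sum>e\<in>E. q x e *\<^sub>R e) d = 0" for x
      by (simp add: qsum bil de)
    show ?thesis
    proof (intro exI[of _ "insert d E"] conjI ballI)
      show "finite (insert d E)" using E by simp
      show "card (insert d E) \<le> card (insert b B)" using E insert.hyps dE by simp
      show "q e f = (if e = f then 1 else 0)" if "e \<in> insert d E" "f \<in> insert d E" for e f
        using that E(3) dd de dE by auto
      fix x assume x: "x \<in> insert b B"
      show "q (x - (\<Sum>e\<in>insert d E. q x e *\<^sub>R e)) (x - (\<Sum>e\<in>insert d E. q x e *\<^sub>R e)) = 0"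
      proof (cases "x = b")
        case True
        have "q b d = q r d" using sum_d[of b] by (simp add: r_def qdiff)
        also have "\<dots> = s" using s by (simp add: d_def sym[of r "(1/s) *\<^sub>R r"] bil field_simps)
        finally have "q b d *\<^sub>R d = r" using s by (simp add: d_def)
        then have "x - (\<Sum>e\<in>insert d E. q x e *\<^sub>R e) = 0" unfolding sum_ins using True by (simp add: r_def)
        then show ?thesis by (simp add: q0)
      next
        case False
        then have xB: "x \<in> B" using x by simp
        have "q x d = q (x - (\<Sum>e\<in>E. q x e *\<^sub>R e)) d" using sum_d[of x] by (simp add: qdiff)
        also have "\<dots> = 0" using null[OF res[OF xB]] .
        finally show ?thesis unfolding sum_ins using res[OF xB] by simp
      qed
    qed
  qed
qed

text \<open>Otherwise some multiple of \<open>x\<close>, added to \<open>y\<close>, would have the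
  square -1.\<close>

lemma psd_null:
  fixes q :: "'v::real_vector \<Rightarrow> 'v \<Rightarrow> real"
  assumes bil: "\<And>x y z. q (x + y) z = q x z + q y z" "\<And>c x z. q (c *\<^sub>R x) z = c * q x z"
    and sym: "\<And>x y. q x y = q y x" and pos: "\<And>x. q x x \<ge> 0" and x: "q x x = 0"
  shows "q x y = 0"
proof (rule ccontr)
  assume ne: "q x y \<noteq> 0"
  have e: "q (t *\<^sub>R x + y) (t *\<^sub>R x + y) = 2 * t * q x y + q y y" for t
    using bil sym x by (simp add: sym[of x "t *\<^sub>R x + y"] sym[of y "t *\<^sub>R x + y"] sym[of y x] algebra_simps)
  have "2 * (- (q y y + 1) / (2 * q x y)) * q x y + q y y = -1" using ne by (simp add: field_simps)
  then show False using pos e by (metis not_one_le_zero neg_0_le_iff_le)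
qed

section \<open>An isometric model of the left-invariant fields\<close>

locale herm_group = smooth_group G T A
  for G :: "('g, 'b) monoid_scheme" (structure) and T :: "'g topology" and A :: "('g, 'v::euclidean_space) chart set" +
  fixes J' :: "'g endo_field" and g' :: "'g metric_field"
  assumes hermitian': "hermitian_manifold T A J' g'"
    and J'_inv: "left_invariant_endo G A J'" and g'_inv: "left_invariant_metric G A g'"
begin

lemma LF_J': assumes X: "X \<in> LF" shows "endo_app J' X \<in> LF"
proof (rule LFI)
  show "endo_app J' X \<in> VF"
    using hermitian' LF_vf[OF X] unfolding hermitian_manifold_def complex_structure_def by blast
  show "endo_app J' X (a \<otimes> p) = dL a (endo_app J' X p)" if "a \<in> carrier G" "p \<in> carrier G" for a p
    using J'_inv LF_inv[OF X that] LF_tangent[OF X that(2)] that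
    unfolding left_invariant_endo_def by (simp add: endo_app_def)
qed

lemma J'_add: assumes X: "X \<in> LF" and Y: "Y \<in> LF" shows "endo_app J' (X + Y) = endo_app J' X + endo_app J' Y"
proof
  fix p show "endo_app J' (X + Y) p = (endo_app J' X + endo_app J' Y) p"
  proof (cases "p \<in> carrier G")
    case True
    have "\<forall>y\<in>tangent_space A p. J' p (X p + y) = J' p (X p) + J' p y"
      using hermitian' LF_tangent[OF X True] True carrier_eq
      unfolding hermitian_manifold_def complex_structure_def by blast
    then show ?thesis using LF_tangent[OF Y True] by (simp add: endo_app_def)
  next
    case False
    then have "Z p = 0" if "Z \<in> LF" for Z using vf_outside[OF LF_vf[OF that]] carrier_eq by simp
    then have "endo_app J' (X + Y) p = 0" "endo_app J' X p = 0" "endo_app J' Y p = 0"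
      using LF_J' LF_add X Y by blast+
    then show ?thesis by simp
  qed
qed

lemma J'_scale: assumes X: "X \<in> LF" shows "endo_app J' (fscale (\<lambda>_. c) X) = fscale (\<lambda>_. c) (endo_app J' X)"
proof
  fix p show "endo_app J' (fscale (\<lambda>_. c) X) p = fscale (\<lambda>_. c) (endo_app J' X) p"
  proof (cases "p \<in> carrier G")
    case True
    have "\<forall>c. J' p (\<lambda>f. c * X p f) = (\<lambda>f. c * J' p (X p) f)"
      using hermitian' LF_tangent[OF X True] True carrier_eq
      unfolding hermitian_manifold_def complex_structure_def by blast
    then show ?thesis by (simp add: endo_app_def fscale_def)
  next
    case False
    then have "Z p = 0" if "Z \<in> LF" for Z using vf_outside[OF LF_vf[OF that]] carrier_eq by simp
    then have "endo_app J' (fscale (\<lambda>_. c) X) p = 0" "endo_app J' X p = 0"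
      using LF_J' LF_scale X by blast+
    then show ?thesis by (simp add: fscale_def zero_fun_def)
  qed
qed

definition ip :: "'g vfield \<Rightarrow> 'g vfield \<Rightarrow> real" where
  "ip X Y = g' \<one> (X \<one>) (Y \<one>)"

lemma g'_ip: assumes "X \<in> LF" "Y \<in> LF" "p \<in> carrier G" shows "g' p (X p) (Y p) = ip X Y"
  using g'_inv LF_inv[OF assms(1), of p \<one>] LF_inv[OF assms(2), of p \<one>]
    LF_tangent[OF assms(1), of \<one>] LF_tangent[OF assms(2), of \<one>] assms(3)
  unfolding left_invariant_metric_def ip_def by (metis one_closed r_one)

lemma ip_ops:
  assumes X: "X \<in> LF" and Y: "Y \<in> LF" and Z: "Z \<in> LF"
  shows "ip (X + Y) Z = ip X Z + ip Y Z" "ip (fscale (\<lambda>_. c) X) Z = c * ip X Z" "ip X Y = ip Y X"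
    "ip X X \<ge> 0" "ip X X = 0 \<Longrightarrow> X = 0"
proof -
  note t = LF_tangent[OF X one_closed] LF_tangent[OF Y one_closed] LF_tangent[OF Z one_closed]
  have r: "(x \<noteq> 0 \<longrightarrow> g' \<one> x x > 0) \<and>
        (\<forall>y\<in>tangent_space A \<one>. g' \<one> x y = g' \<one> y x \<and>
           (\<forall>z\<in>tangent_space A \<one>. g' \<one> (x + y) z = g' \<one> x z + g' \<one> y z) \<and>
           (\<forall>c. g' \<one> (\<lambda>f. c * x f) y = c * g' \<one> x y))" if "x \<in> tangent_space A \<one>" for x
    using hermitian' that carrier_eq(1) one_closed unfolding hermitian_manifold_def riemannian_metric_def by blast
  have r1: "g' \<one> (X \<one> + Y \<one>) (Z \<one>) = g' \<one> (X \<one>) (Z \<one>) + g' \<one> (Y \<one>) (Z \<one>)"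
    "g' \<one> (\<lambda>f. c * X \<one> f) (Z \<one>) = c * g' \<one> (X \<one>) (Z \<one>)" "g' \<one> (X \<one>) (Y \<one>) = g' \<one> (Y \<one>) (X \<one>)"
    "X \<one> \<noteq> 0 \<Longrightarrow> g' \<one> (X \<one>) (X \<one>) > 0"
    using r[OF t(1)] t by blast+
  show "ip (X + Y) Z = ip X Z + ip Y Z" "ip (fscale (\<lambda>_. c) X) Z = c * ip X Z" "ip X Y = ip Y X"
    using r1 by (simp_all add: ip_def fscale_def)
  have "g' \<one> (\<lambda>f. 0 * X \<one> f) (X \<one>) = 0 * g' \<one> (X \<one>) (X \<one>)" using r[OF t(1)] t(1) by blast
  then have 0: "g' \<one> 0 0 = 0" if "X \<one> = 0" using that by (simp add: zero_fun_def)
  then show "ip X X \<ge> 0" using r1(4) by (cases "X \<one> = 0") (simp_all add: ip_def less_imp_le)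
  show "X = 0" if "ip X X = 0"
  proof -
    have "X \<one> = 0" using r1(4) that by (auto simp: ip_def)
    then have "ext (X \<one>) = 0" by (simp add: ext_def differential_eq fun_eq_iff)
    then show ?thesis using LF_ext[OF X] by simp
  qed
qed

text \<open>The invariant fields form an abstract inner product space. It is identified with a
  coordinate subspace of the chart space \<open>'v\<close>, where the metric is the standard inner
  product and the algebraic part applies.\<close>

theorem invariant_frame:
  "\<exists>(S :: 'v set) br j \<Phi>. subspace S \<and> bilinear br \<and> (\<forall>x y. br x y \<in> S) \<and> linear j \<and> (\<forall>x. j x \<in> S) \<and>
    (\<forall>x. \<Phi> x \<in> LF) \<and> (\<forall>x y. \<Phi> (x + y) = \<Phi> x + \<Phi> y) \<and> (\<forall>c x. \<Phi> (c *\<^sub>R x) = fscale (\<lambda>_. c) (\<Phi> x)) \<and>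
    (\<forall>x y. \<Phi> (br x y) = lie_bracket (\<Phi> x) (\<Phi> y)) \<and> (\<forall>x. \<Phi> (j x) = endo_app J' (\<Phi> x)) \<and>
    (\<forall>x\<in>S. \<forall>y\<in>S. ip (\<Phi> x) (\<Phi> y) = x \<bullet> y) \<and> (\<forall>X\<in>LF. \<exists>x\<in>S. \<Phi> x = X)"
proof -
  obtain ch0 where ch0: "ch0 \<in> A" "\<one> \<in> fst ch0" using chart_of_carrier[OF one_closed] by blast
  define \<Lambda> where "\<Lambda> \<xi> = ext (coord_tvec A ch0 \<one> \<xi>)" for \<xi>
  have \<Lambda>_LF: "\<Lambda> \<xi> \<in> LF" for \<xi>
    unfolding \<Lambda>_def using ext_LF tangent_space_chart[OF ch0] by blast
  have \<Lambda>_add: "\<Lambda> (\<xi> + \<eta>) = \<Lambda> \<xi> + \<Lambda> \<eta>" for \<xi> \<eta>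
    by (simp add: \<Lambda>_def ext_def coord_tvec_add[OF ch0] differential_add fun_eq_iff)
  have \<Lambda>_scale: "\<Lambda> (c *\<^sub>R \<xi>) = fscale (\<lambda>_. c) (\<Lambda> \<xi>)" for c \<xi>
    by (simp add: \<Lambda>_def ext_def coord_tvec_scale[OF ch0] differential_scale fscale_def fun_eq_iff)
  have \<Lambda>_surj: "\<exists>\<xi>. \<Lambda> \<xi> = X" if "X \<in> LF" for X
  proof -
    obtain \<xi> where "X \<one> = coord_tvec A ch0 \<one> \<xi>"
      using LF_tangent[OF \<open>X \<in> LF\<close> one_closed] tangent_space_chart[OF ch0] by blast
    then show ?thesis using LF_ext[OF that] unfolding \<Lambda>_def by metis
  qed
  define q where "q \<xi> \<eta> = ip (\<Lambda> \<xi>) (\<Lambda> \<eta>)" for \<xi> \<eta>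
  have q: "q (x + y) z = q x z + q y z" "q (c *\<^sub>R x) z = c * q x z" "q x y = q y x" "q x x \<ge> 0" for x y z c
    unfolding q_def \<Lambda>_add \<Lambda>_scale using ip_ops[OF \<Lambda>_LF \<Lambda>_LF \<Lambda>_LF] by blast+
  have q_null: "q x y = 0" if "q x x = 0" for x y
    by (rule psd_null[of q]) (use q that in blast)+
  obtain E where E: "finite E" "card E \<le> card (Basis :: 'v set)"
    "\<forall>e\<in>E. \<forall>d\<in>E. q e d = (if e = d then 1 else 0)"
    "\<forall>x\<in>Basis. q (x - (\<Sum>e\<in>E. q x e *\<^sub>R e)) (x - (\<Sum>e\<in>E. q x e *\<^sub>R e)) = 0"
    using gram_schmidt_degenerate[of q "Basis :: 'v set", OF q(1,2,3) q_null q(4) finite_Basis] by blast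
  \<comment> \<open>Distinct standard basis vectors are assigned to the members of \<open>E\<close>;
    \<open>\<theta>\<close> sends them back.\<close>
  obtain b where b: "b ` E \<subseteq> (Basis :: 'v set)" "inj_on b E"
    using card_le_inj[OF E(1) finite_Basis E(2)] by blast
  have bb: "b e \<bullet> b d = (if e = d then 1 else 0)" if "e \<in> E" "d \<in> E" for e d
  proof -
    have "b e \<in> Basis" "b d \<in> Basis" using b(1) that by blast+
    then show ?thesis using inner_Basis[of "b e" "b d"] inj_on_eq_iff[OF b(2) that] by simp
  qed
  define \<theta> where "\<theta> x = (\<Sum>e\<in>E. (x \<bullet> b e) *\<^sub>R e)" for x
  define S where "S = span (b ` E)"
  \<comment> \<open>The coordinates of a field in the orthonormal family; on invariant fields this
    is a right inverse of \<open>\<Phi>\<close>.\<close>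
  define \<Psi> where "\<Psi> X = (\<Sum>e\<in>E. ip X (\<Lambda> e) *\<^sub>R b e)" for X
  define \<Phi> where "\<Phi> x = \<Lambda> (\<theta> x)" for x
  have \<theta>: "\<theta> (x + y) = \<theta> x + \<theta> y" "\<theta> (c *\<^sub>R x) = c *\<^sub>R \<theta> x" for x y c
    by (simp_all add: \<theta>_def inner_simps algebra_simps sum.distrib scaleR_sum_right)
  have \<Phi>: "\<Phi> x \<in> LF" "\<Phi> (x + y) = \<Phi> x + \<Phi> y" "\<Phi> (c *\<^sub>R x) = fscale (\<lambda>_. c) (\<Phi> x)" for x y c
    unfolding \<Phi>_def \<theta> by (rule \<Lambda>_LF, rule \<Lambda>_add, rule \<Lambda>_scale)
  have \<Psi>_S: "\<Psi> X \<in> S" for X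
    unfolding \<Psi>_def S_def by (intro span_sum span_scale span_base) auto
  have \<Psi>_lin: "\<Psi> (X + Y) = \<Psi> X + \<Psi> Y" "\<Psi> (fscale (\<lambda>_. c) X) = c *\<^sub>R \<Psi> X" if "X \<in> LF" "Y \<in> LF" for X Y c
    unfolding \<Psi>_def ip_ops(1,2)[OF that \<Lambda>_LF]
    by (simp_all add: scaleR_add_left sum.distrib scaleR_sum_right)
  have \<theta>\<Psi>: "\<theta> (\<Psi> X) = (\<Sum>e\<in>E. ip X (\<Lambda> e) *\<^sub>R e)" for X
  proof -
    have "\<Psi> X \<bullet> b d = (\<Sum>e\<in>E. ip X (\<Lambda> e) * (b e \<bullet> b d))" if "d \<in> E" for d
      by (simp add: \<Psi>_def inner_sum_left)
    also have "\<dots> d = ip X (\<Lambda> d)" if "d \<in> E" for d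
    proof -
      have "(\<Sum>e\<in>E. ip X (\<Lambda> e) * (b e \<bullet> b d)) = (\<Sum>e\<in>E. if e = d then ip X (\<Lambda> e) else 0)"
        using bb that by (intro sum.cong) auto
      then show ?thesis using that E(1) by simp
    qed
    finally show ?thesis unfolding \<theta>_def by (intro sum.cong) auto
  qed
  \<comment> \<open>\<open>E\<close> spans only up to the null space of \<open>q\<close>. That
    suffices, because \<open>ip\<close> is definite on fields and \<open>\<Lambda>\<close> therefore
    annihilates this null space.\<close>
  have res: "\<Lambda> x = \<Lambda> (\<Sum>e\<in>E. q x e *\<^sub>R e)" for x
  proof -
    define r where "r x = x - (\<Sum>e\<in>E. q x e *\<^sub>R e)" for x
    have r: "r (x + y) = r x + r y" "r (c *\<^sub>R x) = c *\<^sub>R r x" for x y c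
      by (simp_all add: r_def q(1,2) algebra_simps sum.distrib scaleR_sum_right)
    have lin: "linear r" by (rule linearI) (use r in auto)
    have qr: "q (r x) y = 0" if "x \<in> Basis" for x y using q_null E(4) that unfolding r_def by blast
    have q0: "q 0 y = 0" for y using q(2)[of 0 0 y] by simp
    have qsum: "q (\<Sum>e\<in>F. f e) z = (\<Sum>e\<in>F. q (f e) z)" for F :: "'v set" and f z
      by (induction F rule: infinite_finite_induct) (simp_all add: q0 q(1))
    have "q (r x) (r x) = 0"
      unfolding linear_expand[OF lin, of x] qsum q(2) by (simp add: qr)
    then have "\<Lambda> (r x) = 0" using ip_ops(5)[OF \<Lambda>_LF \<Lambda>_LF \<Lambda>_LF] unfolding q_def by blast
    moreover have "\<Lambda> x = \<Lambda> (r x) + \<Lambda> (\<Sum>e\<in>E. q x e *\<^sub>R e)" unfolding \<Lambda>_add[symmetric] by (simp add: r_def)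
    ultimately show ?thesis by simp
  qed
  have \<Phi>\<Psi>: "\<Phi> (\<Psi> X) = X" if "X \<in> LF" for X
  proof -
    obtain x where x: "\<Lambda> x = X" using \<Lambda>_surj[OF \<open>X \<in> LF\<close>] by blast
    show ?thesis unfolding \<Phi>_def \<theta>\<Psi> using res[of x] unfolding q_def x by simp
  qed
  have inner: "ip (\<Phi> x) (\<Phi> y) = x \<bullet> y" if "x \<in> S" "y \<in> S" for x y
  proof -
    have q0: "q 0 y = 0" for y using q(2)[of 0 0 y] by simp
    have qsum: "q (\<Sum>e\<in>F. f e) z = (\<Sum>e\<in>F. q (f e) z)" for F :: "'v set" and f z
      by (induction F rule: infinite_finite_induct) (simp_all add: q0 q(1))
    have q\<theta>: "q (\<theta> x) d = x \<bullet> b d" if "d \<in> E" for x d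
    proof -
      have "(\<Sum>e\<in>E. (x \<bullet> b e) * q e d) = (\<Sum>e\<in>E. if e = d then x \<bullet> b e else 0)"
        using E(3) that by (intro sum.cong) auto
      then show ?thesis unfolding \<theta>_def qsum q(2) using that E(1) by simp
    qed
    have e: "ip (\<Phi> x) (\<Phi> y) = (\<Sum>e\<in>E. (x \<bullet> b e) * (y \<bullet> b e))"
    proof -
      have "ip (\<Phi> x) (\<Phi> y) = q (\<theta> x) (\<theta> y)" by (simp add: q_def \<Phi>_def)
      also have "\<dots> = (\<Sum>e\<in>E. (x \<bullet> b e) * q e (\<theta> y))" unfolding \<theta>_def[of x] qsum q(2) ..
      also have "\<dots> = (\<Sum>e\<in>E. (x \<bullet> b e) * (y \<bullet> b e))" using q\<theta> q(3) by (intro sum.cong) auto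
      finally show ?thesis .
    qed
    have "(\<Sum>c\<in>b ` E. (x \<bullet> c) *\<^sub>R c) = x"
      by (rule orthonormal_basis_expand)
        (use \<open>x \<in> S\<close> E(1) bb b(1) in \<open>auto simp: S_def pairwise_def orthogonal_def\<close>)
    then have "x \<bullet> y = (\<Sum>c\<in>b ` E. (x \<bullet> c) *\<^sub>R c) \<bullet> y" by simp
    also have "\<dots> = (\<Sum>e\<in>E. (x \<bullet> b e) * (y \<bullet> b e))"
      unfolding inner_sum_left sum.reindex[OF b(2)] by (simp add: inner_commute[of y])
    finally show ?thesis using e by simp
  qed
  define br where "br x y = \<Psi> (lie_bracket (\<Phi> x) (\<Phi> y))" for x y
  define j where "j x = \<Psi> (endo_app J' (\<Phi> x))" for x
  have lbl: "lie_bracket (\<Phi> x + \<Phi> y) (\<Phi> z) = lie_bracket (\<Phi> x) (\<Phi> z) + lie_bracket (\<Phi> y) (\<Phi> z)"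
    "lie_bracket (\<Phi> z) (\<Phi> x + \<Phi> y) = lie_bracket (\<Phi> z) (\<Phi> x) + lie_bracket (\<Phi> z) (\<Phi> y)"
    "lie_bracket (\<Phi> z) (fscale (\<lambda>_. c) (\<Phi> x)) = fscale (\<lambda>_. c) (lie_bracket (\<Phi> z) (\<Phi> x))" for x y z c
    by (intro bracket_add_left bracket_add_right bracket_const_right LF_vf \<Phi>)+
  have lbs: "lie_bracket (fscale (\<lambda>_. c) (\<Phi> x)) (\<Phi> z) = fscale (\<lambda>_. c) (lie_bracket (\<Phi> x) (\<Phi> z))" for x z c
    unfolding bracket_anti[of _ "\<Phi> z"] lbl by (simp add: fscale_def fun_eq_iff)
  note brLF = LF_bracket[OF \<Phi>(1) \<Phi>(1)]
  have "bilinear br"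
    unfolding bilinear_def
  proof (intro conjI allI linearI)
    show "br z (x + y) = br z x + br z y" "br (x + y) z = br x z + br y z" for x y z
      unfolding br_def \<Phi> lbl by (rule \<Psi>_lin(1)[OF brLF brLF])+
    show "br z (c *\<^sub>R x) = c *\<^sub>R br z x" "br (c *\<^sub>R x) z = c *\<^sub>R br x z" for x z c
      unfolding br_def \<Phi> lbl lbs by (rule \<Psi>_lin(2)[OF brLF brLF])+
  qed
  moreover have "linear j"
  proof (rule linearI)
    show "j (x + y) = j x + j y" for x y
      unfolding j_def \<Phi> J'_add[OF \<Phi>(1) \<Phi>(1)] by (rule \<Psi>_lin(1)[OF LF_J'[OF \<Phi>(1)] LF_J'[OF \<Phi>(1)]])
    show "j (c *\<^sub>R x) = c *\<^sub>R j x" for c x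
      unfolding j_def \<Phi> J'_scale[OF \<Phi>(1)] by (rule \<Psi>_lin(2)[OF LF_J'[OF \<Phi>(1)] LF_J'[OF \<Phi>(1)]])
  qed
  moreover have "\<Phi> (br x y) = lie_bracket (\<Phi> x) (\<Phi> y)" "\<Phi> (j x) = endo_app J' (\<Phi> x)" for x y
    unfolding br_def j_def by (rule \<Phi>\<Psi>[OF brLF], rule \<Phi>\<Psi>[OF LF_J'[OF \<Phi>(1)]])
  moreover have "subspace S" unfolding S_def by simp
  moreover have "br x y \<in> S" "j x \<in> S" for x y unfolding br_def j_def by (rule \<Psi>_S)+
  moreover have "\<exists>x\<in>S. \<Phi> x = X" if "X \<in> LF" for X using \<Phi>\<Psi>[OF that] \<Psi>_S by blast
  ultimately show ?thesis using \<Phi> inner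
    by (intro exI[of _ S] exI[of _ br] exI[of _ j] exI[of _ \<Phi>] conjI allI ballI) blast+
qed

end

section \<open>The quotient\<close>

locale lie_quotient = herm_group G T A J' g'
  for G :: "('g, 'b) monoid_scheme" (structure) and T :: "'g topology" and A :: "('g, 'v::euclidean_space) chart set"
    and J' :: "'g endo_field" and g' :: "'g metric_field" +
  fixes \<Gamma> :: "'g set" and J :: "'g set endo_field" and g :: "'g set metric_field"
  assumes subgroup: "subgroup \<Gamma> G"
    and hermitian_quotient:
      "hermitian_manifold (left_quotient_topology G T \<Gamma>) (left_quotient_atlas G T A \<Gamma>) J g"
    and lift: "p \<in> carrier G \<Longrightarrow> x \<in> tangent_space A p \<Longrightarrow>
      differential (left_quotient_atlas G T A \<Gamma>) (coset_proj G \<Gamma>) (J' p x) =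
        J (coset_proj G \<Gamma> p) (differential (left_quotient_atlas G T A \<Gamma>) (coset_proj G \<Gamma>) x)"
    and lift_metric: "p \<in> carrier G \<Longrightarrow> x \<in> tangent_space A p \<Longrightarrow> y \<in> tangent_space A p \<Longrightarrow>
      g' p x y = g (coset_proj G \<Gamma> p) (differential (left_quotient_atlas G T A \<Gamma>) (coset_proj G \<Gamma>) x)
        (differential (left_quotient_atlas G T A \<Gamma>) (coset_proj G \<Gamma>) y)"
begin

abbreviation \<pi> where "\<pi> \<equiv> coset_proj G \<Gamma>"
abbreviation Q where "Q \<equiv> left_quotient_topology G T \<Gamma>"
abbreviation M where "M \<equiv> left_quotient_atlas G T A \<Gamma>"
abbreviation d\<pi> where "d\<pi> \<equiv> differential M \<pi>"

sublocale QM: smooth_mfd Q M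
  using hermitian_quotient by unfold_locales (simp add: hermitian_manifold_def)

lemma mcarrier_M: "mcarrier M = \<pi> ` carrier G"
proof -
  have "quotient_map T Q \<pi>" by (rule quotient_map_quotient_topology)
  from quotient_imp_surjective_map[OF this] show ?thesis using QM.topspace_carrier carrier_eq by simp
qed

lemma \<pi>_mult: assumes "h \<in> \<Gamma>" "a \<in> carrier G" shows "\<pi> (h \<otimes> a) = \<pi> a"
proof -
  have "h \<otimes> a \<in> \<Gamma> #> a" using assms by (auto simp: r_coset_def)
  then show ?thesis using repr_independence[OF _ assms(2) subgroup] by simp
qed

lemma \<pi>_eq: assumes "a \<in> carrier G" "b \<in> carrier G" "\<pi> a = \<pi> b" shows "\<exists>h\<in>\<Gamma>. b = h \<otimes> a"
proof -
  have "b \<in> \<Gamma> #> a" using rcos_self[OF assms(2) subgroup] assms(3) by simp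
  then show ?thesis by (auto simp: r_coset_def)
qed

lemma \<Gamma>_carrier: "h \<in> \<Gamma> \<Longrightarrow> h \<in> carrier G"
  using subgroup.mem_carrier[OF subgroup] .

definition qch :: "'g set \<Rightarrow> ('g, 'v) chart \<Rightarrow> ('g set, 'v) chart" where
  "qch V ch = (\<pi> ` V, snd ch \<circ> inv_into V \<pi>)"

lemma qch_cases:
  assumes "ch' \<in> M"
  shows "\<exists>ch\<in>A. \<exists>V. ch' = qch V ch \<and> V \<subseteq> fst ch \<and> openin T V \<and> inj_on \<pi> V"
proof -
  obtain U V \<phi> where "ch' = (\<pi> ` V, \<phi> \<circ> inv_into V \<pi>)" "(U, \<phi>) \<in> A" "V \<subseteq> U" "openin T V" "inj_on \<pi> V"
    using assms unfolding quotient_atlas_def by blast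
  then show ?thesis unfolding qch_def by (intro bexI[of _ "(U, \<phi>)"] exI[of _ V]) auto
qed

lemma left_mult_continuous: assumes "a \<in> carrier G" shows "continuous_map T T (\<lambda>x. a \<otimes> x)"
proof -
  have m: "continuous_map (prod_topology T T) T (\<lambda>(a, b). a \<otimes> b)"
    using lie_group by (simp add: lie_group_def smooth_map_def)
  have "continuous_map T (prod_topology T T) (\<lambda>x. (a, x))"
    using assms carrier_eq by (simp add: continuous_map_paired)
  from continuous_map_compose[OF this m] show ?thesis by (simp add: o_def)
qed

text \<open>The given charts of the quotient make \<open>\<pi>\<close> injective near some point of each fibre, hence,
  by translation, near every point.\<close>

lemma local_section:
  assumes ch: "ch \<in> A" and p: "p \<in> fst ch"
  shows "\<exists>V. openin T V \<and> p \<in> V \<and> V \<subseteq> fst ch \<and> inj_on \<pi> V"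
proof -
  have pG: "p \<in> carrier G" by (rule fst_in_carrier[OF ch p])
  have "\<pi> p \<in> mcarrier M" using pG mcarrier_M by simp
  then obtain ch1 where ch1: "ch1 \<in> M" "\<pi> p \<in> fst ch1" using QM.chart_of by blast
  obtain ch2 V1 where V1: "ch1 = qch V1 ch2" "openin T V1" "inj_on \<pi> V1" using qch_cases[OF ch1(1)] by blast
  then obtain p1 where p1: "p1 \<in> V1" "\<pi> p1 = \<pi> p" using ch1(2) by (auto simp: qch_def)
  have V1G: "V1 \<subseteq> carrier G" using openin_subset[OF V1(2)] carrier_eq by simp
  have p1G: "p1 \<in> carrier G" using V1G p1(1) by (rule subsetD)
  obtain h where h: "h \<in> \<Gamma>" "p = h \<otimes> p1" using \<pi>_eq[OF p1G pG p1(2)] by blast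
  have hG: "h \<in> carrier G" "inv h \<in> \<Gamma>" "inv h \<in> carrier G"
    using h(1) \<Gamma>_carrier subgroup.m_inv_closed[OF subgroup h(1)] by auto
  let ?V = "{x \<in> topspace T. inv h \<otimes> x \<in> V1} \<inter> fst ch"
  have "openin T ?V"
    by (intro openin_Int openin_continuous_map_preimage[OF left_mult_continuous[OF hG(3)] V1(2)] is_chart_ch(1)[OF ch])
  moreover have "p \<in> ?V"
    using p pG p1 p1G h(2) hG carrier_eq by (simp add: m_assoc[symmetric])
  moreover have "inj_on \<pi> ?V"
  proof (rule inj_onI)
    fix x y assume x: "x \<in> ?V" and y: "y \<in> ?V" and e: "\<pi> x = \<pi> y"
    have G: "x \<in> carrier G" "y \<in> carrier G" using x y carrier_eq by simp_all
    have "\<pi> (inv h \<otimes> x) = \<pi> (inv h \<otimes> y)" using \<pi>_mult[OF hG(2)] G e by simp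
    then have "inv h \<otimes> x = inv h \<otimes> y" using inj_onD[OF V1(3)] x y by simp
    then show "x = y" using G hG by simp
  qed
  ultimately show ?thesis by blast
qed

context
  fixes ch V assumes ch: "ch \<in> A" and V: "openin T V" "V \<subseteq> fst ch" "inj_on \<pi> V"
begin

lemma qch_M: "qch V ch \<in> M"
proof -
  have "(fst ch, snd ch) \<in> A" using ch by simp
  then show ?thesis using V unfolding quotient_atlas_def qch_def by blast
qed

lemma qch_at: "v \<in> V \<Longrightarrow> \<pi> v \<in> fst (qch V ch)" "v \<in> V \<Longrightarrow> snd (qch V ch) (\<pi> v) = snd ch v"
  using inv_into_f_f[OF V(3)] by (simp_all add: qch_def)

lemma qch_loc: assumes "y \<in> snd ch ` V" shows "loc (qch V ch) f y = loc ch (\<lambda>p. f (\<pi> p)) y"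
proof -
  obtain v where v: "v \<in> V" "y = snd ch v" using assms by blast
  have "loc (qch V ch) f y = f (\<pi> v)"
    using QM.loc_at[OF qch_M qch_at(1)[OF v(1)], of f] qch_at(2)[OF v(1)] v(2) by simp
  also have "\<dots> = loc ch (\<lambda>p. f (\<pi> p)) y"
    using loc_at[OF ch subsetD[OF V(2) v(1)], of "\<lambda>p. f (\<pi> p)"] v(2) by simp
  finally show ?thesis .
qed

lemma qch_im: "im (qch V ch) = snd ch ` V"
  using qch_at(2) by (force simp: im_def qch_def)

end

text \<open>In the charts \<open>ch\<close> and \<open>qch V ch\<close> the projection is the
  identity, and \<open>local_section\<close> provides such a \<open>V\<close> around every
  point.\<close>

lemma pullback_smooth: assumes f: "smooth_fun M f" shows "smooth_fun A (\<lambda>p. f (\<pi> p))"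
  unfolding smooth_fun_loc
proof (intro ballI smooth_on_local)
  fix ch y assume ch: "ch \<in> A" and "y \<in> im ch"
  then obtain p where p: "p \<in> fst ch" "y = snd ch p" by (auto simp: im_def)
  obtain V where V: "openin T V" "V \<subseteq> fst ch" "inj_on \<pi> V" "p \<in> V" using local_section[OF ch p(1)] by blast
  have o: "open (snd ch ` V)" by (rule open_image_ch[OF ch V(1,2)])
  have s: "smooth_on (snd ch ` V) (loc (qch V ch) f)"
    using QM.loc_smooth[OF qch_M[OF ch V(1-3)] f] unfolding qch_im[OF ch V(1-3)] .
  have "smooth_on (snd ch ` V) (loc ch (\<lambda>p. f (\<pi> p)))"
    by (rule smooth_on_cong[OF o _ s]) (rule qch_loc[OF ch V(1-3)])
  then show "\<exists>T. open T \<and> y \<in> T \<and> smooth_on T (loc ch (\<lambda>p. f (\<pi> p)))"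
    using o p(2) V(4) by blast
qed

lemma d\<pi>_coord:
  assumes ch: "ch \<in> A" and V: "openin T V" "V \<subseteq> fst ch" "inj_on \<pi> V" and v: "v \<in> V"
  shows "d\<pi> (coord_tvec A ch v \<xi>) = coord_tvec M (qch V ch) (\<pi> v) \<xi>"
proof
  fix f
  show "d\<pi> (coord_tvec A ch v \<xi>) f = coord_tvec M (qch V ch) (\<pi> v) \<xi> f"
  proof (cases "smooth_fun M f")
    case True
    have o: "open (snd ch ` V)" by (rule open_image_ch[OF ch V(1,2)])
    have vV: "snd ch v \<in> snd ch ` V" using v by blast
    have d: "loc ch (\<lambda>p. f (\<pi> p)) differentiable (at (snd ch v))"
      by (rule loc_differentiable[OF ch pullback_smooth[OF True] subsetD[OF V(2) v]])
    have e: "loc ch (\<lambda>p. f (\<pi> p)) y = loc (qch V ch) f y" if "y \<in> snd ch ` V" for y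
      using qch_loc[OF ch V that, of f] by simp
    have "fder (loc (qch V ch) f) (snd ch v) = fder (loc ch (\<lambda>p. f (\<pi> p))) (snd ch v)"
      by (rule fder_cong(1)[OF o vV e d])
    then show ?thesis
      using True pullback_smooth[OF True] qch_at(2)[OF ch V v] by (simp add: differential_eq coord_tvec_loc)
  qed (simp add: differential_eq coord_tvec_loc)
qed

text \<open>A point of the fibre is chosen arbitrarily. For left-invariant \<open>X\<close> the
  choice does not matter, since points of a fibre differ by left translation with an element of
  \<open>\<Gamma>\<close>.\<close>

definition push :: "'g vfield \<Rightarrow> 'g set vfield" where
  "push X = (\<lambda>q. if q \<in> mcarrier M then d\<pi> (X (SOME p. p \<in> carrier G \<and> \<pi> p = q)) else 0)"

lemma push_at: assumes X: "X \<in> LF" and p: "p \<in> carrier G" shows "push X (\<pi> p) = d\<pi> (X p)"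
proof -
  define p' where "p' = (SOME p'. p' \<in> carrier G \<and> \<pi> p' = \<pi> p)"
  have p': "p' \<in> carrier G \<and> \<pi> p' = \<pi> p" unfolding p'_def by (rule someI[of _ p]) (use p in simp)
  then obtain h where h: "h \<in> \<Gamma>" "p = h \<otimes> p'" using \<pi>_eq[of p' p] p by blast
  have hG: "h \<in> carrier G" by (rule \<Gamma>_carrier[OF h(1)])
  have "d\<pi> (X p) f = d\<pi> (X p') f" for f
  proof (cases "smooth_fun M f")
    case True
    have "X p (\<lambda>q. f (\<pi> q)) = X p' (\<lambda>q. f (\<pi> (h \<otimes> q)))"
      unfolding h(2) LF_inv[OF X hG conjunct1[OF p']] using pullback_smooth[OF True] by (simp add: differential_eq)
    also have "\<dots> = X p' (\<lambda>q. f (\<pi> q))"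
      by (rule vf_ops(1)[OF LF_vf[OF X]]) (use \<pi>_mult[OF h(1)] carrier_eq in simp)
    finally show ?thesis by (simp add: differential_eq)
  qed (simp add: differential_eq)
  moreover have "\<pi> p \<in> mcarrier M" using p mcarrier_M by simp
  ultimately show ?thesis unfolding push_def p'_def[symmetric] by (simp add: fun_eq_iff)
qed

lemma push_outside: "q \<notin> mcarrier M \<Longrightarrow> push X q = 0"
  by (simp add: push_def)

lemma push_eqI:
  assumes X: "X \<in> LF" and Y: "\<And>q. q \<notin> mcarrier M \<Longrightarrow> Y q = 0" "\<And>p. p \<in> carrier G \<Longrightarrow> Y (\<pi> p) = d\<pi> (X p)"
  shows "push X = Y"
proof
  fix q show "push X q = Y q"
    using push_at[OF X] Y push_outside[of q X] mcarrier_M by (cases "q \<in> mcarrier M") auto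
qed

lemma push_add: assumes "X \<in> LF" "Y \<in> LF" shows "push (X + Y) = push X + push Y"
  by (rule push_eqI[OF LF_add[OF assms]]) (simp_all add: push_outside push_at assms differential_add)

lemma push_scale: assumes "X \<in> LF" shows "push (fscale (\<lambda>_. c) X) = fscale (\<lambda>_. c) (push X)"
proof (rule push_eqI[OF LF_scale[OF assms]])
  show "fscale (\<lambda>_. c) (push X) q = 0" if "q \<notin> mcarrier M" for q
    using push_outside[OF that, of X] by (simp add: fscale_def zero_fun_def)
  show "fscale (\<lambda>_. c) (push X) (\<pi> p) = d\<pi> (fscale (\<lambda>_. c) X p)" if "p \<in> carrier G" for p
    by (simp add: fscale_def push_at[OF assms that] differential_scale)
qed

lemma push_vf: assumes X: "X \<in> LF" shows "push X \<in> vector_fields M"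
proof (rule QM.vfI)
  fix ch' assume "ch' \<in> M"
  then obtain ch V where ch: "ch \<in> A" "ch' = qch V ch" and V: "openin T V" "V \<subseteq> fst ch" "inj_on \<pi> V"
    using qch_cases by blast
  obtain \<xi> where \<xi>: "smooth_on (im ch) \<xi>" "\<And>p. p \<in> fst ch \<Longrightarrow> X p = coord_tvec A ch p (\<xi> (snd ch p))"
    using vf_chart[OF LF_vf[OF X] ch(1)] by blast
  have "smooth_on (im ch') \<xi>"
    unfolding ch(2) qch_im[OF ch(1) V] by (rule smooth_on_subset[OF \<xi>(1)]) (use V(2) in \<open>auto simp: im_def\<close>)
  moreover have "push X q = coord_tvec M ch' q (\<xi> (snd ch' q))" if "q \<in> fst ch'" for q
  proof -
    obtain v where v: "v \<in> V" "q = \<pi> v" using \<open>q \<in> fst ch'\<close> ch(2) by (auto simp: qch_def)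
    have vc: "v \<in> fst ch" by (rule subsetD[OF V(2) v(1)])
    show ?thesis
      unfolding v(2) push_at[OF X fst_in_carrier[OF ch(1) vc]] \<xi>(2)[OF vc] d\<pi>_coord[OF ch(1) V v(1)] ch(2)
        qch_at(2)[OF ch(1) V v(1)] ..
  qed
  ultimately show "\<exists>\<xi>. smooth_on (im ch') \<xi> \<and> (\<forall>p\<in>fst ch'. push X p = coord_tvec M ch' p (\<xi> (snd ch' p)))"
    by blast
qed (rule push_outside)

text \<open>Pulling back functions along \<open>\<pi>\<close> intertwines \<open>push U\<close> with
  \<open>U\<close>, so the commutators correspond as well.\<close>

lemma push_bracket:
  assumes X: "X \<in> LF" and Y: "Y \<in> LF" shows "push (lie_bracket X Y) = lie_bracket (push X) (push Y)"
proof (rule push_eqI[OF LF_bracket[OF X Y]])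
  note vf = QM.vf_bracket[OF push_vf[OF X] push_vf[OF Y]]
  show "lie_bracket (push X) (push Y) q = 0" if "q \<notin> mcarrier M" for q by (rule QM.vf_outside[OF vf that])
  fix p assume p: "p \<in> carrier G"
  show "lie_bracket (push X) (push Y) (\<pi> p) = d\<pi> (lie_bracket X Y p)"
  proof
    fix f
    show "lie_bracket (push X) (push Y) (\<pi> p) f = d\<pi> (lie_bracket X Y p) f"
    proof (cases "smooth_fun M f")
      case True
      have *: "push U (\<pi> p) (vderiv (push Z) f) = U p (vderiv Z (\<lambda>q. f (\<pi> q)))" if UZ: "U \<in> LF" "Z \<in> LF" for U Z
      proof -
        have "push U (\<pi> p) (vderiv (push Z) f) = U p (\<lambda>q. vderiv (push Z) f (\<pi> q))"
          using push_at[OF UZ(1) p] QM.smooth_vderiv[OF push_vf[OF UZ(2)]] by (simp add: differential_eq)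
        also have "\<dots> = U p (vderiv Z (\<lambda>q. f (\<pi> q)))"
          by (rule vf_ops(1)[OF LF_vf[OF UZ(1)]])
            (use push_at[OF UZ(2)] True carrier_eq in \<open>simp add: vderiv_def differential_eq\<close>)
        finally show ?thesis .
      qed
      show ?thesis using True by (simp add: lie_bracket_def differential_eq *[OF X Y] *[OF Y X])
    next
      case False
      then show ?thesis using QM.vf_ops(2)[OF vf] by (simp add: differential_eq)
    qed
  qed
qed

lemma push_metric:
  assumes "X \<in> LF" "Y \<in> LF" "q \<in> mcarrier M" shows "g q (push X q) (push Y q) = ip X Y"
proof -
  obtain p where p: "p \<in> carrier G" "q = \<pi> p" using assms(3) mcarrier_M by blast
  show ?thesis
    unfolding p(2) push_at[OF assms(1) p(1)] push_at[OF assms(2) p(1)] g'_ip[OF assms(1,2) p(1), symmetric]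
    by (rule lift_metric[OF p(1) LF_tangent[OF assms(1) p(1)] LF_tangent[OF assms(2) p(1)], symmetric])
qed

lemma push_surj: assumes t: "t \<in> tangent_space M q" shows "\<exists>X\<in>LF. push X q = t"
proof -
  obtain ch' \<xi> where ch': "ch' \<in> M" "q \<in> fst ch'" "t = coord_tvec M ch' q \<xi>" using QM.tangent_spaceE[OF t] by blast
  obtain ch V where ch: "ch \<in> A" "ch' = qch V ch" and V: "openin T V" "V \<subseteq> fst ch" "inj_on \<pi> V"
    using qch_cases[OF ch'(1)] by blast
  obtain v where v: "v \<in> V" "q = \<pi> v" using ch'(2) ch(2) by (auto simp: qch_def)
  have vc: "v \<in> fst ch" by (rule subsetD[OF V(2) v(1)])
  have vG: "v \<in> carrier G" by (rule fst_in_carrier[OF ch(1) vc])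
  have "coord_tvec A ch v \<xi> \<in> tangent_space A v" using tangent_space_chart[OF ch(1) vc] by blast
  then obtain X where X: "X \<in> LF" "X v = coord_tvec A ch v \<xi>" using LF_surj[OF vG] by blast
  have "push X q = t"
    unfolding v(2) push_at[OF X(1) vG] X(2) d\<pi>_coord[OF ch(1) V v(1)] ch'(3) ch(2) ..
  then show ?thesis using X(1) by blast
qed

text \<open>Two maps are combined: \<open>\<Phi>\<close> transports solvability and the condition on
  the commutator from the invariant fields to \<open>S\<close>, while its composition with
  \<open>push\<close> is the frame of the quotient in which the curvature is computed.\<close>

theorem constant_hol_sect_curv_flat:
  assumes solv: "solvable_lie_algebra LF"
    and J': "endo_app J' ` commutator_space LF LF = commutator_space LF LF"
    and chern: "chern_connection M J g nabla" and const: "const_hol_sect_curv M J g nabla c"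
  shows "flat_connection M g nabla"
proof -
  obtain S :: "'v set" and br j \<Phi> where S: "subspace S" and br: "bilinear br" "\<forall>x y. br x y \<in> S"
    and j: "linear j" "\<forall>x. j x \<in> S" and \<Phi>: "\<forall>x. \<Phi> x \<in> LF" "\<forall>x y. \<Phi> (x + y) = \<Phi> x + \<Phi> y"
      "\<forall>c x. \<Phi> (c *\<^sub>R x) = fscale (\<lambda>_. c) (\<Phi> x)"
    and \<Phi>_br: "\<forall>x y. \<Phi> (br x y) = lie_bracket (\<Phi> x) (\<Phi> y)" and \<Phi>_j: "\<forall>x. \<Phi> (j x) = endo_app J' (\<Phi> x)"
    and inner: "\<forall>x\<in>S. \<forall>y\<in>S. ip (\<Phi> x) (\<Phi> y) = x \<bullet> y" and surj: "\<forall>X\<in>LF. \<exists>x\<in>S. \<Phi> x = X"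
    using invariant_frame by (elim exE conjE) (rule that)
  interpret QC: chern_manifold Q M J g nabla
    by unfold_locales (rule hermitian_quotient, rule chern)
  interpret F: chern_frame Q M J g nabla S br j "\<lambda>x. push (\<Phi> x)"
  proof unfold_locales
    show "mcarrier M \<noteq> {}" unfolding mcarrier_M using one_closed by blast
    show "push (\<Phi> x) \<in> vector_fields M" for x using push_vf \<Phi>(1) by blast
    show "push (\<Phi> (x + y)) = push (\<Phi> x) + push (\<Phi> y)" for x y using push_add \<Phi> by simp
    show "push (\<Phi> (c *\<^sub>R x)) = fscale (\<lambda>_. c) (push (\<Phi> x))" for c x using push_scale \<Phi> by simp
    show "push (\<Phi> (br x y)) = lie_bracket (push (\<Phi> x)) (push (\<Phi> y))" for x y using push_bracket \<Phi>(1) \<Phi>_br by simp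
    show "push (\<Phi> (j x)) = endo_app J (push (\<Phi> x))" for x
    proof -
      have X: "\<Phi> x \<in> LF" using \<Phi>(1) by blast
      show ?thesis
        unfolding \<Phi>_j[rule_format]
      proof (rule push_eqI[OF LF_J'[OF X]])
        show "endo_app J (push (\<Phi> x)) q = 0" if "q \<notin> mcarrier M" for q
          by (rule QM.vf_outside[OF QC.JV_vf[OF push_vf[OF X]] that])
        show "endo_app J (push (\<Phi> x)) (\<pi> p) = d\<pi> (endo_app J' (\<Phi> x) p)" if "p \<in> carrier G" for p
          using lift[OF that LF_tangent[OF X that]] push_at[OF X that] by (simp add: endo_app_def)
      qed
    qed
    show "g p (push (\<Phi> x) p) (push (\<Phi> y) p) = x \<bullet> y" if "x \<in> S" "y \<in> S" "p \<in> mcarrier M" for x y p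
      using push_metric[OF _ _ that(3)] \<Phi>(1) inner that by simp
    show "\<exists>x\<in>S. push (\<Phi> x) p = t" if t: "t \<in> tangent_space M p" for p t
    proof -
      obtain X where X: "X \<in> LF" "push X p = t" using push_surj[OF t] by blast
      obtain x where "x \<in> S" "\<Phi> x = X" using surj X(1) by blast
      then show ?thesis using X(2) by blast
    qed
  qed (use S br j in \<open>auto simp: linear_add linear_cmul\<close>)
  have \<Phi>_zero: "\<Phi> 0 = 0" using \<Phi>(3)[rule_format, of 0 0] by (simp add: fscale_def fun_eq_iff)
  \<comment> \<open>Inherited from the injectivity of the pushed frame.\<close>
  have \<Phi>_inj: "x = y" if "x \<in> S" "y \<in> S" "\<Phi> x = \<Phi> y" for x y
    by (rule F.\<Phi>_inj[OF that(1,2)]) (simp add: that(3))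
  \<comment> \<open>\<open>commutator_space\<close> spans over the scalar action by constant
    functions, so its span rules come from this module structure and not from
    \<open>scaleR\<close>.\<close>
  have module: "module (\<lambda>c. fscale (\<lambda>_. c) :: 'g vfield \<Rightarrow> 'g vfield)"
    by unfold_locales (simp_all add: fscale_def fun_eq_iff algebra_simps)
  have der: "derived_series LF k = \<Phi> ` der_ser br S k" for k
  proof (induction k)
    case 0
    show ?case using surj \<Phi>(1) by auto
  next
    case (Suc k)
    let ?X = "{br x y |x y. x \<in> der_ser br S k \<and> y \<in> der_ser br S k}"
    have gen: "{lie_bracket X Y |X Y. X \<in> derived_series LF k \<and> Y \<in> derived_series LF k} = \<Phi> ` ?X"
    proof (intro equalityI subsetI)
      fix Z assume "Z \<in> {lie_bracket X Y |X Y. X \<in> derived_series LF k \<and> Y \<in> derived_series LF k}"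
      then obtain x y where "x \<in> der_ser br S k" "y \<in> der_ser br S k" "Z = lie_bracket (\<Phi> x) (\<Phi> y)"
        unfolding Suc by blast
      then show "Z \<in> \<Phi> ` ?X" unfolding \<Phi>_br[rule_format, symmetric] by blast
    next
      fix Z assume "Z \<in> \<Phi> ` ?X"
      then obtain x y where "x \<in> der_ser br S k" "y \<in> der_ser br S k" "Z = lie_bracket (\<Phi> x) (\<Phi> y)"
        using \<Phi>_br by blast
      then show "Z \<in> {lie_bracket X Y |X Y. X \<in> derived_series LF k \<and> Y \<in> derived_series LF k}"
        unfolding Suc by blast
    qed
    have "module.span (\<lambda>c. fscale (\<lambda>_. c)) (\<Phi> ` ?X) = \<Phi> ` span ?X"
    proof
      have "module.subspace (\<lambda>c. fscale (\<lambda>_. c)) (\<Phi> ` span ?X)"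
        unfolding module.subspace_def[OF module]
      proof (intro conjI ballI allI)
        show "0 \<in> \<Phi> ` span ?X" using imageI[OF span_zero, of \<Phi>] by (simp only: \<Phi>_zero)
        fix X assume "X \<in> \<Phi> ` span ?X"
        then obtain x where x: "x \<in> span ?X" "X = \<Phi> x" by blast
        show "fscale (\<lambda>_. c) X \<in> \<Phi> ` span ?X" for c
          unfolding x(2) \<Phi>(3)[rule_format, symmetric] by (rule imageI[OF span_scale[OF x(1)]])
        fix Y assume "Y \<in> \<Phi> ` span ?X"
        then obtain y where y: "y \<in> span ?X" "Y = \<Phi> y" by blast
        show "X + Y \<in> \<Phi> ` span ?X"
          unfolding x(2) y(2) \<Phi>(2)[rule_format, symmetric] by (rule imageI[OF span_add[OF x(1) y(1)]])
      qed
      then show "module.span (\<lambda>c. fscale (\<lambda>_. c)) (\<Phi> ` ?X) \<subseteq> \<Phi> ` span ?X"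
        by (rule module.span_minimal[OF module image_mono[OF span_superset]])
      let ?sp = "module.span (\<lambda>c. fscale (\<lambda>_. c)) (\<Phi> ` ?X)"
      have "subspace {x. \<Phi> x \<in> ?sp}"
        unfolding subspace_def mem_Collect_eq \<Phi>_zero
      proof (intro conjI ballI allI, unfold mem_Collect_eq)
        show "0 \<in> ?sp" by (rule module.span_zero[OF module])
        show "\<Phi> (x + y) \<in> ?sp" if "\<Phi> x \<in> ?sp" "\<Phi> y \<in> ?sp" for x y
          unfolding \<Phi>(2)[rule_format] by (rule module.span_add[OF module that])
        show "\<Phi> (c *\<^sub>R x) \<in> ?sp" if "\<Phi> x \<in> ?sp" for c x
          unfolding \<Phi>(3)[rule_format] by (rule module.span_scale[OF module that])
      qed
      then have sp: "span ?X \<subseteq> {x. \<Phi> x \<in> ?sp}"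
      proof (rule span_minimal[rotated])
        show "?X \<subseteq> {x. \<Phi> x \<in> ?sp}" using module.span_superset[OF module, of "\<Phi> ` ?X"] by blast
      qed
      show "\<Phi> ` span ?X \<subseteq> ?sp"
      proof (rule image_subsetI)
        show "\<Phi> x \<in> ?sp" if "x \<in> span ?X" for x using subsetD[OF sp that] by simp
      qed
    qed
    then show ?case unfolding derived_series.simps commutator_space_def der_ser.simps gen .
  qed
  have der_S: "der_ser br S k \<subseteq> S" for k by (rule F.C.der_ser_subset)
  obtain k where "derived_series LF k = {0}" using solv unfolding solvable_lie_algebra_def by blast
  then have k: "\<Phi> ` der_ser br S k = {0}" unfolding der .
  have "der_ser br S k = {0}"
  proof
    show "der_ser br S k \<subseteq> {0}"
    proof
      fix x assume x: "x \<in> der_ser br S k"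
      have "\<Phi> x \<in> {0}" unfolding k[symmetric] by (rule imageI[OF x])
      then have "\<Phi> x = \<Phi> 0" using \<Phi>_zero by simp
      then show "x \<in> {0}" using \<Phi>_inj[OF subsetD[OF der_S x] subspace_0[OF S]] by simp
    qed
    show "{0} \<subseteq> der_ser br S k" using subspace_0[OF F.C.subspace_der_ser] by simp
  qed
  moreover have "j ` der_ser br S 1 = der_ser br S 1"
  proof -
    have c: "commutator_space LF LF = \<Phi> ` der_ser br S 1"
      using der[of 1] unfolding One_nat_def derived_series.simps .
    \<comment> \<open>\<open>\<Phi>\<close> intertwines \<open>j\<close> with \<open>J'\<close>, so
      the condition on the commutator becomes an equation of images, and injectivity on
      \<open>S\<close> removes \<open>\<Phi>\<close>.\<close>
    have e: "\<Phi> ` (j ` der_ser br S 1) = \<Phi> ` der_ser br S 1"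
      using J'[unfolded c image_image \<Phi>_j[rule_format, symmetric]] unfolding image_image .
    have inj: "inj_on \<Phi> S" by (rule inj_onI) (rule \<Phi>_inj)
    have sub: "j ` der_ser br S 1 \<subseteq> S" by (rule image_subsetI) (rule j(2)[rule_format])
    show ?thesis by (rule iffD1[OF inj_on_image_eq_iff[OF inj sub der_S] e])
  qed
  ultimately show ?thesis using const by (rule F.chern_flat)
qed

end

theorem theorem1:
  fixes G :: "('g, 'b) monoid_scheme" and T :: "'g topology"
    and A :: "('g, 'v::euclidean_space) chart set" and \<Gamma> :: "'g set"
    and J :: "'g set endo_field" and g :: "'g set metric_field"
    and J' :: "'g endo_field" and g' :: "'g metric_field"
    and nabla :: "'g set connection" and c :: real
  defines "\<gg> \<equiv> left_invariant_fields G A"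
    and "M \<equiv> left_quotient_atlas G T A \<Gamma>"
  assumes "lie_hermitian_manifold G T A \<Gamma> J g J' g'"
    and "solvable_lie_algebra \<gg>"
    and "endo_app J' ` commutator_space \<gg> \<gg> = commutator_space \<gg> \<gg>"
    and "chern_connection M J g nabla"
    and "const_hol_sect_curv M J g nabla c"
  shows "flat_connection M g nabla"
proof -
  note lh = assms(3)[unfolded lie_hermitian_manifold_def Let_def]
  interpret lie_quotient G T A J' g' \<Gamma> J g
  proof (intro lie_quotient.intro herm_group.intro smooth_group.intro smooth_mfd.intro
      smooth_group_axioms.intro herm_group_axioms.intro lie_quotient_axioms.intro)
    show "smooth_manifold T A" using lh by (simp add: hermitian_manifold_def)
  qed (use lh in blast)+
  show ?thesis
    using constant_hol_sect_curv_flat assms(4-7) unfolding \<gg>_def M_def by blast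
qed

end
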